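(* Let $\theta$ be an irrational number. A smooth automorphism of the Flip orbifold that induces the identity map on $K_0(A_\theta^\Phi)=\mathbb Z^6$ necessarily induces the identity map on the zeroth cyclic cohomology group $HC^0(A_\theta^{\infty,\Phi})=\mathbb C^5$.
   Context: Write $e(t):=e^{2\pi i t}$. For irrational $\theta$, $A_\theta$ is the universal C*-algebra generated by unitaries $U,V$ with $VU=e^{2\pi i\theta}UV$. $A_\theta^\infty$ is the canonical smooth dense *-subalgebra of rapidly decreasing Laurent series $\sum a_{mn}U^mV^n$. The Flip is the automorphism $\Phi(U)=U^{-1}$, $\Phi(V)=V^{-1}$; the Flip orbifold is $A_\theta^\Phi=\{x\in A_\theta:\Phi(x)=x\}$ and the smooth Flip orbifold is $A_\theta^{\infty,\Phi}=A_\theta^\infty\cap A_\theta^\Phi$, a dense *-subalgebra of $A_\theta^\Phi$ closed under the holomorphic functional calculus, so that $K_0(A_\theta^{\infty,\Phi})=K_0(A_\theta^\Phi)$. A smooth automorphism of the Flip orbifold is an automorphism of $A_\theta^\Phi$ mapping $A_\theta^{\infty,\Phi}$ onto itself. $HC^0(A_\theta^{\infty,\Phi})$ is the zeroth cyclic cohomology, i.e. the complex vector space of traces on $A_\theta^{\infty,\Phi}$; it is 5-dimensional, spanned by the canonical (bounded) trace $\tau$ and the four unbounded traces $\phi_{jk}$, $jk\in\{00,01,10,11\}$, which are the restrictions to $A_\theta^{\infty,\Phi}$ of the linear functionals on $A_\theta^\infty$ given by $\phi_{jk}(U^mV^n)=e(-\tfrac{\theta}{2}mn)\,\delta_2^{m-j}\,\delta_2^{n-k}$,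 where $\delta_2^n=1$ if $n$ is even and $0$ if $n$ is odd. A smooth automorphism $\beta$ acts on $HC^0(A_\theta^{\infty,\Phi})$ by $\phi\mapsto\phi\circ\beta$. *)

theory Defs
  imports "HOL-Analysis.Analysis" "HOL-Algebra.Group" "Jordan_Normal_Form.Matrix"
begin

section \<open>Unital C*-algebras\<close>

text \<open>The distribution has neither complex Banach algebras nor C*-algebras. The superclass
  \<^class>\<open>real_normed_algebra_1\<close> supplies a submultiplicative norm with \<open>norm 1 = 1\<close>.\<close>

class cstar_algebra = real_normed_algebra_1 + complete_space +
  fixes scaleC :: "complex \<Rightarrow> 'a \<Rightarrow> 'a"  (infixr \<open>*\<^sub>C\<close> 75)
    and star :: "'a \<Rightarrow> 'a"
  assumes scaleC_add_right: "c *\<^sub>C (x + y) = c *\<^sub>C x + c *\<^sub>C y"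
    and scaleC_add_left: "(c + d) *\<^sub>C x = c *\<^sub>C x + d *\<^sub>C x"
    and scaleC_scaleC: "c *\<^sub>C d *\<^sub>C x = (c * d) *\<^sub>C x"
    and scaleR_scaleC: "r *\<^sub>R x = complex_of_real r *\<^sub>C x"
    and mult_scaleC_left: "(c *\<^sub>C x) * y = c *\<^sub>C (x * y)"
    and mult_scaleC_right: "x * (c *\<^sub>C y) = c *\<^sub>C (x * y)"
    and norm_scaleC: "norm (c *\<^sub>C x) = cmod c * norm x"
    and star_star: "star (star x) = x"
    and star_add: "star (x + y) = star x + star y"
    and star_scaleC: "star (c *\<^sub>C x) = cnj c *\<^sub>C star x"
    and star_mult: "star (x * y) = star y * star x"
    and cstar_identity: "norm (star x * x) = (norm x)\<^sup>2"

definition unitary :: "'a::cstar_algebra \<Rightarrow> bool" where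
  "unitary u \<longleftrightarrow> star u * u = 1 \<and> u * star u = 1"

definition star_subalgebra :: "'a::cstar_algebra set \<Rightarrow> bool" where
  "star_subalgebra B \<longleftrightarrow> 0 \<in> B \<and>
     (\<forall>x\<in>B. \<forall>y\<in>B. x + y \<in> B \<and> x * y \<in> B) \<and>
     (\<forall>x\<in>B. star x \<in> B \<and> (\<forall>c. c *\<^sub>C x \<in> B))"

text \<open>Only the values of \<open>f\<close> on \<open>B\<close> matter.\<close>

definition star_automorphism :: "'a::cstar_algebra set \<Rightarrow> ('a \<Rightarrow> 'a) \<Rightarrow> bool" where
  "star_automorphism B f \<longleftrightarrow> bij_betw f B B \<and>
     (\<forall>x\<in>B. \<forall>y\<in>B. f (x + y) = f x + f y \<and> f (x * y) = f x * f y) \<and>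
     (\<forall>x\<in>B. f (star x) = star (f x) \<and> (\<forall>c. f (c *\<^sub>C x) = c *\<^sub>C f x))"


section \<open>The irrational rotation algebra\<close>

definition e_exp :: "real \<Rightarrow> complex" where
  "e_exp t = exp (2 * complex_of_real pi * \<i> * complex_of_real t)"

text \<open>Integer powers of a unitary (\<open>powi\<close> needs an \<open>inverse\<close> operation on the type).\<close>

definition upow :: "'a::cstar_algebra \<Rightarrow> int \<Rightarrow> 'a" where
  "upow u k = (if 0 \<le> k then u ^ nat k else star u ^ nat (- k))"

definition umonom :: "'a::cstar_algebra \<Rightarrow> 'a \<Rightarrow> int \<times> int \<Rightarrow> 'a" where
  "umonom U V = (\<lambda>(m, n). upow U m * upow V n)"

text \<open>The formal *-algebra presented by two unitaries \<open>U\<close>, \<open>V\<close> with \<open>V U = e(\<theta>) U V\<close>: a finitely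
  supported \<open>a\<close> stands for the Laurent polynomial with coefficient \<open>a (m, n)\<close> at
  \<open>U\<^sup>m V\<^sup>n\<close>. The phases come from
  \<open>(U\<^sup>p V\<^sup>q) (U\<^sup>r V\<^sup>s) = e(\<theta> q r) U\<^sup>p\<^sup>+\<^sup>r V\<^sup>q\<^sup>+\<^sup>s\<close> and \<open>(U\<^sup>-\<^sup>m V\<^sup>-\<^sup>n)\<^sup>* = V\<^sup>n U\<^sup>m = e(\<theta> m n) U\<^sup>m V\<^sup>n\<close>.\<close>

definition laurent_polys :: "(int \<times> int \<Rightarrow> complex) set" where
  "laurent_polys = {a. finite {z. a z \<noteq> 0}}"

definition twisted_mult ::
  "real \<Rightarrow> (int \<times> int \<Rightarrow> complex) \<Rightarrow> (int \<times> int \<Rightarrow> complex) \<Rightarrow> int \<times> int \<Rightarrow> complex" where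
  "twisted_mult \<theta> a b = (\<lambda>(m, n).
     \<Sum>(p, q)\<in>{z. a z \<noteq> 0}. a (p, q) * b (m - p, n - q) * e_exp (\<theta> * of_int (q * (m - p))))"

definition twisted_star :: "real \<Rightarrow> (int \<times> int \<Rightarrow> complex) \<Rightarrow> int \<times> int \<Rightarrow> complex" where
  "twisted_star \<theta> a = (\<lambda>(m, n). cnj (a (- m, - n)) * e_exp (\<theta> * of_int (m * n)))"

definition laurent_eval :: "'a::cstar_algebra \<Rightarrow> 'a \<Rightarrow> (int \<times> int \<Rightarrow> complex) \<Rightarrow> 'a" where
  "laurent_eval U V a = (\<Sum>z\<in>{z. a z \<noteq> 0}. a z *\<^sub>C umonom U V z)"

definition cstar_seminorm :: "real \<Rightarrow> ((int \<times> int \<Rightarrow> complex) \<Rightarrow> real) \<Rightarrow> bool" where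
  "cstar_seminorm \<theta> s \<longleftrightarrow>
     (\<forall>a\<in>laurent_polys. 0 \<le> s a \<and> (\<forall>c. s (\<lambda>z. c * a z) = cmod c * s a) \<and>
        s (twisted_mult \<theta> (twisted_star \<theta> a) a) = (s a)\<^sup>2) \<and>
     (\<forall>a\<in>laurent_polys. \<forall>b\<in>laurent_polys.
        s (\<lambda>z. a z + b z) \<le> s a + s b \<and> s (twisted_mult \<theta> a b) \<le> s a * s b)"

text \<open>The type \<open>'a\<close> with \<open>U\<close>, \<open>V\<close> is (a copy of) \<open>A\<^sub>\<theta>\<close>. HOL cannot quantify over all
  C*-algebras inside a formula, so universality is expressed by C*-seminorms on the formal
  *-algebra: these are precisely the functions \<open>a \<mapsto> \<parallel>a(u, v)\<parallel>\<close> for unitaries \<open>u\<close>, \<open>v\<close> in some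
  C*-algebra with \<open>v u = e(\<theta>) u v\<close>, and the universal C*-algebra is by construction the
  completion in the largest of them.\<close>

locale rotation_algebra =
  fixes \<theta> :: real and U V :: "'a::cstar_algebra"
  assumes unitary_U: "unitary U"
    and unitary_V: "unitary V"
    and commutation: "V * U = e_exp \<theta> *\<^sub>C (U * V)"
    and generated: "\<And>B. \<lbrakk>star_subalgebra B; closed B; U \<in> B; V \<in> B\<rbrakk> \<Longrightarrow> B = UNIV"
    and universal: "\<And>s a. \<lbrakk>cstar_seminorm \<theta> s; a \<in> laurent_polys\<rbrakk>
                     \<Longrightarrow> s a \<le> norm (laurent_eval U V a)"


section \<open>The smooth subalgebra and the Flip orbifold\<close>

definition weight :: "int \<times> int \<Rightarrow> real" where
  "weight = (\<lambda>(m, n). 1 + \<bar>of_int m\<bar> + \<bar>of_int n\<bar>)"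

definition rapidly_decreasing :: "(int \<times> int \<Rightarrow> complex) \<Rightarrow> bool" where
  "rapidly_decreasing a \<longleftrightarrow> (\<forall>k::nat. bdd_above (range (\<lambda>z. weight z ^ k * cmod (a z))))"

definition schwartz_norm :: "nat \<Rightarrow> (int \<times> int \<Rightarrow> complex) \<Rightarrow> real" where
  "schwartz_norm k a = (SUP z. weight z ^ k * cmod (a z))"

definition smooth_series ::
  "'a::cstar_algebra \<Rightarrow> 'a \<Rightarrow> (int \<times> int \<Rightarrow> complex) \<Rightarrow> 'a \<Rightarrow> bool" where
  "smooth_series U V a x \<longleftrightarrow>
     rapidly_decreasing a \<and> ((\<lambda>z. a z *\<^sub>C umonom U V z) has_sum x) UNIV"

definition smooth_algebra :: "'a::cstar_algebra \<Rightarrow> 'a \<Rightarrow> 'a set" where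
  "smooth_algebra U V = {x. \<exists>a. smooth_series U V a x}"

text \<open>On the rotation algebra there is exactly one such \<open>\<Phi>\<close>.\<close>

definition is_flip :: "'a::cstar_algebra \<Rightarrow> 'a \<Rightarrow> ('a \<Rightarrow> 'a) \<Rightarrow> bool" where
  "is_flip U V \<Phi> \<longleftrightarrow> star_automorphism UNIV \<Phi> \<and> \<Phi> U = star U \<and> \<Phi> V = star V"

definition flip_orbifold :: "('a::cstar_algebra \<Rightarrow> 'a) \<Rightarrow> 'a set" where
  "flip_orbifold \<Phi> = {x. \<Phi> x = x}"

definition smooth_flip_orbifold :: "'a::cstar_algebra \<Rightarrow> 'a \<Rightarrow> ('a \<Rightarrow> 'a) \<Rightarrow> 'a set" where
  "smooth_flip_orbifold U V \<Phi> = smooth_algebra U V \<inter> flip_orbifold \<Phi>"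

definition smooth_automorphism ::
  "'a::cstar_algebra \<Rightarrow> 'a \<Rightarrow> ('a \<Rightarrow> 'a) \<Rightarrow> ('a \<Rightarrow> 'a) \<Rightarrow> bool" where
  "smooth_automorphism U V \<Phi> \<beta> \<longleftrightarrow> star_automorphism (flip_orbifold \<Phi>) \<beta> \<and>
     \<beta> ` smooth_flip_orbifold U V \<Phi> = smooth_flip_orbifold U V \<Phi>"


section \<open>The group K0 of a unital C*-subalgebra\<close>

definition mat_star :: "'a::cstar_algebra mat \<Rightarrow> 'a mat" where
  "mat_star A = mat (dim_col A) (dim_row A) (\<lambda>(i, j). star (A $$ (j, i)))"

definition mat_projections :: "'a::cstar_algebra set \<Rightarrow> 'a mat set" where
  "mat_projections B =
     {p. square_mat p \<and> elements_mat p \<subseteq> B \<and> p * p = p \<and> mat_star p = p}"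

text \<open>Murray-von Neumann equivalence of projections of possibly different sizes, via a
  rectangular partial isometry.\<close>

definition mvn_equiv :: "'a::cstar_algebra set \<Rightarrow> 'a mat \<Rightarrow> 'a mat \<Rightarrow> bool" where
  "mvn_equiv B p q \<longleftrightarrow> (\<exists>v\<in>carrier_mat (dim_row q) (dim_row p).
     elements_mat v \<subseteq> B \<and> mat_star v * v = p \<and> v * mat_star v = q)"

definition dsum :: "'a::cstar_algebra mat \<Rightarrow> 'a mat \<Rightarrow> 'a mat"  (infixl \<open>\<oplus>\<^sub>m\<close> 65) where
  "p \<oplus>\<^sub>m q = four_block_mat p (0\<^sub>m (dim_row p) (dim_col q)) (0\<^sub>m (dim_row q) (dim_col p)) q"

text \<open>Grothendieck group of the semigroup of Murray-von Neumann classes: the pair \<open>(p, q)\<close>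
  represents \<open>[p] - [q]\<close>.\<close>

definition K0_rel :: "'a::cstar_algebra set \<Rightarrow> (('a mat \<times> 'a mat) \<times> ('a mat \<times> 'a mat)) set" where
  "K0_rel B = {((p, q), (p', q')).
     p \<in> mat_projections B \<and> q \<in> mat_projections B \<and>
     p' \<in> mat_projections B \<and> q' \<in> mat_projections B \<and>
     (\<exists>r\<in>mat_projections B. mvn_equiv B (p \<oplus>\<^sub>m q' \<oplus>\<^sub>m r) (p' \<oplus>\<^sub>m q \<oplus>\<^sub>m r))}"

definition K0 :: "'a::cstar_algebra set \<Rightarrow> ('a mat \<times> 'a mat) set monoid" where
  "K0 B = \<lparr>carrier = (mat_projections B \<times> mat_projections B) // K0_rel B,
     mult = (\<lambda>X Y. \<Union>(p, q)\<in>X. \<Union>(p', q')\<in>Y. K0_rel B `` {(p \<oplus>\<^sub>m p', q \<oplus>\<^sub>m q')}),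
     one = K0_rel B `` {(0\<^sub>m 0 0, 0\<^sub>m 0 0)}\<rparr>"

definition K0_map :: "'a::cstar_algebra set \<Rightarrow> ('a \<Rightarrow> 'a) \<Rightarrow>
    ('a mat \<times> 'a mat) set \<Rightarrow> ('a mat \<times> 'a mat) set" where
  "K0_map B \<beta> X = (\<Union>(p, q)\<in>X. K0_rel B `` {(map_mat \<beta> p, map_mat \<beta> q)})"


section \<open>Zeroth cyclic cohomology of the smooth Flip orbifold\<close>

text \<open>As usual for cyclic cohomology of Frechet algebras, traces are continuous for the
  Frechet topology of rapidly decreasing coefficients (they may be unbounded for the C*-norm).
  For Liouville \<open>\<theta>\<close> this matters: there the space of all algebraic traces is not 5-dimensional,
  whereas the space of continuous ones always is.
  Functionals are \<^const>\<open>extensional\<close>, so that equality in \<open>HC0\<close> is equality on the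
  smooth orbifold.\<close>

definition HC0 :: "'a::cstar_algebra \<Rightarrow> 'a \<Rightarrow> ('a \<Rightarrow> 'a) \<Rightarrow> ('a \<Rightarrow> complex) set" where
  "HC0 U V \<Phi> = {\<phi> \<in> extensional (smooth_flip_orbifold U V \<Phi>).
     (\<forall>x\<in>smooth_flip_orbifold U V \<Phi>. \<forall>c. \<phi> (c *\<^sub>C x) = c * \<phi> x) \<and>
     (\<forall>x\<in>smooth_flip_orbifold U V \<Phi>. \<forall>y\<in>smooth_flip_orbifold U V \<Phi>.
        \<phi> (x + y) = \<phi> x + \<phi> y \<and> \<phi> (x * y) = \<phi> (y * x)) \<and>
     (\<exists>k C. \<forall>x\<in>smooth_flip_orbifold U V \<Phi>. \<forall>a.
        smooth_series U V a x \<longrightarrow> cmod (\<phi> x) \<le> C * schwartz_norm k a)}"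

definition HC0_map :: "'a::cstar_algebra \<Rightarrow> 'a \<Rightarrow> ('a \<Rightarrow> 'a) \<Rightarrow> ('a \<Rightarrow> 'a) \<Rightarrow>
    ('a \<Rightarrow> complex) \<Rightarrow> 'a \<Rightarrow> complex" where
  "HC0_map U V \<Phi> \<beta> \<phi> = compose (smooth_flip_orbifold U V \<Phi>) \<phi> \<beta>"

end

theory Submission
  imports Defs
begin

text \<open>
Let \<open>\<phi>\<close> be a continuous trace on the smooth orbifold and let \<open>\<psi> = \<phi> \<circ> \<beta> - \<phi>\<close>. Three facts show that
\<open>\<psi>\<close> vanishes.

First, \<open>\<psi>\<close> is again a continuous trace. The automorphism \<open>\<beta>\<close> is contractive for the C*-norm
(\<open>star_automorphism_contractive\<close>), and Fourier coefficients are bounded by the C*-norm, because averaging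
over inner automorphisms isolates a coefficient (\<open>norm_finite_series_ge_0\<close>). A uniform boundedness argument
then makes \<open>\<beta>\<close> continuous for the Frechet topology (\<open>auto_frechet_continuous\<close>).

Second, \<open>\<psi>\<close> vanishes on all projections in matrices over the smooth orbifold. Since \<open>\<beta>\<close> is trivial on
\<open>K\<^sub>0\<close>, a projection \<open>p\<close> and its image \<open>\<beta> p\<close> have the same class there; but the equivalence is
implemented over the C*-algebra, where \<open>\<phi>\<close> is not defined. It can be moved into the smooth subalgebra
(\<open>trace_eq_of_K0_rel\<close>), because inverses of smooth matrices close to the identity are smooth. The reason
for the latter is a family of submultiplicative norms, built from the norms of \<open>x\<close> and its derivatives and
depending on a parameter \<open>t\<close>, which tends to the C*-norm as \<open>t\<close> tends to \<open>0\<close> (\<open>jet_norm_mult\<close>,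
\<open>ex_jet_norm_less_1\<close>). Geometric and binomial series that converge in the C*-norm therefore converge
with all derivatives.

Third, projections separate the continuous traces. Commutators of the elements
\<open>U\<^sup>m V\<^sup>n + U\<^sup>-\<^sup>m V\<^sup>-\<^sup>n\<close>, normalised by phases, show that a continuous trace has the form
\<open>\<alpha> \<tau> + \<Sum> \<kappa>\<^sub>j\<^sub>k \<phi>\<^sub>j\<^sub>k\<close> (\<open>continuous_trace_formula\<close>). For \<open>w\<close> in \<open>{0, 1} \<times> {0, 1}\<close> let \<open>W\<close> be the
corresponding monomial; the elements \<open>y\<close> with \<open>W \<Phi>(y) = - y\<close> form a finitely generated projective module
over the orbifold. Irrationality provides a frame \<open>y\<^sub>1, y\<^sub>2\<close> with \<open>\<Sum> y\<^sub>i y\<^sub>i\<^sup>* = 1\<close>, and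
\<open>p = (y\<^sub>i\<^sup>* y\<^sub>j)\<close> is a projection over the smooth orbifold (\<open>ex_flip_projection\<close>). On the whole smooth
algebra the \<open>\<phi>\<^sub>j\<^sub>k\<close> satisfy \<open>\<phi>\<^sub>j\<^sub>k (x y) = \<phi>\<^sub>j\<^sub>k (\<Phi>(y) x)\<close>, so that \<open>\<phi>\<^sub>j\<^sub>k\<close> of \<open>\<Sum> y\<^sub>i\<^sup>* y\<^sub>i\<close> is
\<open>- \<phi>\<^sub>j\<^sub>k (W\<^sup>*)\<close>, which is \<open>- 1\<close> for \<open>jk = w\<close> and \<open>0\<close> otherwise, while \<open>\<tau>\<close> takes the value \<open>1\<close>.
These four projections and the unit give the equations \<open>\<alpha> = \<kappa>\<^sub>j\<^sub>k\<close> and \<open>\<alpha> = - \<kappa>\<^sub>0\<^sub>0\<close>, whose only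
solution is zero (\<open>continuous_trace_eq_0\<close>).
\<close>

section \<open>C*-algebras and their *-homomorphisms\<close>

instance cstar_algebra \<subseteq> banach ..

lemma scaleC_zero_left [simp]: "0 *\<^sub>C (x::'a::cstar_algebra) = 0"
  using scaleC_add_left[of 0 0 x] by simp

lemma scaleC_zero_right [simp]: "c *\<^sub>C (0::'a::cstar_algebra) = 0"
  using scaleC_add_right[of c 0 0] by simp

lemma scaleC_one [simp]: "1 *\<^sub>C (x::'a::cstar_algebra) = x"
  using scaleR_scaleC[of 1 x] by simp

lemma scaleC_minus_left: "(- c) *\<^sub>C (x::'a::cstar_algebra) = - (c *\<^sub>C x)"
  using minus_unique[of "c *\<^sub>C x" "(- c) *\<^sub>C x"] scaleC_add_left[of c "- c" x] by simp

lemma scaleC_minus_right: "c *\<^sub>C (- x::'a::cstar_algebra) = - (c *\<^sub>C x)"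
  using minus_unique[of "c *\<^sub>C x" "c *\<^sub>C (- x)"] scaleC_add_right[of c x "- x"] by simp

lemma scaleC_diff_right: "c *\<^sub>C (x - y::'a::cstar_algebra) = c *\<^sub>C x - c *\<^sub>C y"
  using scaleC_add_right[of c x "- y"] by (simp add: scaleC_minus_right)

lemma scaleC_diff_left: "(c - d) *\<^sub>C (x::'a::cstar_algebra) = c *\<^sub>C x - d *\<^sub>C x"
  using scaleC_add_left[of c "- d" x] by (simp add: scaleC_minus_left)

lemma scaleC_sum_left: "(\<Sum>i\<in>I. f i) *\<^sub>C (x::'a::cstar_algebra) = (\<Sum>i\<in>I. f i *\<^sub>C x)"
  by (induction I rule: infinite_finite_induct) (auto simp: scaleC_add_left)

lemma scaleC_sum_right: "c *\<^sub>C (\<Sum>i\<in>I. f i::'a::cstar_algebra) = (\<Sum>i\<in>I. c *\<^sub>C f i)"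
  by (induction I rule: infinite_finite_induct) (auto simp: scaleC_add_right)

lemma scaleC_2: "2 *\<^sub>C (x::'a::cstar_algebra) = x + x"
  using scaleC_add_left[of 1 1 x] by simp

lemma star_zero [simp]: "star (0::'a::cstar_algebra) = 0"
  using star_add[of 0 "0::'a"] by simp

lemma star_one [simp]: "star (1::'a::cstar_algebra) = 1"
  by (metis mult_1 mult_1_right star_mult star_star)

lemma star_minus: "star (- x::'a::cstar_algebra) = - star x"
  using minus_unique[of "star x" "star (- x)"] star_add[of x "- x"] by simp

lemma star_diff: "star (x - y::'a::cstar_algebra) = star x - star y"
  using star_add[of x "- y"] by (simp add: star_minus)

lemma star_power: "star (x ^ n) = star (x::'a::cstar_algebra) ^ n"
  by (induction n) (auto simp: star_mult power_commutes)

lemma star_scaleR: "star (r *\<^sub>R x) = r *\<^sub>R star (x::'a::cstar_algebra)"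
  by (simp add: scaleR_scaleC star_scaleC)

lemma norm_star [simp]: "norm (star x) = norm (x::'a::cstar_algebra)"
proof -
  have le: "norm y \<le> norm (star y)" for y :: 'a
  proof (cases "norm y = 0")
    case False
    have "norm y * norm y \<le> norm (star y) * norm y"
      using cstar_identity[of y] norm_mult_ineq[of "star y" y] by (simp add: power2_eq_square)
    then show ?thesis using False by simp
  qed simp
  show ?thesis using le[of x] le[of "star x"] by (simp add: star_star)
qed

lemma bounded_linear_star: "bounded_linear (star :: 'a::cstar_algebra \<Rightarrow> 'a)"
  by (rule bounded_linear_intro[where K = 1]) (auto simp: star_add star_scaleR)

lemma bounded_linear_scaleC_right: "bounded_linear (\<lambda>x::'a::cstar_algebra. c *\<^sub>C x)"
  by (rule bounded_linear_intro[where K = "cmod c"])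
    (auto simp: scaleC_add_right norm_scaleC scaleR_scaleC scaleC_scaleC mult.commute)

lemma bounded_linear_scaleC_left: "bounded_linear (\<lambda>c. c *\<^sub>C (x::'a::cstar_algebra))"
  by (rule bounded_linear_intro[where K = "norm x"])
    (auto simp: scaleC_add_left norm_scaleC scaleR_scaleC scaleC_scaleC scaleR_conv_of_real)

lemma norm_unitary: "unitary u \<Longrightarrow> norm (u::'a::cstar_algebra) = 1"
proof -
  assume "unitary u"
  then have "(norm u)\<^sup>2 = 1" using cstar_identity[of u] by (simp add: unitary_def)
  then show "norm u = 1" using norm_ge_zero[of u] by (auto simp: power2_eq_1_iff)
qed

lemma norm_unitary_conj_le:
  assumes "unitary (u::'a::cstar_algebra)"
  shows "norm (u * x * star u) \<le> norm x"
proof -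
  have "norm (u * x * star u) \<le> norm u * norm x * norm (star u)"
    by (meson norm_ge_zero norm_mult_ineq mult_right_mono order_trans)
  then show ?thesis using norm_unitary[OF assms] by simp
qed

lemma unitary_star: "unitary (u::'a::cstar_algebra) \<Longrightarrow> unitary (star u)"
  by (simp add: unitary_def star_star)

lemma unitary_mult: "unitary u \<Longrightarrow> unitary (v::'a::cstar_algebra) \<Longrightarrow> unitary (u * v)"
proof -
  assume u: "unitary u" and v: "unitary v"
  have "star (u * v) * (u * v) = star v * (star u * u) * v"
    and "u * v * star (u * v) = u * (v * star v) * star u"
    by (simp_all add: star_mult mult.assoc)
  then show "unitary (u * v)" using u v by (simp add: unitary_def)
qed

lemma unitary_scaleC: "unitary u \<Longrightarrow> cmod c = 1 \<Longrightarrow> unitary (c *\<^sub>C (u::'a::cstar_algebra))"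
proof -
  assume u: "unitary u" and c: "cmod c = 1"
  have "cnj c * c = 1" "c * cnj c = 1"
    using complex_norm_square[of c] c by (simp_all add: mult.commute)
  then show "unitary (c *\<^sub>C u)"
    using u by (simp add: unitary_def star_scaleC mult_scaleC_left mult_scaleC_right scaleC_scaleC)
qed

text \<open>The coefficients of the binomial series of \<open>(1 - t)\<^sup>-\<^sup>1\<^sup>/\<^sup>2\<close>.\<close>

definition isqrt_coeff :: "nat \<Rightarrow> real" where
  "isqrt_coeff n = (-1) ^ n * ((- 1 / 2) gchoose n)"

lemma abs_isqrt_coeff: "\<bar>isqrt_coeff n\<bar> \<le> 1"
proof (induction n)
  case (Suc n)
  have "isqrt_coeff (Suc n) = isqrt_coeff n * ((1 / 2 + real n) / (real n + 1))"
  proof -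
    have "(- 1 / 2 gchoose Suc n) = - ((1 / 2 + real n) / (real n + 1)) * ((- 1 / 2) gchoose n)"
      using gbinomial_mult_1[of "- 1 / 2 :: real" n] by (simp add: field_simps)
    then show ?thesis by (simp add: isqrt_coeff_def)
  qed
  moreover have "\<bar>(1 / 2 + real n) / (real n + 1)\<bar> \<le> 1" by simp
  ultimately show ?case
    using mult_le_one[OF Suc, of "\<bar>(1 / 2 + real n) / (real n + 1)\<bar>"]
    by (simp only: abs_mult abs_ge_zero)
qed (simp add: isqrt_coeff_def)

lemma isqrt_coeff_convolution: "(\<Sum>i\<le>n. isqrt_coeff i * isqrt_coeff (n - i)) = 1"
proof -
  have "(\<Sum>i\<le>n. isqrt_coeff i * isqrt_coeff (n - i))
      = (\<Sum>i\<le>n. (-1) ^ n * (((- 1 / 2) gchoose i) * ((- 1 / 2) gchoose (n - i))))"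
    by (intro sum.cong refl)
      (simp add: isqrt_coeff_def mult.assoc mult.left_commute power_add[symmetric])
  also have "\<dots> = (-1) ^ n * ((- 1) gchoose n)"
    using gbinomial_Vandermonde[of "- 1 / 2 :: real" "- 1 / 2" n]
    by (simp add: sum_distrib_left[symmetric] atLeast0AtMost)
  also have "((- 1 :: real) gchoose n) = (-1) ^ n"
    using gbinomial_minus[of "1::real" n] by (simp add: binomial_gbinomial[symmetric] add.commute)
  finally show ?thesis by (simp add: power_mult_distrib[symmetric])
qed

definition isqrt_one_minus :: "'a::{real_normed_algebra_1,banach} \<Rightarrow> 'a" where
  "isqrt_one_minus x = (\<Sum>n. isqrt_coeff n *\<^sub>R x ^ n)"

lemma summable_isqrt:
  fixes x :: "'a::{real_normed_algebra_1,banach}"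
  assumes "norm x < 1"
  shows "summable (\<lambda>n::nat. norm (isqrt_coeff n *\<^sub>R x ^ n))"
proof (rule summable_comparison_test')
  show "summable (\<lambda>n. norm x ^ n)" using assms by simp
  show "norm (norm (isqrt_coeff n *\<^sub>R x ^ n)) \<le> norm x ^ n" for n
    using mult_mono[OF abs_isqrt_coeff[of n] norm_power_ineq[of x n]] by simp
qed

lemma isqrt_one_minus_square:
  fixes x :: "'a::{real_normed_algebra_1,banach}"
  assumes "norm x < 1"
  shows "isqrt_one_minus x * isqrt_one_minus x * (1 - x) = 1"
proof -
  have "isqrt_one_minus x * isqrt_one_minus x
      = (\<Sum>n. \<Sum>i\<le>n. (isqrt_coeff i *\<^sub>R x ^ i) * (isqrt_coeff (n - i) *\<^sub>R x ^ (n - i)))"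
    unfolding isqrt_one_minus_def
    by (rule Cauchy_product) (rule summable_isqrt[OF assms])+
  also have "\<dots> = (\<Sum>n. x ^ n)"
  proof (rule arg_cong[where f = suminf], rule ext)
    fix n
    have "(\<Sum>i\<le>n. (isqrt_coeff i *\<^sub>R x ^ i) * (isqrt_coeff (n - i) *\<^sub>R x ^ (n - i)))
        = (\<Sum>i\<le>n. (isqrt_coeff i * isqrt_coeff (n - i)) *\<^sub>R x ^ n)"
      by (intro sum.cong refl) (simp add: power_add[symmetric] mult.commute)
    then show "(\<Sum>i\<le>n. (isqrt_coeff i *\<^sub>R x ^ i) * (isqrt_coeff (n - i) *\<^sub>R x ^ (n - i)))
        = x ^ n"
      by (simp add: scaleR_sum_left[symmetric] isqrt_coeff_convolution)
  qed
  finally have eq: "isqrt_one_minus x * isqrt_one_minus x = (\<Sum>n. x ^ n)" .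
  have sm: "summable (\<lambda>n. x ^ n)" using assms by (rule complete_algebra_summable_geometric)
  have "(\<Sum>n. x ^ n) * (1 - x) = (\<Sum>n. x ^ n * (1 - x))"
    by (rule suminf_mult2[OF sm])
  also have "\<dots> = (\<Sum>n. x ^ n - x ^ Suc n)"
    by (simp add: algebra_simps power_commutes)
  also have "\<dots> = 1"
    using telescope_sums'[OF summable_LIMSEQ_zero[OF sm]] by (simp add: sums_iff)
  finally show ?thesis using eq by simp
qed

lemma isqrt_one_minus_intertwine:
  fixes x y z :: "'a::{real_normed_algebra_1,banach}"
  assumes "norm x < 1" "norm y < 1" "x * z = z * y"
  shows "isqrt_one_minus x * z = z * isqrt_one_minus y"
proof -
  have pw: "x ^ n * z = z * y ^ n" for n
  proof (induction n)
    case (Suc n)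
    have "x ^ Suc n * z = x ^ n * (x * z)" by (simp add: power_commutes mult.assoc[symmetric])
    also have "\<dots> = z * y ^ n * y" using Suc by (simp add: assms(3) mult.assoc[symmetric])
    finally show ?case by (simp add: power_commutes mult.assoc)
  qed simp
  have "isqrt_one_minus x * z = (\<Sum>n. isqrt_coeff n *\<^sub>R x ^ n * z)"
    unfolding isqrt_one_minus_def
    by (rule suminf_mult2) (rule summable_norm_cancel[OF summable_isqrt[OF assms(1)]])
  also have "\<dots> = (\<Sum>n. z * (isqrt_coeff n *\<^sub>R y ^ n))" by (simp add: pw)
  also have "\<dots> = z * isqrt_one_minus y"
    unfolding isqrt_one_minus_def
    by (rule suminf_mult) (rule summable_norm_cancel[OF summable_isqrt[OF assms(2)]])
  finally show ?thesis .
qed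

lemma isqrt_one_minus_bounded_linear:
  fixes f :: "'a::{real_normed_algebra_1,banach} \<Rightarrow> 'b::{real_normed_algebra_1,banach}"
  assumes "norm x < 1" "bounded_linear f" "\<And>n. f (x ^ n) = f x ^ n"
  shows "f (isqrt_one_minus x) = isqrt_one_minus (f x)"
proof -
  interpret bounded_linear f by fact
  show ?thesis unfolding isqrt_one_minus_def
    using suminf[OF summable_norm_cancel[OF summable_isqrt[OF assms(1)]]]
    by (simp add: scaleR assms(3))
qed

lemma star_isqrt_one_minus:
  "norm (x::'a::cstar_algebra) < 1 \<Longrightarrow> star x = x \<Longrightarrow> star (isqrt_one_minus x) = isqrt_one_minus x"
  using isqrt_one_minus_bounded_linear[OF _ bounded_linear_star, of x] by (simp add: star_power)

locale closed_unital_subalgebra =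
  fixes B :: "'a::cstar_algebra set"
  assumes star_subalgebra: "star_subalgebra B" and closed: "closed B" and one: "1 \<in> B"
begin

lemma zero: "0 \<in> B" and add: "x \<in> B \<Longrightarrow> y \<in> B \<Longrightarrow> x + y \<in> B"
  and mult: "x \<in> B \<Longrightarrow> y \<in> B \<Longrightarrow> x * y \<in> B" and star: "x \<in> B \<Longrightarrow> star x \<in> B"
  and scaleC: "x \<in> B \<Longrightarrow> c *\<^sub>C x \<in> B"
  using star_subalgebra by (auto simp: star_subalgebra_def)

lemma scaleR: "x \<in> B \<Longrightarrow> r *\<^sub>R x \<in> B" by (simp add: scaleR_scaleC scaleC)
lemma uminus: "x \<in> B \<Longrightarrow> - x \<in> B" using scaleC[of x "-1"] by (simp add: scaleC_minus_left)
lemma diff: "x \<in> B \<Longrightarrow> y \<in> B \<Longrightarrow> x - y \<in> B" using add[of x "- y"] uminus by simp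
lemma sum: "(\<And>i. i \<in> I \<Longrightarrow> f i \<in> B) \<Longrightarrow> (\<Sum>i\<in>I. f i) \<in> B"
  by (induction I rule: infinite_finite_induct) (auto simp: zero add)
lemma power: "x \<in> B \<Longrightarrow> x ^ n \<in> B" by (induction n) (auto simp: one mult)

lemma suminf: "(\<And>n. f n \<in> B) \<Longrightarrow> summable f \<Longrightarrow> suminf f \<in> B"
  by (rule closed_sequentially[OF closed, of "\<lambda>n. \<Sum>i<n. f i"])
    (auto intro: sum summable_LIMSEQ)

lemma isqrt: "x \<in> B \<Longrightarrow> norm x < 1 \<Longrightarrow> isqrt_one_minus x \<in> B"
  unfolding isqrt_one_minus_def
  by (intro suminf scaleR power summable_norm_cancel[OF summable_isqrt])

text \<open>If \<open>h\<close> is self-adjoint of norm less than \<open>1\<close>, then \<open>h\<close> is the real part of the unitary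
  \<open>h + i c\<close> with \<open>c = (1 - h\<^sup>2)\<^sup>1\<^sup>/\<^sup>2\<close>. A unital *-homomorphism maps unitaries to unitaries, so it
  maps \<open>h\<close> to an element of norm at most \<open>1\<close>. The C*-identity reduces the general case to this one.\<close>

lemma star_hom_contractive:
  assumes add': "\<And>x y. x \<in> B \<Longrightarrow> y \<in> B \<Longrightarrow> f (x + y) = f x + f y"
    and mult': "\<And>x y. x \<in> B \<Longrightarrow> y \<in> B \<Longrightarrow> f (x * y) = f x * f y"
    and star': "\<And>x. x \<in> B \<Longrightarrow> f (star x) = star (f x)"
    and scaleC': "\<And>x c. x \<in> B \<Longrightarrow> f (c *\<^sub>C x) = c *\<^sub>C f x"
    and one': "f 1 = (1::'b::cstar_algebra)"
    and x: "x \<in> B"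
  shows "norm (f x) \<le> norm x"
proof -
  have small: "norm (f h) \<le> 1" if h: "h \<in> B" "star h = h" "norm h < 1" for h
  proof -
    let ?u = "\<lambda>h c. h + \<i> *\<^sub>C c"
    define g where "g = isqrt_one_minus (h * h)"
    \<comment> \<open>\<open>(1 - h\<^sup>2) (1 - h\<^sup>2)\<^sup>-\<^sup>1\<^sup>/\<^sup>2\<close> is the square root of \<open>1 - h\<^sup>2\<close>, so one binomial series suffices.\<close>
    define c where "c = (1 - h * h) * g"
    have n: "norm (h * h) < 1"
      using norm_mult_ineq[of h h] h(3) mult_left_le[of "norm h" "norm h"] by simp
    have gB: "g \<in> B" unfolding g_def by (intro isqrt mult h n)
    have cB: "c \<in> B" unfolding c_def by (intro mult diff one h gB)
    have hg: "g * h = h * g" unfolding g_def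
      by (rule isqrt_one_minus_intertwine[OF n n]) (simp add: mult.assoc)
    have g2: "g * g * (1 - h * h) = 1" unfolding g_def by (rule isqrt_one_minus_square[OF n])
    have gs: "star g = g" unfolding g_def
      by (rule star_isqrt_one_minus[OF n]) (simp add: star_mult h)
    have ghh: "g * (h * h) = h * h * g" using hg by (metis mult.assoc)
    have com: "g * (1 - h * h) = (1 - h * h) * g"
      by (simp only: right_diff_distrib left_diff_distrib ghh mult_1 mult_1_right)
    have cs: "star c = c" by (simp add: c_def star_mult star_diff gs h com)
    have "(1 - h * h) * h = h * (1 - h * h)" by (simp add: algebra_simps)
    then have ch: "c * h = h * c"
      unfolding c_def by (metis hg mult.assoc)
    have "c * c = (1 - h * h) * (g * g * (1 - h * h))"
      unfolding c_def using com by (metis mult.assoc)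
    then have cc: "c * c = 1 - h * h" using g2 by simp
    have "unitary (?u h c)"
      by (simp add: unitary_def star_add star_scaleC h cs algebra_simps mult_scaleC_left
          mult_scaleC_right scaleC_scaleC ch cc scaleC_minus_left scaleC_diff_right scaleC_add_right)
    then have "star (?u h c) * ?u h c = 1" by (simp add: unitary_def)
    moreover have uB: "?u h c \<in> B" by (intro add scaleC h cB)
    ultimately have "star (f (?u h c)) * f (?u h c) = 1"
      by (metis star star' mult' one')
    then have nu: "norm (f (?u h c)) = 1"
      using cstar_identity[of "f (?u h c)"] norm_ge_zero[of "f (?u h c)"]
      by (auto simp: power2_eq_1_iff)
    have "2 *\<^sub>C h = ?u h c + star (?u h c)"
      by (simp add: star_add star_scaleC h cs scaleC_minus_left scaleC_2)
    then have "2 *\<^sub>C f h = f (?u h c) + star (f (?u h c))"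
      by (metis add' scaleC' star star' uB h(1))
    then have "2 * norm (f h) \<le> 2"
      using norm_triangle_ineq[of "f (?u h c)" "star (f (?u h c))"] nu
      by (metis norm_scaleC norm_star norm_numeral one_add_one)
    then show ?thesis by simp
  qed
  have sa: "norm (f h) \<le> norm h" if h: "h \<in> B" "star h = h" for h
  proof (rule field_le_epsilon)
    fix e :: real assume e: "e > 0"
    define r where "r = norm h + e"
    have r: "r > 0" using e norm_ge_zero[of h] unfolding r_def by linarith
    have "norm (f ((1 / r) *\<^sub>R h)) \<le> 1"
      using e r by (intro small scaleR h) (auto simp: star_scaleR h r_def)
    also have "f ((1 / r) *\<^sub>R h) = (1 / r) *\<^sub>R f h" using h by (simp only: scaleR_scaleC scaleC')
    finally show "norm (f h) \<le> norm h + e" using r by (simp add: r_def[symmetric])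
  qed
  have "(norm (f x))\<^sup>2 = norm (f (star x * x))"
    using x by (simp add: mult' star star' cstar_identity)
  also have "\<dots> \<le> norm (star x * x)"
    by (rule sa) (auto simp: mult star x star_mult star_star)
  also have "\<dots> = (norm x)\<^sup>2" by (rule cstar_identity)
  finally show ?thesis by (rule power2_le_imp_le) simp
qed

lemma star_automorphism_one:
  assumes "star_automorphism B f"
  shows "f 1 = 1"
proof -
  obtain y where y: "y \<in> B" "f y = 1"
    using assms one unfolding star_automorphism_def bij_betw_def by (metis imageE)
  then show ?thesis using assms one unfolding star_automorphism_def
    by (metis mult.right_neutral mult_1)
qed

lemma star_automorphism_contractive:
  assumes "star_automorphism B f" "x \<in> B"
  shows "norm (f x) \<le> norm x"
  using assms(1) star_automorphism_one[OF assms(1)] assms(2)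
  by (intro star_hom_contractive) (auto simp: star_automorphism_def)

end

section \<open>Rapidly decreasing sequences on the dual lattice\<close>

lemma weight_ge_1: "1 \<le> weight z"
  by (cases z) (simp add: weight_def)

lemma weight_pos [simp]: "0 < weight z"
  using weight_ge_1[of z] by linarith

lemma weight_nonzero [simp]: "weight z \<noteq> 0"
  using weight_pos[of z] by linarith

lemma weight_nonneg [simp]: "0 \<le> weight z"
  using weight_pos[of z] by linarith

lemma weight_uminus [simp]: "weight (- z) = weight z"
  by (cases z) (simp add: weight_def)

lemma weight_add_le: "weight (z + y) \<le> weight z * weight y"
proof -
  obtain m n r s where [simp]: "z = (m, n)" "y = (r, s)" by (cases z, cases y) auto
  have "weight (z + y) \<le> 1 + (\<bar>of_int m\<bar> + \<bar>of_int n\<bar>) + (\<bar>of_int r\<bar> + \<bar>of_int s\<bar>)"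
    by (auto simp: weight_def)
  also have "\<dots> \<le> 1 + (\<bar>of_int m\<bar> + \<bar>of_int n\<bar>) + (\<bar>of_int r\<bar> + \<bar>of_int s\<bar>)
      + (\<bar>of_int m\<bar> + \<bar>of_int n\<bar>) * (\<bar>of_int r\<bar> + \<bar>of_int s\<bar>)"
    by simp
  also have "\<dots> = weight z * weight y" by (simp add: weight_def algebra_simps)
  finally show ?thesis .
qed

lemma rapidly_decreasing_iff:
  "rapidly_decreasing c \<longleftrightarrow> (\<forall>k. \<exists>C. \<forall>z. weight z ^ k * cmod (c z) \<le> C)"
  by (auto simp: rapidly_decreasing_def bdd_above_def)

lemma rapidly_decreasingI:
  "(\<And>k z. weight z ^ k * cmod (c z) \<le> C k) \<Longrightarrow> rapidly_decreasing c"
  by (auto simp: rapidly_decreasing_iff)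

lemma schwartz_norm_bound:
  "rapidly_decreasing c \<Longrightarrow> weight z ^ k * cmod (c z) \<le> schwartz_norm k c"
  unfolding schwartz_norm_def rapidly_decreasing_def by (intro cSUP_upper) auto

lemma schwartz_norm_le: "(\<And>z. weight z ^ k * cmod (c z) \<le> C) \<Longrightarrow> schwartz_norm k c \<le> C"
  unfolding schwartz_norm_def by (intro cSUP_least) auto

lemma schwartz_norm_nonneg: "rapidly_decreasing c \<Longrightarrow> 0 \<le> schwartz_norm k c"
  using schwartz_norm_bound[of c 0 k] by (meson mult_nonneg_nonneg norm_ge_zero order_trans
      weight_nonneg zero_le_power)

lemma schwartz_norm_mono:
  assumes "rapidly_decreasing c" "j \<le> k"
  shows "schwartz_norm j c \<le> schwartz_norm k c"
proof (rule schwartz_norm_le)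
  fix z
  have "weight z ^ j * cmod (c z) \<le> weight z ^ k * cmod (c z)"
    using assms(2) weight_ge_1[of z] by (intro mult_right_mono power_increasing) auto
  also have "\<dots> \<le> schwartz_norm k c" by (rule schwartz_norm_bound[OF assms(1)])
  finally show "weight z ^ j * cmod (c z) \<le> schwartz_norm k c" .
qed

lemma schwartz_norm_add:
  assumes "rapidly_decreasing c" "rapidly_decreasing d"
  shows "rapidly_decreasing (\<lambda>z. c z + d z)"
    and "schwartz_norm k (\<lambda>z. c z + d z) \<le> schwartz_norm k c + schwartz_norm k d"
proof -
  have le: "weight z ^ k * cmod (c z + d z) \<le> schwartz_norm k c + schwartz_norm k d" for k z
  proof -
    have "weight z ^ k * cmod (c z + d z) \<le> weight z ^ k * (cmod (c z) + cmod (d z))"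
      by (intro mult_left_mono norm_triangle_ineq) auto
    then show ?thesis
      using schwartz_norm_bound[OF assms(1), of z k] schwartz_norm_bound[OF assms(2), of z k]
      by (simp add: distrib_left)
  qed
  from le show "rapidly_decreasing (\<lambda>z. c z + d z)" by (rule rapidly_decreasingI)
  from le show "schwartz_norm k (\<lambda>z. c z + d z) \<le> schwartz_norm k c + schwartz_norm k d"
    by (rule schwartz_norm_le)
qed

lemma rapidly_decreasing_bounded_mult:
  assumes "rapidly_decreasing c" "\<And>z. cmod (h z) \<le> K * weight z ^ p"
  shows "rapidly_decreasing (\<lambda>z. h z * c z)"
proof (rule rapidly_decreasingI)
  fix k z
  have K: "0 \<le> K"
    using order_trans[OF norm_ge_zero assms(2)[of 0]] by (simp add: weight_def zero_prod_def)
  have "weight z ^ k * cmod (h z * c z) \<le> weight z ^ k * (K * weight z ^ p * cmod (c z))"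
    unfolding norm_mult by (intro mult_left_mono mult_right_mono assms) auto
  also have "\<dots> = K * (weight z ^ (k + p) * cmod (c z))" by (simp add: power_add)
  also have "\<dots> \<le> K * schwartz_norm (k + p) c"
    by (intro mult_left_mono schwartz_norm_bound assms K)
  finally show "weight z ^ k * cmod (h z * c z) \<le> K * schwartz_norm (k + p) c" .
qed

lemma rapidly_decreasing_cmult: "rapidly_decreasing c \<Longrightarrow> rapidly_decreasing (\<lambda>z. a * c z)"
  by (rule rapidly_decreasing_bounded_mult[where K = "cmod a" and p = 0]) auto

lemma schwartz_norm_cmult_le:
  assumes "rapidly_decreasing c"
  shows "schwartz_norm k (\<lambda>z. a * c z) \<le> cmod a * schwartz_norm k c"
proof (rule schwartz_norm_le)
  fix z
  have "cmod a * (weight z ^ k * cmod (c z)) \<le> cmod a * schwartz_norm k c"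
    by (intro mult_left_mono schwartz_norm_bound assms) auto
  then show "weight z ^ k * cmod (a * c z) \<le> cmod a * schwartz_norm k c"
    by (simp add: norm_mult mult_ac)
qed

lemma rapidly_decreasing_uminus: "rapidly_decreasing c \<Longrightarrow> rapidly_decreasing (\<lambda>z. c (- z))"
  unfolding rapidly_decreasing_iff by (metis weight_uminus)

lemma rapidly_decreasing_cnj: "rapidly_decreasing c \<Longrightarrow> rapidly_decreasing (\<lambda>z. cnj (c z))"
  by (simp add: rapidly_decreasing_def)

lemma rapidly_decreasing_finite:
  assumes "finite {z. c z \<noteq> 0}"
  shows "rapidly_decreasing c"
proof (rule rapidly_decreasingI)
  fix k z
  let ?C = "\<Sum>z\<in>{z. c z \<noteq> 0}. weight z ^ k * cmod (c z)"
  show "weight z ^ k * cmod (c z) \<le> ?C"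
  proof (cases "c z = 0")
    case False
    then show ?thesis
      using assms by (intro member_le_sum[where f = "\<lambda>z. weight z ^ k * cmod (c z)"]) auto
  qed (auto intro!: sum_nonneg)
qed

lemma summable_on_product:
  fixes f :: "'i \<Rightarrow> real" and g :: "'j \<Rightarrow> real"
  assumes f: "f summable_on UNIV" "\<And>i. 0 \<le> f i" and g: "g summable_on UNIV" "\<And>j. 0 \<le> g j"
  shows "(\<lambda>p. f (fst p) * g (snd p)) summable_on UNIV"
proof -
  let ?F = "\<lambda>p. f (fst p) * g (snd p)"
  have "(\<lambda>p. norm (?F p)) summable_on (SIGMA _:UNIV. UNIV)"
  proof (rule Infinite_Sum.abs_summable_on_Sigma_iff[THEN iffD2], intro conjI ballI)
    show "(\<lambda>j. norm (?F (i, j))) summable_on UNIV" for i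
      using f(2) g by (simp add: summable_on_cmult_right)
    have "norm (\<Sum>\<^sub>\<infinity>j. norm (?F (i, j))) = f i * (\<Sum>\<^sub>\<infinity>j. g j)" for i
      using f(2) g by (simp add: infsum_cmult_right' infsum_nonneg)
    then show "(\<lambda>i. norm (\<Sum>\<^sub>\<infinity>j. norm (?F (i, j)))) summable_on UNIV"
      using f(1) by (simp add: summable_on_cmult_left)
  qed
  then show ?thesis using f(2) g(2) by simp
qed

lemma summable_on_int_inverse_square: "(\<lambda>m::int. 1 / (1 + \<bar>real_of_int m\<bar>)\<^sup>2) summable_on UNIV"
proof -
  let ?f = "\<lambda>m::int. 1 / (1 + \<bar>real_of_int m\<bar>)\<^sup>2"
  have "summable (\<lambda>n. norm (1 / (1 + real n)\<^sup>2))"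
    using inverse_power_summable[of 2, where 'a = real] summable_Suc_iff[of "\<lambda>n. inverse (real n ^ 2)"]
    by (simp add: inverse_eq_divide)
  then have nat: "(\<lambda>n::nat. 1 / (1 + real n)\<^sup>2) summable_on UNIV"
    by (rule norm_summable_imp_summable_on)
  have "?f summable_on (range int)"
    by (subst summable_on_reindex) (use nat in \<open>auto simp: o_def\<close>)
  moreover have "?f summable_on (range (\<lambda>n. - int n))"
    by (subst summable_on_reindex) (use nat in \<open>auto simp: o_def inj_on_def\<close>)
  ultimately have "?f summable_on (range int \<union> range (\<lambda>n. - int n))"
    by (rule summable_on_union)
  moreover have "range int \<union> range (\<lambda>n. - int n) = UNIV"
  proof (rule UNIV_eq_I[symmetric])
    show "m \<in> range int \<union> range (\<lambda>n. - int n)" for m :: int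
      by (cases m rule: int_cases2) auto
  qed
  ultimately show ?thesis by simp
qed

lemma summable_on_weight: "(\<lambda>z. 1 / weight z ^ 4) summable_on UNIV"
proof -
  let ?f = "\<lambda>m::int. 1 / (1 + \<bar>real_of_int m\<bar>)\<^sup>2"
  have s: "(\<lambda>p. ?f (fst p) * ?f (snd p)) summable_on UNIV"
    by (intro summable_on_product summable_on_int_inverse_square) auto
  show ?thesis
  proof (rule summable_on_comparison_test[OF s])
    fix z :: "int \<times> int"
    obtain m n where z: "z = (m, n)" by (cases z)
    have "(1 + \<bar>real_of_int m\<bar>)\<^sup>2 * (1 + \<bar>real_of_int n\<bar>)\<^sup>2 \<le> weight z ^ 2 * weight z ^ 2"
      by (intro mult_mono power_mono) (auto simp: z weight_def)
    then have "1 / (weight z ^ 2 * weight z ^ 2)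
        \<le> 1 / ((1 + \<bar>real_of_int m\<bar>)\<^sup>2 * (1 + \<bar>real_of_int n\<bar>)\<^sup>2)"
      by (intro divide_left_mono mult_pos_pos zero_less_power) (auto intro: add_pos_nonneg)
    then show "1 / weight z ^ 4 \<le> ?f (fst z) * ?f (snd z)"
      by (simp add: z power_add[symmetric])
  qed auto
qed

text \<open>The constant that bounds \<open>\<ell>\<^sup>1\<close> norms by Schwartz norms: four powers of the weight make a
  double series over the lattice converge.\<close>

definition weight_sum :: real where
  "weight_sum = (\<Sum>\<^sub>\<infinity>z. 1 / weight z ^ 4)"

lemma weight_sum_nonneg: "0 \<le> weight_sum"
  unfolding weight_sum_def by (intro infsum_nonneg) auto

lemma weighted_summable:
  assumes "rapidly_decreasing c"
  shows "(\<lambda>z. weight z ^ k * cmod (c z)) summable_on UNIV"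
    and "(\<Sum>\<^sub>\<infinity>z. weight z ^ k * cmod (c z)) \<le> weight_sum * schwartz_norm (k + 4) c"
proof -
  have le: "weight z ^ k * cmod (c z) \<le> 1 / weight z ^ 4 * schwartz_norm (k + 4) c" for z
  proof -
    have "weight z ^ k * cmod (c z) = 1 / weight z ^ 4 * (weight z ^ (k + 4) * cmod (c z))"
      using weight_pos[of z] by (simp add: power_add del: weight_pos)
    also have "\<dots> \<le> 1 / weight z ^ 4 * schwartz_norm (k + 4) c"
      by (intro mult_left_mono schwartz_norm_bound assms) auto
    finally show ?thesis .
  qed
  have s: "(\<lambda>z. 1 / weight z ^ 4 * schwartz_norm (k + 4) c) summable_on UNIV"
    by (intro summable_on_cmult_left summable_on_weight)
  show 1: "(\<lambda>z. weight z ^ k * cmod (c z)) summable_on UNIV"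
    using s le by (rule summable_on_comparison_test) auto
  have "(\<Sum>\<^sub>\<infinity>z. weight z ^ k * cmod (c z)) \<le> (\<Sum>\<^sub>\<infinity>z. 1 / weight z ^ 4 * schwartz_norm (k + 4) c)"
    by (intro infsum_mono 1 s le)
  also have "\<dots> = weight_sum * schwartz_norm (k + 4) c"
    unfolding weight_sum_def by (rule infsum_cmult_left')
  finally show "(\<Sum>\<^sub>\<infinity>z. weight z ^ k * cmod (c z)) \<le> weight_sum * schwartz_norm (k + 4) c" .
qed

lemma abs_summable:
  assumes "rapidly_decreasing c"
  shows "(\<lambda>z. cmod (c z)) summable_on UNIV"
    and "(\<Sum>\<^sub>\<infinity>z. cmod (c z)) \<le> weight_sum * schwartz_norm 4 c"
  using weighted_summable[OF assms, of 0] by simp_all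

text \<open>A product of two Fourier series, or a functional of such a product, is an absolutely convergent
  double series \<open>F z y\<close>. It may be summed by rows, by columns, or along the diagonals
  \<open>z + y = const\<close>, which are the coefficients of the product.\<close>

lemma double_sum:
  fixes F :: "int \<times> int \<Rightarrow> int \<times> int \<Rightarrow> 'b::banach"
  assumes c: "rapidly_decreasing c" and d: "rapidly_decreasing d"
    and F: "\<And>z y. norm (F z y) \<le> K * (cmod (c z) * cmod (d y))"
  shows double_sum_summable: "(\<lambda>(z, y). F z y) summable_on UNIV"
    and double_sum_diagonals: "(\<Sum>\<^sub>\<infinity>z. \<Sum>\<^sub>\<infinity>y. F z y) = (\<Sum>\<^sub>\<infinity>y. \<Sum>\<^sub>\<infinity>z. F z (y - z))"
    and double_sum_swap: "(\<Sum>\<^sub>\<infinity>z. \<Sum>\<^sub>\<infinity>y. F z y) = (\<Sum>\<^sub>\<infinity>y. \<Sum>\<^sub>\<infinity>z. F z y)"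
    and double_sum_row: "F z summable_on UNIV"
    and double_sum_diagonal: "(\<lambda>z. F z (y - z)) summable_on UNIV"
proof -
  have row: "(\<lambda>y. cmod (c z) * cmod (d y)) summable_on UNIV" for z
    by (intro summable_on_cmult_right abs_summable d)
  have cd: "(\<lambda>p. cmod (c (fst p)) * cmod (d (snd p))) summable_on UNIV"
    by (intro summable_on_product abs_summable c d) auto
  have Fp: "(\<lambda>p. F (fst p) (snd p)) summable_on UNIV"
  proof (rule abs_summable_summable, rule summable_on_comparison_test)
    show "(\<lambda>p. K * (cmod (c (fst p)) * cmod (d (snd p)))) summable_on UNIV"
      by (intro summable_on_cmult_right cd)
  qed (auto simp: F)
  then show 1: "(\<lambda>(z, y). F z y) summable_on UNIV"
    by (simp add: case_prod_unfold)
  have 2: "(\<lambda>p. F (snd p) (fst p - snd p)) summable_on UNIV"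
    using Fp
    by (subst summable_on_reindex_bij_witness[where i = "\<lambda>(z, y). (z + y, z)"
          and j = "\<lambda>(y, z). (z, y - z)" and T = UNIV and h = "\<lambda>p. F (fst p) (snd p)"])
      (auto simp: case_prod_unfold)
  show "(\<Sum>\<^sub>\<infinity>z. \<Sum>\<^sub>\<infinity>y. F z y) = (\<Sum>\<^sub>\<infinity>y. \<Sum>\<^sub>\<infinity>z. F z (y - z))"
  proof -
    have "(\<Sum>\<^sub>\<infinity>z. \<Sum>\<^sub>\<infinity>y. F z y) = (\<Sum>\<^sub>\<infinity>p. F (fst p) (snd p))"
      using infsum_Sigma_banach[of "\<lambda>p. F (fst p) (snd p)" UNIV "\<lambda>_. UNIV"] Fp by simp
    also have "\<dots> = (\<Sum>\<^sub>\<infinity>p. F (snd p) (fst p - snd p))"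
      by (rule infsum_reindex_bij_witness[where j = "\<lambda>(z, y). (z + y, z)"
          and i = "\<lambda>(y, z). (z, y - z)"]) (auto simp: case_prod_unfold)
    also have "\<dots> = (\<Sum>\<^sub>\<infinity>y. \<Sum>\<^sub>\<infinity>z. F z (y - z))"
      using infsum_Sigma_banach[of "\<lambda>p. F (snd p) (fst p - snd p)" UNIV "\<lambda>_. UNIV"] 2 by simp
    finally show ?thesis .
  qed
  show "(\<Sum>\<^sub>\<infinity>z. \<Sum>\<^sub>\<infinity>y. F z y) = (\<Sum>\<^sub>\<infinity>y. \<Sum>\<^sub>\<infinity>z. F z y)"
    using 1 by (intro infsum_swap_banach) simp
  show "F z summable_on UNIV"
  proof (rule abs_summable_summable, rule summable_on_comparison_test)
    show "(\<lambda>y. K * (cmod (c z) * cmod (d y))) summable_on UNIV"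
      by (intro summable_on_cmult_right row)
  qed (auto simp: F)
  have "(\<lambda>p. F (snd p) (fst p - snd p)) summable_on (range (Pair y))"
    using 2 by (rule summable_on_subset_banach) simp
  then show "(\<lambda>z. F z (y - z)) summable_on UNIV"
    by (subst (asm) summable_on_reindex) (auto simp: inj_on_def o_def)
qed

lemma infsum_finite_sum:
  fixes f :: "'i \<Rightarrow> 'z \<Rightarrow> 'b::banach"
  assumes "\<And>i. i \<in> I \<Longrightarrow> f i summable_on A"
  shows "(\<lambda>z. \<Sum>i\<in>I. f i z) summable_on A"
    and "(\<Sum>\<^sub>\<infinity>z\<in>A. \<Sum>i\<in>I. f i z) = (\<Sum>i\<in>I. \<Sum>\<^sub>\<infinity>z\<in>A. f i z)"
proof -
  have "(\<lambda>z. \<Sum>i\<in>I. f i z) summable_on A \<and>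
      (\<Sum>\<^sub>\<infinity>z\<in>A. \<Sum>i\<in>I. f i z) = (\<Sum>i\<in>I. \<Sum>\<^sub>\<infinity>z\<in>A. f i z)"
    using assms
    by (induction I rule: infinite_finite_induct) (auto simp: infsum_add intro!: summable_on_add)
  then show "(\<lambda>z. \<Sum>i\<in>I. f i z) summable_on A"
    and "(\<Sum>\<^sub>\<infinity>z\<in>A. \<Sum>i\<in>I. f i z) = (\<Sum>i\<in>I. \<Sum>\<^sub>\<infinity>z\<in>A. f i z)" by auto
qed

section \<open>Fourier series in an irrational rotation algebra\<close>

lemma infsum_bounded_linear:
  assumes "bounded_linear h" "f summable_on A"
  shows "(\<Sum>\<^sub>\<infinity>x\<in>A. h (f x)) = h (infsum f A)"
  by (rule infsumI[OF has_sum_bounded_linear[OF assms(1) has_sum_infsum[OF assms(2)]]])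

lemma e_exp_add: "e_exp (s + t) = e_exp s * e_exp t"
  by (simp add: e_exp_def algebra_simps exp_add)

lemma e_exp_0 [simp]: "e_exp 0 = 1"
  by (simp add: e_exp_def)

lemma cmod_e_exp [simp]: "cmod (e_exp t) = 1"
  using norm_exp_i_times[of "2 * pi * t"] by (simp add: e_exp_def mult_ac)

lemma e_exp_nonzero [simp]: "e_exp t \<noteq> 0"
  by (simp add: e_exp_def)

lemma cnj_e_exp: "cnj (e_exp t) = e_exp (- t)"
  by (simp add: e_exp_def exp_cnj)

lemma e_exp_eq_1_imp_int: "e_exp t = 1 \<Longrightarrow> t \<in> \<int>"
proof -
  assume "e_exp t = 1"
  then have "exp (\<i> * complex_of_real (2 * pi * t)) = 1"
    by (simp add: e_exp_def mult_ac)
  then obtain n :: int where "2 * pi * t = 2 * of_int n * pi"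
    by (subst (asm) exp_eq_1) auto
  then show ?thesis by simp
qed

lemma e_exp_power: "e_exp t ^ n = e_exp (t * real n)"
  by (induction n) (auto simp: e_exp_add[symmetric] algebra_simps)

lemma upow_0 [simp]: "upow u 0 = 1"
  by (simp add: upow_def)

lemma upow_1 [simp]: "upow u 1 = u"
  by (simp add: upow_def)

lemma upow_Suc:
  assumes "unitary u"
  shows "upow u (k + 1) = upow u k * u"
proof (cases "0 \<le> k")
  case True
  then show ?thesis by (simp add: upow_def nat_add_distrib power_commutes)
next
  case False
  define n where "n = nat (- 1 - k)"
  have k: "nat (- k) = Suc n" "nat (- (k + 1)) = n" "k + 1 \<ge> 0 \<Longrightarrow> n = 0 \<and> nat (k + 1) = 0"
    using False by (auto simp: n_def)
  have "upow u k = star u ^ n * star u"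
    using False by (simp add: k upow_def power_commutes)
  then have "upow u k * u = star u ^ n" using assms by (simp add: unitary_def mult.assoc)
  also have "\<dots> = upow u (k + 1)" using k by (auto simp: upow_def)
  finally show ?thesis by simp
qed

lemma upow_pred: "unitary u \<Longrightarrow> upow u (k - 1) = upow u k * star u"
  using upow_Suc[of u "k - 1"] by (simp add: unitary_def mult.assoc)

lemma upow_add: "unitary u \<Longrightarrow> upow u (j + k) = upow u j * upow u k"
proof (induction k rule: int_induct[where k = 0])
  case (step1 i)
  then show ?case
    using upow_Suc[of u "j + i"] upow_Suc[of u i] by (simp add: mult.assoc add.assoc)
next
  case (step2 i)
  then show ?case
    using upow_pred[of u "j + i"] upow_pred[of u i] by (simp add: mult.assoc add_diff_eq)
qed simp

lemma unitary_upow: "unitary u \<Longrightarrow> unitary (upow u k)"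
proof (induction k rule: int_induct[where k = 0])
  case base show ?case by (simp add: unitary_def)
next
  case (step1 i) then show ?case by (simp add: upow_Suc unitary_mult)
next
  case (step2 i) then show ?case by (simp add: upow_pred unitary_mult unitary_star)
qed

text \<open>With \<open>x = V\<close> and then \<open>x = U\<^sup>m\<close>, this gives the commutation relation for all integer powers.\<close>

lemma upow_commutation:
  assumes u: "unitary u" and ux: "u * x = e_exp t *\<^sub>C (x * u)"
  shows "upow u n * x = e_exp (t * of_int n) *\<^sub>C (x * upow u n)"
proof (induction n rule: int_induct[where k = 0])
  case (step1 i)
  have "upow u (i + 1) * x = upow u i * (u * x)"
    using u by (simp add: upow_Suc mult.assoc)
  also have "\<dots> = e_exp t *\<^sub>C (upow u i * x * u)"
    by (simp add: ux mult_scaleC_right mult.assoc)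
  also have "\<dots> = e_exp (t * of_int (i + 1)) *\<^sub>C (x * upow u (i + 1))"
    using u upow_Suc[OF u, of i]
    by (simp add: step1 mult_scaleC_left scaleC_scaleC e_exp_add[symmetric]
        algebra_simps mult.assoc)
  finally show ?case .
next
  case (step2 i)
  have "x * star u = star u * (u * x) * star u"
    using u by (simp add: unitary_def mult.assoc[symmetric])
  also have "\<dots> = e_exp t *\<^sub>C (star u * x)"
    using u by (simp add: ux mult_scaleC_left mult_scaleC_right unitary_def mult.assoc)
  finally have "e_exp (- t) *\<^sub>C (x * star u) = star u * x"
    by (simp add: scaleC_scaleC e_exp_add[symmetric])
  then have su: "star u * x = e_exp (- t) *\<^sub>C (x * star u)" by simp
  have "upow u (i - 1) * x = upow u i * (star u * x)"
    using u by (simp add: upow_pred mult.assoc)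
  also have "\<dots> = e_exp (- t) *\<^sub>C (upow u i * x * star u)"
    by (simp add: su mult_scaleC_right mult.assoc)
  also have "\<dots> = e_exp (t * of_int (i - 1)) *\<^sub>C (x * upow u (i - 1))"
    using u upow_pred[OF u, of i]
    by (simp add: step2 mult_scaleC_left scaleC_scaleC e_exp_add[symmetric]
        algebra_simps mult.assoc)
  finally show ?case .
qed simp

text \<open>The form whose values are the commutation phases of the monomials \<open>U\<^sup>m V\<^sup>n\<close>.\<close>

definition symplectic :: "int \<times> int \<Rightarrow> int \<times> int \<Rightarrow> int" where
  "symplectic z y = snd z * fst y - fst z * snd y"

lemma symplectic_simps:
  "symplectic (z + z') y = symplectic z y + symplectic z' y" "symplectic z (y + y') = symplectic z y + symplectic z y'"
  "symplectic (- z) y = - symplectic z y" "symplectic z (- y) = - symplectic z y"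
  "symplectic (z - z') y = symplectic z y - symplectic z' y" "symplectic z (y - y') = symplectic z y - symplectic z y'"
  "symplectic z z = 0" "symplectic 0 y = 0" "symplectic z 0 = 0"
  by (auto simp: symplectic_def algebra_simps)

lemma symplectic_commute: "symplectic y z = - symplectic z y"
  by (simp add: symplectic_def)

locale irrational_rotation_algebra = rotation_algebra \<theta> U V
  for \<theta> and U V :: "'a::cstar_algebra" +
  assumes irrational: "\<theta> \<notin> \<rat>"
begin

definition twist :: "int \<times> int \<Rightarrow> int \<times> int \<Rightarrow> complex" where
  "twist z y = e_exp (\<theta> / 2 * of_int (symplectic z y))"

text \<open>The symmetric normalisation of the monomials \<open>U\<^sup>m V\<^sup>n\<close>: both the adjoint and the flip send
  \<open>weyl z\<close> to \<open>weyl (- z)\<close>, and \<open>\<phi>\<^sub>j\<^sub>k\<close> takes the value \<open>1\<close> or \<open>0\<close> on it.\<close>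

definition weyl :: "int \<times> int \<Rightarrow> 'a" where
  "weyl z = e_exp (\<theta> / 2 * of_int (fst z * snd z)) *\<^sub>C umonom U V z"

lemma cmod_twist [simp]: "cmod (twist z y) = 1" by (simp add: twist_def)
lemma twist_0 [simp]: "twist 0 y = 1" "twist y 0 = 1" by (simp_all add: twist_def symplectic_simps)
lemma twist_self [simp]: "twist y y = 1" "twist y (- y) = 1" "twist (- y) y = 1"
  by (simp_all add: twist_def symplectic_simps)
lemma twist_minus: "twist (- z) y = twist y z" "twist z (- y) = twist y z"
  by (simp_all add: twist_def symplectic_simps symplectic_commute[of y z])

lemma weyl_0 [simp]: "weyl 0 = 1"
  by (simp add: weyl_def umonom_def zero_prod_def)

lemma unitary_weyl: "unitary (weyl z)"
  unfolding weyl_def umonom_def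
  by (cases z) (simp add: unitary_scaleC unitary_mult unitary_upow unitary_U unitary_V)

lemma norm_weyl [simp]: "norm (weyl z) = 1"
  by (rule norm_unitary[OF unitary_weyl])

lemma upow_V_U: "upow V n * upow U m = e_exp (\<theta> * of_int (n * m)) *\<^sub>C (upow U m * upow V n)"
proof -
  have "U * V = e_exp (- \<theta>) *\<^sub>C (V * U)"
    by (simp add: commutation scaleC_scaleC e_exp_add[symmetric])
  from upow_commutation[OF unitary_U this, of m]
  have "V * upow U m = e_exp (\<theta> * of_int m) *\<^sub>C (upow U m * V)"
    by (simp add: scaleC_scaleC e_exp_add[symmetric])
  from upow_commutation[OF unitary_V this, of n] show ?thesis by (simp add: mult_ac)
qed

lemma weyl_mult: "weyl z * weyl y = twist z y *\<^sub>C weyl (z + y)"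
proof -
  obtain m n r s where [simp]: "z = (m, n)" "y = (r, s)" by (cases z, cases y) auto
  have "upow U m * upow V n * (upow U r * upow V s)
      = upow U m * (upow V n * upow U r) * upow V s" by (simp add: mult.assoc)
  also have "\<dots> = e_exp (\<theta> * of_int (n * r)) *\<^sub>C (upow U (m + r) * upow V (n + s))"
    by (simp add: upow_V_U mult_scaleC_left mult_scaleC_right upow_add unitary_U unitary_V mult.assoc)
  finally have "weyl z * weyl y = e_exp (\<theta> / 2 * of_int (m * n) + \<theta> / 2 * of_int (r * s)
      + \<theta> * of_int (n * r)) *\<^sub>C (upow U (m + r) * upow V (n + s))"
    by (simp add: weyl_def umonom_def mult_scaleC_left mult_scaleC_right scaleC_scaleC e_exp_add mult_ac)
  also have "\<theta> / 2 * of_int (m * n) + \<theta> / 2 * of_int (r * s) + \<theta> * of_int (n * r)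
      = \<theta> / 2 * of_int (symplectic z y) + \<theta> / 2 * of_int ((m + r) * (n + s))"
    by (simp add: symplectic_def field_simps)
  finally show ?thesis
    by (simp add: weyl_def umonom_def twist_def scaleC_scaleC e_exp_add)
qed

lemma star_weyl: "star (weyl z) = weyl (- z)"
proof -
  have "star (weyl z) = star (weyl z) * (weyl z * weyl (- z))"
    by (simp add: weyl_mult)
  also have "\<dots> = weyl (- z)"
    using unitary_weyl[of z] by (simp add: mult.assoc[symmetric] unitary_def)
  finally show ?thesis .
qed

lemma weyl_conj: "weyl y * weyl z * weyl (- y) = e_exp (\<theta> * of_int (symplectic y z)) *\<^sub>C weyl z"
  by (simp add: weyl_mult mult_scaleC_left scaleC_scaleC twist_def e_exp_add[symmetric] symplectic_simps
      symplectic_commute[of z y] field_simps)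

lemma e_exp_theta_eq_1_iff: "e_exp (\<theta> * of_int k) = 1 \<longleftrightarrow> k = 0"
proof
  assume "e_exp (\<theta> * of_int k) = 1"
  then obtain n :: int where n: "\<theta> * of_int k = of_int n"
    using e_exp_eq_1_imp_int Ints_cases by metis
  show "k = 0"
  proof (rule ccontr)
    assume "k \<noteq> 0"
    then have "\<theta> = of_int n / of_int k" using n by (simp add: field_simps)
    then show False using irrational by (metis Rats_divide Rats_of_int)
  qed
qed simp

text \<open>Averaging over the inner automorphisms given by the powers of one suitably chosen
  \<open>weyl y\<close> removes every term of a Fourier polynomial except the constant one, because \<open>\<theta>\<close> is
  irrational. Hence the Fourier coefficients are bounded by the norm.\<close>

lemma norm_finite_series_ge_0:
  assumes F: "finite F" "0 \<in> F"
  shows "cmod (c 0) \<le> norm (\<Sum>z\<in>F. c z *\<^sub>C weyl z)"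
proof -
  define x where "x = (\<Sum>z\<in>F. c z *\<^sub>C weyl z)"
  \<comment> \<open>\<open>M\<close> is so large that \<open>y = (1, M)\<close> is symplectically orthogonal to no nonzero point of \<open>F\<close>.\<close>
  define M where "M = (\<Sum>z\<in>F. \<bar>snd z\<bar>) + 1"
  define y where "y = (1::int, M)"
  define \<mu> where "\<mu> z = e_exp (\<theta> * of_int (symplectic y z))" for z
  define av where "av N z = (\<Sum>j<N. \<mu> z ^ j) / of_nat N" for N z
  have \<mu>1: "\<mu> z \<noteq> 1" if "z \<in> F" "z \<noteq> 0" for z
  proof -
    have M: "\<bar>snd z\<bar> < M"
      using member_le_sum[of z F "\<lambda>z. \<bar>snd z\<bar>"] that F by (simp add: M_def)
    have "symplectic y z \<noteq> 0"
    proof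
      assume "symplectic y z = 0"
      then have s: "snd z = M * fst z" by (simp add: symplectic_def y_def)
      have "fst z = 0"
      proof (rule ccontr)
        assume "fst z \<noteq> 0"
        then have "\<bar>M\<bar> * 1 \<le> \<bar>M\<bar> * \<bar>fst z\<bar>" by (intro mult_left_mono) auto
        moreover have "\<bar>snd z\<bar> = \<bar>M\<bar> * \<bar>fst z\<bar>" by (simp add: s abs_mult)
        ultimately show False using M by linarith
      qed
      then show False using s that by (simp add: prod_eq_iff)
    qed
    then show ?thesis by (simp add: \<mu>_def e_exp_theta_eq_1_iff)
  qed
  have pw: "weyl (of_nat j * fst y, of_nat j * snd y) * weyl z
      * weyl (- (of_nat j * fst y, of_nat j * snd y)) = \<mu> z ^ j *\<^sub>C weyl z" for j :: nat and z
    by (simp only: weyl_conj) (simp add: \<mu>_def e_exp_power symplectic_def y_def algebra_simps)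
  let ?y = "\<lambda>j::nat. (of_nat j * fst y, of_nat j * snd y)"
  have conj: "weyl (?y j) * x * weyl (- ?y j) = (\<Sum>z\<in>F. (c z * \<mu> z ^ j) *\<^sub>C weyl z)" for j
    unfolding x_def sum_distrib_left sum_distrib_right
    by (intro sum.cong refl) (simp only: mult_scaleC_left mult_scaleC_right pw scaleC_scaleC)
  define T where "T j = weyl (?y j) * x * weyl (- ?y j)" for j
  have T: "norm (T j) \<le> norm x" for j
    unfolding T_def by (rule norm_unitary_conj_le[OF unitary_weyl, unfolded star_weyl])
  have le: "norm (\<Sum>z\<in>F. (c z * av N z) *\<^sub>C weyl z) \<le> norm x" if "N > 0" for N
  proof -
    have "(\<Sum>z\<in>F. (c z * av N z) *\<^sub>C weyl z)
        = (1 / of_nat N) *\<^sub>C (\<Sum>j<N. T j)"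
    proof -
      have "c z * av N z = (\<Sum>j<N. 1 / of_nat N * (c z * \<mu> z ^ j))" for z
        by (simp add: av_def sum_distrib_left sum_divide_distrib)
      then show ?thesis
        unfolding T_def conj scaleC_sum_right scaleC_scaleC
        by (subst sum.swap) (simp add: scaleC_sum_left)
    qed
    also have "norm \<dots> = norm (\<Sum>j<N. T j) / of_nat N"
      by (simp add: norm_scaleC norm_divide)
    also have "\<dots> \<le> (\<Sum>j<N. norm x) / of_nat N"
      by (intro divide_right_mono sum_norm_le T) simp
    also have "\<dots> = norm x" using that by simp
    finally show ?thesis .
  qed
  have av0: "(\<lambda>N. av N z) \<longlonglongrightarrow> 0" if "z \<in> F" "z \<noteq> 0" for z
  proof (rule Lim_null_comparison)
    have "norm (av N z) \<le> (2 / cmod (1 - \<mu> z)) * (1 / real N)" if "N > 0" for N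
    proof -
      have "(\<Sum>j<N. \<mu> z ^ j) = (1 - \<mu> z ^ N) / (1 - \<mu> z)"
        using \<mu>1[OF \<open>z \<in> F\<close> \<open>z \<noteq> 0\<close>] by (simp add: sum_gp_strict)
      moreover have "cmod (1 - \<mu> z ^ N) \<le> 2"
        using norm_triangle_ineq4[of 1 "\<mu> z ^ N"] by (simp add: norm_power \<mu>_def)
      ultimately show ?thesis
        by (simp add: av_def norm_divide norm_mult divide_right_mono)
    qed
    then show "\<forall>\<^sub>F N in sequentially. norm (av N z) \<le> (2 / cmod (1 - \<mu> z)) * (1 / real N)"
      using eventually_gt_at_top[of 0] by (rule eventually_mono[rotated])
    show "(\<lambda>N. (2 / cmod (1 - \<mu> z)) * (1 / real N)) \<longlonglongrightarrow> 0"
      by (intro tendsto_mult_right_zero lim_1_over_n)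
  qed
  have "(\<lambda>N. \<Sum>z\<in>F. (c z * av N z) *\<^sub>C weyl z) \<longlonglongrightarrow> (\<Sum>z\<in>F. (if z = 0 then c 0 else 0) *\<^sub>C weyl z)"
  proof (intro tendsto_sum bounded_linear.tendsto[OF bounded_linear_scaleC_left])
    fix z assume z: "z \<in> F"
    show "(\<lambda>N. c z * av N z) \<longlonglongrightarrow> (if z = 0 then c 0 else 0)"
    proof (cases "z = 0")
      case True
      have "\<forall>\<^sub>F N in sequentially. c z * av N z = c 0"
        using eventually_gt_at_top[of 0]
        by eventually_elim (simp add: True av_def \<mu>_def symplectic_simps)
      then show ?thesis using True by (simp add: tendsto_eventually)
    next
      case False
      then show ?thesis using tendsto_mult_right_zero[OF av0[OF z False]] by simp
    qed
  qed
  also have "(\<Sum>z\<in>F. (if z = 0 then c 0 else 0) *\<^sub>C weyl z) = c 0 *\<^sub>C 1"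
    using F by (simp add: if_distrib[of "\<lambda>c. c *\<^sub>C _"] sum.delta cong: if_cong)
  finally have "norm (c 0 *\<^sub>C (1::'a)) \<le> norm x"
  proof (intro tendsto_upperbound[OF tendsto_norm])
    show "\<forall>\<^sub>F N in sequentially. norm (\<Sum>z\<in>F. (c z * av N z) *\<^sub>C weyl z) \<le> norm x"
      using eventually_gt_at_top[of 0] by (rule eventually_mono) (rule le)
  qed auto
  then show ?thesis by (simp add: norm_scaleC x_def)
qed

text \<open>Multiplication by a unitary monomial moves any coefficient to the origin.\<close>

lemma norm_finite_series_ge:
  assumes F: "finite F" "w \<in> F"
  shows "cmod (c w) \<le> norm (\<Sum>z\<in>F. c z *\<^sub>C weyl z)"
proof -
  let ?G = "(\<lambda>z. z - w) ` F"
  have G: "(\<Sum>z\<in>?G. (c (z + w) * twist (z + w) (- w)) *\<^sub>C weyl z) = (\<Sum>z\<in>F. c z *\<^sub>C weyl z) * weyl (- w)"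
    by (subst sum.reindex) (auto simp: inj_on_def sum_distrib_right mult_scaleC_left weyl_mult scaleC_scaleC)
  have "cmod (c (0 + w) * twist (0 + w) (- w)) \<le> norm (\<Sum>z\<in>?G. (c (z + w) * twist (z + w) (- w)) *\<^sub>C weyl z)"
    using F by (intro norm_finite_series_ge_0) auto
  also have "\<dots> \<le> norm (\<Sum>z\<in>F. c z *\<^sub>C weyl z)"
    unfolding G using norm_mult_ineq[of "\<Sum>z\<in>F. c z *\<^sub>C weyl z" "weyl (- w)"] by simp
  finally show ?thesis by (simp add: norm_mult)
qed

definition series :: "(int \<times> int \<Rightarrow> complex) \<Rightarrow> 'a" where
  "series c = (\<Sum>\<^sub>\<infinity>z. c z *\<^sub>C weyl z)"

lemma norm_term: "norm (c z *\<^sub>C weyl z) = cmod (c z)"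
  by (simp add: norm_scaleC)

lemma series_summable: "rapidly_decreasing c \<Longrightarrow> (\<lambda>z. c z *\<^sub>C weyl z) summable_on UNIV"
  by (rule abs_summable_summable) (simp add: norm_scaleC abs_summable(1))

lemma has_sum_series: "rapidly_decreasing c \<Longrightarrow> ((\<lambda>z. c z *\<^sub>C weyl z) has_sum series c) UNIV"
  unfolding series_def by (intro has_sum_infsum series_summable)

lemma norm_series_le:
  assumes "rapidly_decreasing c"
  shows "norm (series c) \<le> weight_sum * schwartz_norm 4 c"
proof -
  have "norm (series c) \<le> (\<Sum>\<^sub>\<infinity>z. cmod (c z))"
    unfolding series_def using norm_infsum_bound[of "\<lambda>z. c z *\<^sub>C weyl z" UNIV]
      abs_summable(1)[OF assms] by (simp add: norm_term)
  then show ?thesis using abs_summable(2)[OF assms] by linarith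
qed

lemma coeff_le_norm_series:
  assumes "rapidly_decreasing c"
  shows "cmod (c z) \<le> norm (series c)"
proof (rule tendsto_lowerbound)
  show "((\<lambda>F. norm (\<Sum>z\<in>F. c z *\<^sub>C weyl z)) \<longlongrightarrow> norm (series c)) (finite_subsets_at_top UNIV)"
    using has_sum_series[OF assms] unfolding has_sum_def by (rule tendsto_norm)
  show "\<forall>\<^sub>F F in finite_subsets_at_top UNIV. cmod (c z) \<le> norm (\<Sum>z\<in>F. c z *\<^sub>C weyl z)"
    using eventually_finite_subsets_at_top_weakI[of UNIV]
    unfolding eventually_finite_subsets_at_top
    by (intro exI[of _ "{z}"]) (auto intro: norm_finite_series_ge)
qed (rule finite_subsets_at_top_neq_bot)

lemma series_add:
  "rapidly_decreasing c \<Longrightarrow> rapidly_decreasing d \<Longrightarrow> series (\<lambda>z. c z + d z) = series c + series d"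
  unfolding series_def scaleC_add_left by (intro infsum_add series_summable)

lemma series_cmult: "rapidly_decreasing c \<Longrightarrow> series (\<lambda>z. a * c z) = a *\<^sub>C series c"
  unfolding series_def
  using infsum_bounded_linear[OF bounded_linear_scaleC_right series_summable, of c a]
  by (simp add: scaleC_scaleC)

lemma series_uminus:
  assumes "rapidly_decreasing c"
  shows "series (\<lambda>z. - c z) = - series c"
  using series_cmult[OF assms, of "-1"] by (simp add: scaleC_minus_left)

lemma rapidly_decreasing_diff:
  "rapidly_decreasing c \<Longrightarrow> rapidly_decreasing d \<Longrightarrow> rapidly_decreasing (\<lambda>z. c z - d z)"
  using schwartz_norm_add(1)[of c "\<lambda>z. -1 * d z"] rapidly_decreasing_cmult[of d "-1"] by simp

lemma series_diff:
  assumes "rapidly_decreasing c" "rapidly_decreasing d"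
  shows "series (\<lambda>z. c z - d z) = series c - series d"
  using series_add[OF assms(1) rapidly_decreasing_cmult[OF assms(2), of "-1"]]
  by (simp add: series_uminus assms)

lemma series_inject:
  assumes "rapidly_decreasing c" "rapidly_decreasing d" "series c = series d"
  shows "c = d"
proof
  fix z
  have "cmod (c z - d z) \<le> norm (series (\<lambda>z. c z - d z))"
    by (rule coeff_le_norm_series) (intro rapidly_decreasing_diff assms)
  then show "c z = d z" using assms by (simp add: series_diff)
qed

lemma star_series:
  assumes "rapidly_decreasing c"
  shows "star (series c) = series (\<lambda>z. cnj (c (- z)))"
proof -
  have "star (series c) = (\<Sum>\<^sub>\<infinity>z. star (c z *\<^sub>C weyl z))"
    unfolding series_def
    using infsum_bounded_linear[OF bounded_linear_star series_summable[OF assms]] by simp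
  also have "\<dots> = (\<Sum>\<^sub>\<infinity>z. cnj (c (- z)) *\<^sub>C weyl z)"
    by (rule infsum_reindex_bij_witness[where i = uminus and j = uminus]) (auto simp: star_scaleC star_weyl)
  finally show ?thesis by (simp add: series_def)
qed

definition conv :: "(int \<times> int \<Rightarrow> complex) \<Rightarrow> (int \<times> int \<Rightarrow> complex) \<Rightarrow> int \<times> int \<Rightarrow> complex" where
  "conv c d y = (\<Sum>\<^sub>\<infinity>z. c z * d (y - z) * twist z (y - z))"

lemma conv_summable:
  assumes "rapidly_decreasing c" "rapidly_decreasing d"
  shows "(\<lambda>z. c z * d (y - z) * twist z (y - z)) summable_on UNIV"
  by (rule double_sum_diagonal[OF assms, of "\<lambda>z y. c z * d y * twist z y" 1]) (simp add: norm_mult)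

lemma rapidly_decreasing_conv:
  assumes c: "rapidly_decreasing c" and d: "rapidly_decreasing d"
  shows "rapidly_decreasing (conv c d)"
proof (rule rapidly_decreasingI)
  fix k y
  have s: "(\<lambda>z. weight z ^ k * cmod (c z) * schwartz_norm k d) summable_on UNIV"
    by (intro summable_on_cmult_left weighted_summable c)
  have le: "norm (weight y ^ k *\<^sub>R (c z * d (y - z) * twist z (y - z)))
      \<le> weight z ^ k * cmod (c z) * schwartz_norm k d" for z
  proof -
    have "weight y ^ k \<le> (weight z * weight (y - z)) ^ k"
      using weight_add_le[of z "y - z"] by (intro power_mono) auto
    then have "weight y ^ k * (cmod (c z) * cmod (d (y - z)))
        \<le> (weight z * weight (y - z)) ^ k * (cmod (c z) * cmod (d (y - z)))"
      by (intro mult_right_mono) auto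
    also have "\<dots> = weight z ^ k * cmod (c z) * (weight (y - z) ^ k * cmod (d (y - z)))"
      by (simp add: power_mult_distrib)
    also have "\<dots> \<le> weight z ^ k * cmod (c z) * schwartz_norm k d"
      by (intro mult_left_mono schwartz_norm_bound d) auto
    finally show ?thesis by (simp add: norm_mult)
  qed
  have "weight y ^ k * cmod (conv c d y)
      = norm (\<Sum>\<^sub>\<infinity>z. weight y ^ k *\<^sub>R (c z * d (y - z) * twist z (y - z)))"
    by (simp add: conv_def infsum_scaleR_right)
  also have "\<dots> \<le> (\<Sum>\<^sub>\<infinity>z. weight z ^ k * cmod (c z) * schwartz_norm k d)"
    by (rule norm_infsum_le[OF has_sum_infsum has_sum_infsum])
      (use s le in \<open>auto intro: summable_on_scaleR_right conv_summable[OF c d]\<close>)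
  also have "\<dots> = (\<Sum>\<^sub>\<infinity>z. weight z ^ k * cmod (c z)) * schwartz_norm k d"
    by (rule infsum_cmult_left')
  finally show "weight y ^ k * cmod (conv c d y) \<le> (\<Sum>\<^sub>\<infinity>z. weight z ^ k * cmod (c z)) * schwartz_norm k d" .
qed

lemma series_mult:
  assumes c: "rapidly_decreasing c" and d: "rapidly_decreasing d"
  shows "series c * series d = series (conv c d)"
proof -
  define F where "F z y = (c z * d y * twist z y) *\<^sub>C weyl (z + y)" for z y
  have F: "norm (F z y) \<le> 1 * (cmod (c z) * cmod (d y))" for z y
    by (simp add: F_def norm_scaleC norm_mult)
  have row: "(\<Sum>\<^sub>\<infinity>y. F z y) = c z *\<^sub>C weyl z * series d" for z
  proof -
    have "c z *\<^sub>C weyl z * series d = (\<Sum>\<^sub>\<infinity>y. c z *\<^sub>C weyl z * d y *\<^sub>C weyl y)"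
      unfolding series_def
      by (rule infsum_bounded_linear[OF bounded_linear_mult_right series_summable[OF d], symmetric])
    then show ?thesis
      by (simp add: F_def mult_scaleC_left mult_scaleC_right weyl_mult scaleC_scaleC mult_ac)
  qed
  have col: "(\<Sum>\<^sub>\<infinity>z. F z (y - z)) = conv c d y *\<^sub>C weyl y" for y
  proof -
    have "z + (y - z) = y" for z :: "int \<times> int" by simp
    then show ?thesis unfolding F_def conv_def
      by (simp only:) (rule infsum_bounded_linear[OF bounded_linear_scaleC_left conv_summable[OF c d]])
  qed
  have "series c * series d = (\<Sum>\<^sub>\<infinity>z. c z *\<^sub>C weyl z * series d)"
    unfolding series_def[of c]
    by (rule infsum_bounded_linear[OF bounded_linear_mult_left series_summable[OF c], symmetric])
  also have "\<dots> = (\<Sum>\<^sub>\<infinity>y. \<Sum>\<^sub>\<infinity>z. F z (y - z))"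
    unfolding row[symmetric] by (rule double_sum_diagonals[OF c d F])
  finally show ?thesis by (simp add: col series_def)
qed

end

section \<open>The smooth algebra as a Frechet algebra\<close>

context irrational_rotation_algebra
begin

abbreviation smooth :: "'a set" where "smooth \<equiv> smooth_algebra U V"

text \<open>By \<open>series_inject\<close> a smooth element has exactly one rapidly decreasing coefficient family.\<close>

definition fcoeff :: "'a \<Rightarrow> int \<times> int \<Rightarrow> complex" where
  "fcoeff x = (THE c. rapidly_decreasing c \<and> x = series c)"

abbreviation frechet :: "nat \<Rightarrow> 'a \<Rightarrow> real" where "frechet k x \<equiv> schwartz_norm k (fcoeff x)"

lemma fcoeff_series [simp]: "rapidly_decreasing c \<Longrightarrow> fcoeff (series c) = c"
  unfolding fcoeff_def by (rule the_equality) (auto dest: series_inject)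

lemma smooth_series_iff:
  "smooth_series U V a x \<longleftrightarrow> rapidly_decreasing a \<and>
    x = series (\<lambda>z. e_exp (- (\<theta> / 2 * of_int (fst z * snd z))) * a z)"
    (is "_ \<longleftrightarrow> _ \<and> x = series (\<lambda>z. ?e z * a z)")
proof -
  have eq: "a z *\<^sub>C umonom U V z = (?e z * a z) *\<^sub>C weyl z" for z
    by (simp add: weyl_def scaleC_scaleC mult_ac e_exp_add[symmetric])
  show ?thesis
    unfolding smooth_series_def eq
    using has_sum_series[OF rapidly_decreasing_bounded_mult[of a ?e 1 0]] has_sum_unique by auto
qed

lemma smooth_series_fcoeff:
  assumes "smooth_series U V a x"
  shows "schwartz_norm k a = frechet k x"
proof -
  let ?d = "\<lambda>z. e_exp (- (\<theta> / 2 * of_int (fst z * snd z))) * a z"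
  have "rapidly_decreasing ?d" "x = series ?d"
    using assms rapidly_decreasing_bounded_mult[of a "\<lambda>z. e_exp (- (\<theta> / 2 * of_int (fst z * snd z)))" 1 0]
    by (auto simp: smooth_series_iff)
  then show ?thesis by (simp add: schwartz_norm_def norm_mult)
qed

lemma smooth_algebra_eq: "smooth = series ` Collect rapidly_decreasing"
proof safe
  fix x assume "x \<in> smooth"
  then obtain a where "smooth_series U V a x" by (auto simp: smooth_algebra_def)
  then show "x \<in> series ` Collect rapidly_decreasing"
    using rapidly_decreasing_bounded_mult[of a "\<lambda>z. e_exp (- (\<theta> / 2 * of_int (fst z * snd z)))" 1 0]
    by (auto simp: smooth_series_iff)
next
  fix c assume "rapidly_decreasing c"
  then have "smooth_series U V (\<lambda>z. e_exp (\<theta> / 2 * of_int (fst z * snd z)) * c z) (series c)"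
    using rapidly_decreasing_bounded_mult[of c "\<lambda>z. e_exp (\<theta> / 2 * of_int (fst z * snd z))" 1 0]
    by (simp add: smooth_series_iff mult.assoc[symmetric] e_exp_add[symmetric])
  then show "series c \<in> smooth" by (auto simp: smooth_algebra_def)
qed

lemma series_smooth: "rapidly_decreasing c \<Longrightarrow> series c \<in> smooth"
  by (simp add: smooth_algebra_eq)

lemma fcoeff_rapidly_decreasing: "x \<in> smooth \<Longrightarrow> rapidly_decreasing (fcoeff x)"
  by (auto simp: smooth_algebra_eq)

lemma series_fcoeff: "x \<in> smooth \<Longrightarrow> series (fcoeff x) = x"
  by (auto simp: smooth_algebra_eq)

lemma smooth_eqI: "x \<in> smooth \<Longrightarrow> y \<in> smooth \<Longrightarrow> (\<And>z. fcoeff x z = fcoeff y z) \<Longrightarrow> x = y"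
  by (metis ext series_fcoeff)

lemma cmod_fcoeff_le: "x \<in> smooth \<Longrightarrow> cmod (fcoeff x z) \<le> norm x"
  using coeff_le_norm_series[OF fcoeff_rapidly_decreasing, of x z] by (simp add: series_fcoeff)

lemma norm_le_frechet: "x \<in> smooth \<Longrightarrow> norm x \<le> weight_sum * frechet 4 x"
  using norm_series_le[OF fcoeff_rapidly_decreasing, of x] by (simp add: series_fcoeff)

lemma smooth_add: "x \<in> smooth \<Longrightarrow> y \<in> smooth \<Longrightarrow> x + y \<in> smooth"
  and fcoeff_add: "x \<in> smooth \<Longrightarrow> y \<in> smooth \<Longrightarrow> fcoeff (x + y) = (\<lambda>z. fcoeff x z + fcoeff y z)"
  using series_add[of "fcoeff x" "fcoeff y"] schwartz_norm_add(1)[of "fcoeff x" "fcoeff y"]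
    fcoeff_series[of "\<lambda>z. fcoeff x z + fcoeff y z"]
    series_smooth[of "\<lambda>z. fcoeff x z + fcoeff y z"]
  by (auto simp: fcoeff_rapidly_decreasing series_fcoeff)

lemma smooth_scaleC: "x \<in> smooth \<Longrightarrow> a *\<^sub>C x \<in> smooth"
  and fcoeff_scaleC: "x \<in> smooth \<Longrightarrow> fcoeff (a *\<^sub>C x) = (\<lambda>z. a * fcoeff x z)"
  using series_cmult[of "fcoeff x" a] rapidly_decreasing_cmult[of "fcoeff x" a]
    fcoeff_series[of "\<lambda>z. a * fcoeff x z"] series_smooth[of "\<lambda>z. a * fcoeff x z"]
  by (auto simp: fcoeff_rapidly_decreasing series_fcoeff)

lemma smooth_mult: "x \<in> smooth \<Longrightarrow> y \<in> smooth \<Longrightarrow> x * y \<in> smooth"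
  and fcoeff_mult: "x \<in> smooth \<Longrightarrow> y \<in> smooth \<Longrightarrow> fcoeff (x * y) = conv (fcoeff x) (fcoeff y)"
  using series_mult[of "fcoeff x" "fcoeff y"] rapidly_decreasing_conv[of "fcoeff x" "fcoeff y"]
    fcoeff_series[of "conv (fcoeff x) (fcoeff y)"] series_smooth[of "conv (fcoeff x) (fcoeff y)"]
  by (auto simp: fcoeff_rapidly_decreasing series_fcoeff)

lemma smooth_star: "x \<in> smooth \<Longrightarrow> star x \<in> smooth"
  using star_series[of "fcoeff x"]
    rapidly_decreasing_cnj[OF rapidly_decreasing_uminus, of "fcoeff x"]
    series_smooth[of "\<lambda>z. cnj (fcoeff x (- z))"]
  by (auto simp: fcoeff_rapidly_decreasing series_fcoeff)

lemma smooth_weyl: "weyl w \<in> smooth"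
  and fcoeff_weyl: "fcoeff (weyl w) = (\<lambda>z. if z = w then 1 else 0)"
proof -
  let ?c = "\<lambda>z. if z = w then 1 else 0 :: complex"
  have c: "rapidly_decreasing ?c"
    by (rule rapidly_decreasing_finite) (rule finite_subset[of _ "{w}"], auto)
  have "series ?c = (\<Sum>\<^sub>\<infinity>z\<in>{w}. ?c z *\<^sub>C weyl z)"
    unfolding series_def by (rule infsum_cong_neutral) auto
  then have "series ?c = weyl w" by simp
  then show "weyl w \<in> smooth" "fcoeff (weyl w) = ?c"
    using series_smooth[OF c] fcoeff_series[OF c] by auto
qed

lemma smooth_1: "1 \<in> smooth"
  using smooth_weyl[of 0] by simp

lemma smooth_0: "0 \<in> smooth"
  using smooth_scaleC[OF smooth_1, of 0] by simp

lemma fcoeff_1: "fcoeff 1 = (\<lambda>z. if z = 0 then 1 else 0)"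
  using fcoeff_weyl[of 0] by simp

lemma fcoeff_0: "fcoeff 0 = (\<lambda>z. 0)"
  using fcoeff_scaleC[OF smooth_1, of 0] by simp

lemma smooth_uminus: "x \<in> smooth \<Longrightarrow> - x \<in> smooth"
  using smooth_scaleC[of x "-1"] by (simp add: scaleC_minus_left)

lemma smooth_diff: "x \<in> smooth \<Longrightarrow> y \<in> smooth \<Longrightarrow> x - y \<in> smooth"
  using smooth_add[of x "- y"] by (simp add: smooth_uminus)

lemma fcoeff_diff:
  "x \<in> smooth \<Longrightarrow> y \<in> smooth \<Longrightarrow> fcoeff (x - y) = (\<lambda>z. fcoeff x z - fcoeff y z)"
  using fcoeff_add[of x "-1 *\<^sub>C y"] fcoeff_scaleC[of y "-1"] smooth_scaleC[of y "-1"]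
  by (simp add: scaleC_minus_left)

lemma smooth_scaleR: "x \<in> smooth \<Longrightarrow> r *\<^sub>R x \<in> smooth"
  by (simp add: scaleR_scaleC smooth_scaleC)

lemma smooth_sum: "(\<And>i. i \<in> I \<Longrightarrow> f i \<in> smooth) \<Longrightarrow> (\<Sum>i\<in>I. f i) \<in> smooth"
  by (induction I rule: infinite_finite_induct) (auto simp: smooth_0 smooth_add)

lemma fcoeff_sum: "(\<And>i. i \<in> I \<Longrightarrow> f i \<in> smooth) \<Longrightarrow> fcoeff (\<Sum>i\<in>I. f i) = (\<lambda>z. \<Sum>i\<in>I. fcoeff (f i) z)"
  by (induction I rule: infinite_finite_induct) (auto simp: fcoeff_0 fcoeff_add smooth_sum)

lemma smooth_power: "x \<in> smooth \<Longrightarrow> x ^ n \<in> smooth"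
  by (induction n) (auto simp: smooth_1 smooth_mult)

text \<open>The closure is a C*-subalgebra that contains the generators.\<close>

lemma smooth_dense: "closure smooth = UNIV"
proof (rule generated)
  have cont_mult: "x * y \<in> closure smooth" if xy: "x \<in> closure smooth" "y \<in> closure smooth" for x y
  proof -
    obtain a b where ab: "\<forall>n. a n \<in> smooth" "a \<longlonglongrightarrow> x" "\<forall>n. b n \<in> smooth" "b \<longlonglongrightarrow> y"
      using xy unfolding closure_sequential by blast
    then have "(\<lambda>n. a n * b n) \<longlonglongrightarrow> x * y" by (intro tendsto_mult)
    moreover have "\<forall>n. a n * b n \<in> smooth" using ab smooth_mult by blast
    ultimately show ?thesis unfolding closure_sequential 
      by (intro exI[of _ "\<lambda>n. a n * b n"]) blast
  qed
  have cont_add: "x + y \<in> closure smooth" if xy: "x \<in> closure smooth" "y \<in> closure smooth" for x y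
  proof -
    obtain a b where ab: "\<forall>n. a n \<in> smooth" "a \<longlonglongrightarrow> x" "\<forall>n. b n \<in> smooth" "b \<longlonglongrightarrow> y"
      using xy unfolding closure_sequential by blast
    then have "(\<lambda>n. a n + b n) \<longlonglongrightarrow> x + y" by (intro tendsto_add)
    moreover have "\<forall>n. a n + b n \<in> smooth" using ab smooth_add by blast
    ultimately show ?thesis unfolding closure_sequential 
      by (intro exI[of _ "\<lambda>n. a n + b n"]) blast
  qed
  have lin: "h x \<in> closure smooth"
    if h: "x \<in> closure smooth" "bounded_linear h" "\<And>x. x \<in> smooth \<Longrightarrow> h x \<in> smooth" for x and h :: "'a \<Rightarrow> 'a"
  proof -
    obtain a where a: "\<forall>n. a n \<in> smooth" "a \<longlonglongrightarrow> x"
      using h(1) unfolding closure_sequential by blast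
    then have "(\<lambda>n. h (a n)) \<longlonglongrightarrow> h x" by (intro bounded_linear.tendsto[OF h(2)])
    moreover have "\<forall>n. h (a n) \<in> smooth" using a h(3) by blast
    ultimately show ?thesis unfolding closure_sequential 
      by (intro exI[of _ "\<lambda>n. h (a n)"]) blast
  qed
  show "star_subalgebra (closure smooth)"
    unfolding star_subalgebra_def
  proof (intro conjI ballI allI)
    show "0 \<in> closure smooth" using smooth_0 closure_subset by blast
    show "star x \<in> closure smooth" if "x \<in> closure smooth" for x
      using that by (rule lin[OF _ bounded_linear_star smooth_star])
    show "c *\<^sub>C x \<in> closure smooth" if "x \<in> closure smooth" for x c
      using that by (rule lin[OF _ bounded_linear_scaleC_right smooth_scaleC])
  qed (intro cont_add cont_mult; assumption)+
  have "U = weyl (1, 0)" "V = weyl (0, 1)"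
    by (simp_all add: weyl_def umonom_def)
  then show "U \<in> closure smooth" "V \<in> closure smooth"
    using smooth_weyl[of "(1, 0)"] smooth_weyl[of "(0, 1)"] subsetD[OF closure_subset] by metis+
qed simp

lemma frechet_bound: "x \<in> smooth \<Longrightarrow> weight z ^ k * cmod (fcoeff x z) \<le> frechet k x"
  by (intro schwartz_norm_bound fcoeff_rapidly_decreasing)

lemma frechet_nonneg: "x \<in> smooth \<Longrightarrow> 0 \<le> frechet k x"
  by (intro schwartz_norm_nonneg fcoeff_rapidly_decreasing)

lemma frechet_mono: "x \<in> smooth \<Longrightarrow> j \<le> k \<Longrightarrow> frechet j x \<le> frechet k x"
  by (intro schwartz_norm_mono fcoeff_rapidly_decreasing)

text \<open>This is the completeness of the Frechet topology. The tails of the coefficient series are estimated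
  in every Schwartz norm, and the fourth one dominates the C*-norm.\<close>

lemma smooth_suminf:
  assumes X: "\<And>n. X n \<in> smooth" and s: "\<And>k. summable (\<lambda>n. frechet k (X n))"
  shows "X sums suminf X" and "suminf X \<in> smooth"
    and "fcoeff (suminf X) z = (\<Sum>n. fcoeff (X n) z)"
proof -
  define c where "c z = (\<Sum>n. fcoeff (X n) z)" for z
  have le: "weight z ^ k * cmod (fcoeff (X n) z) \<le> frechet k (X n)" for z k n
    by (intro frechet_bound X)
  have sk: "summable (\<lambda>n. weight z ^ k * cmod (fcoeff (X n) z))" for z k
    by (rule summable_comparison_test'[OF s[of k]]) (use le in auto)
  have sz: "summable (\<lambda>n. cmod (fcoeff (X n) z))" for z
    using sk[of z 0] by simp
  have tail: "weight z ^ k * cmod (c z - (\<Sum>n<N. fcoeff (X n) z)) \<le> (\<Sum>n. frechet k (X (n + N)))"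
    for z k N
  proof -
    have "c z - (\<Sum>n<N. fcoeff (X n) z) = (\<Sum>n. fcoeff (X (n + N)) z)"
      unfolding c_def by (rule suminf_minus_initial_segment[symmetric, OF summable_norm_cancel[OF sz]])
    also have "cmod \<dots> \<le> (\<Sum>n. cmod (fcoeff (X (n + N)) z))"
      by (intro summable_norm summable_ignore_initial_segment sz)
    finally have "weight z ^ k * cmod (c z - (\<Sum>n<N. fcoeff (X n) z))
        \<le> weight z ^ k * (\<Sum>n. cmod (fcoeff (X (n + N)) z))"
      by (intro mult_left_mono) auto
    also have "\<dots> = (\<Sum>n. weight z ^ k * cmod (fcoeff (X (n + N)) z))"
      by (intro suminf_mult[symmetric] summable_ignore_initial_segment sz)
    also have "\<dots> \<le> (\<Sum>n. frechet k (X (n + N)))"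
      using sk s by (intro suminf_le le summable_ignore_initial_segment)
    finally show ?thesis .
  qed
  have c: "rapidly_decreasing c"
    using tail[of _ _ 0] by (intro rapidly_decreasingI) simp
  have bnd: "norm (series c - (\<Sum>n<N. X n)) \<le> weight_sum * (\<Sum>n. frechet 4 (X (n + N)))" for N
  proof -
    define d where "d z = c z - fcoeff (\<Sum>n<N. X n) z" for z
    have S: "(\<Sum>n<N. X n) \<in> smooth" by (intro smooth_sum X)
    then have d: "rapidly_decreasing d" "series d = series c - (\<Sum>n<N. X n)"
      unfolding d_def using c
      by (auto simp: series_diff series_fcoeff fcoeff_rapidly_decreasing intro!: rapidly_decreasing_diff)
    have "norm (series d) \<le> weight_sum * schwartz_norm 4 d" by (rule norm_series_le[OF d(1)])
    also have "\<dots> \<le> weight_sum * (\<Sum>n. frechet 4 (X (n + N)))"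
      unfolding d_def using tail X
      by (intro mult_left_mono weight_sum_nonneg schwartz_norm_le) (simp add: fcoeff_sum)
    finally show ?thesis by (simp add: d)
  qed
  have "(\<lambda>N. (\<Sum>n<N. X n) - series c) \<longlonglongrightarrow> 0"
  proof (rule Lim_null_comparison)
    show "\<forall>\<^sub>F N in sequentially. norm ((\<Sum>n<N. X n) - series c) \<le> weight_sum * (\<Sum>n. frechet 4 (X (n + N)))"
      using bnd by (simp add: norm_minus_commute)
    show "(\<lambda>N. weight_sum * (\<Sum>n. frechet 4 (X (n + N)))) \<longlonglongrightarrow> 0"
      by (intro tendsto_mult_right_zero suminf_exist_split2 s)
  qed
  then have "X sums series c"
    unfolding sums_def by (rule LIM_zero_cancel)
  then have eq: "suminf X = series c" "X sums suminf X" by (auto simp: sums_iff)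
  then show "X sums suminf X" "suminf X \<in> smooth" "fcoeff (suminf X) z = (\<Sum>n. fcoeff (X n) z)"
    using c by (auto simp: series_smooth c_def)
qed


section \<open>Smoothness of power series by means of the two derivations\<close>

text \<open>\<open>fderiv l p\<close> is \<open>1 / p!\<close> times the \<open>p\<close>-th power of the derivation that multiplies the
  coefficient at \<open>z\<close> with \<open>l z\<close>; up to \<open>2 \<pi> i\<close> these are the generators of the torus action.\<close>

definition fderiv :: "(int \<times> int \<Rightarrow> int) \<Rightarrow> nat \<Rightarrow> 'a \<Rightarrow> 'a" where
  "fderiv l p x = series (\<lambda>z. of_int (l z) ^ p / fact p * fcoeff x z)"

lemma abs_coordinate_le_weight: "l \<in> {fst, snd} \<Longrightarrow> \<bar>real_of_int (l z)\<bar> \<le> weight z"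
  by (cases z) (auto simp: weight_def)

lemma coordinate_additive: "l \<in> {fst, snd} \<Longrightarrow> l (z + y) = (l z + l y :: int)"
  by auto

lemma rapidly_decreasing_deriv:
  assumes "l \<in> {fst, snd}" "rapidly_decreasing c"
  shows "rapidly_decreasing (\<lambda>z. of_int (l z) ^ p / fact p * c z)"
proof (rule rapidly_decreasing_bounded_mult[where K = 1 and p = p])
  fix z
  have "cmod (of_int (l z) ^ p / fact p) = \<bar>real_of_int (l z)\<bar> ^ p / fact p"
    by (simp add: norm_divide norm_power)
  also have "\<dots> \<le> \<bar>real_of_int (l z)\<bar> ^ p"
    by (simp add: divide_le_eq_1 pos_divide_le_eq mult_le_cancel_left1 fact_ge_1)
  also have "\<dots> \<le> weight z ^ p" by (intro power_mono abs_coordinate_le_weight assms) auto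
  finally show "cmod (of_int (l z) ^ p / fact p) \<le> 1 * weight z ^ p" by simp
qed (rule assms)

lemma fderiv_smooth: "l \<in> {fst, snd} \<Longrightarrow> x \<in> smooth \<Longrightarrow> fderiv l p x \<in> smooth"
  unfolding fderiv_def by (intro series_smooth rapidly_decreasing_deriv fcoeff_rapidly_decreasing)

lemma fcoeff_fderiv:
  "l \<in> {fst, snd} \<Longrightarrow> x \<in> smooth \<Longrightarrow> fcoeff (fderiv l p x) z = of_int (l z) ^ p / fact p * fcoeff x z"
  unfolding fderiv_def by (subst fcoeff_series) (intro rapidly_decreasing_deriv fcoeff_rapidly_decreasing, simp_all)

lemma fderiv_0: "x \<in> smooth \<Longrightarrow> fderiv l 0 x = x"
  by (simp add: fderiv_def series_fcoeff)

lemma fderiv_add: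
  "l \<in> {fst, snd} \<Longrightarrow> x \<in> smooth \<Longrightarrow> y \<in> smooth \<Longrightarrow> fderiv l p (x + y) = fderiv l p x + fderiv l p y"
  by (rule smooth_eqI) (auto simp: fderiv_smooth smooth_add fcoeff_fderiv fcoeff_add distrib_left)

lemma fderiv_scaleC:
  "l \<in> {fst, snd} \<Longrightarrow> x \<in> smooth \<Longrightarrow> fderiv l p (a *\<^sub>C x) = a *\<^sub>C fderiv l p x"
  by (rule smooth_eqI) (auto simp: fderiv_smooth smooth_scaleC fcoeff_fderiv fcoeff_scaleC)

lemma fderiv_mult:
  assumes l: "l \<in> {fst, snd}" and x: "x \<in> smooth" and y: "y \<in> smooth"
  shows "fderiv l p (x * y) = (\<Sum>i\<le>p. fderiv l i x * fderiv l (p - i) y)"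
proof (rule smooth_eqI)
  note sm = smooth_mult fderiv_smooth l x y
  show "fderiv l p (x * y) \<in> smooth" "(\<Sum>i\<le>p. fderiv l i x * fderiv l (p - i) y) \<in> smooth"
    by (intro sm smooth_sum)+
  fix w
  let ?c = "fcoeff x" and ?d = "fcoeff y"
  define E where "E k n = (of_int k ^ n / fact n :: complex)" for k :: int and n
  have binom: "E (j + k) p = (\<Sum>i\<le>p. E j i * E k (p - i))" for j k
    using exp_series_add_commuting[of "of_int j :: complex" "of_int k" p]
    by (simp add: E_def mult.commute scaleR_conv_of_real field_simps)
  define f where "f i z = E (l z) i * ?c z * (E (l (w - z)) (p - i) * ?d (w - z)) * twist z (w - z)" for i z
  have fs: "f i summable_on UNIV" for i
    unfolding f_def E_def
    by (rule conv_summable) (intro rapidly_decreasing_deriv fcoeff_rapidly_decreasing l x y)+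
  have "fcoeff (fderiv l p (x * y)) w = E (l w) p * conv ?c ?d w"
    using l x y by (simp add: fcoeff_fderiv smooth_mult fcoeff_mult E_def)
  also have "\<dots> = (\<Sum>\<^sub>\<infinity>z. E (l w) p * (?c z * ?d (w - z) * twist z (w - z)))"
    by (simp add: conv_def infsum_cmult_right')
  also have "\<dots> = (\<Sum>\<^sub>\<infinity>z. \<Sum>i\<le>p. f i z)"
  proof (rule infsum_cong)
    fix z
    have "E (l w) p = (\<Sum>i\<le>p. E (l z) i * E (l (w - z)) (p - i))"
      using binom[of "l z" "l (w - z)"] coordinate_additive[OF l, of z "w - z"] by simp
    then show "E (l w) p * (?c z * ?d (w - z) * twist z (w - z)) = (\<Sum>i\<le>p. f i z)"
      by (simp add: f_def sum_distrib_right sum_distrib_left mult_ac)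
  qed
  also have "\<dots> = (\<Sum>i\<le>p. infsum (f i) UNIV)"
    by (rule infsum_finite_sum) (rule fs)
  also have "\<dots> = (\<Sum>i\<le>p. fcoeff (fderiv l i x * fderiv l (p - i) y) w)"
    using l x y by (simp add: fcoeff_mult fderiv_smooth conv_def fcoeff_fderiv f_def[abs_def] E_def)
  also have "\<dots> = fcoeff (\<Sum>i\<le>p. fderiv l i x * fderiv l (p - i) y) w"
    using l x y by (simp add: fcoeff_sum fderiv_smooth smooth_mult)
  finally show "fcoeff (fderiv l p (x * y)) w = fcoeff (\<Sum>i\<le>p. fderiv l i x * fderiv l (p - i) y) w" .
qed

text \<open>Modulo \<open>t\<close> to the power \<open>J + 1\<close>, the formal Taylor expansion
  \<open>x \<mapsto> \<Sum>p. t\<^sup>p fderiv l p x\<close> is the exponential of a derivation, hence multiplicative by the Leibniz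
  rule. The sum of the norms of its coefficients is therefore submultiplicative.\<close>

definition jet_norm :: "(int \<times> int \<Rightarrow> int) \<Rightarrow> nat \<Rightarrow> real \<Rightarrow> 'a \<Rightarrow> real" where
  "jet_norm l J t x = (\<Sum>p\<le>J. t ^ p * norm (fderiv l p x))"

lemma jet_norm_nonneg: "0 \<le> t \<Longrightarrow> 0 \<le> jet_norm l J t x"
  unfolding jet_norm_def by (intro sum_nonneg mult_nonneg_nonneg) auto

lemma jet_norm_add:
  assumes "l \<in> {fst, snd}" "0 \<le> t" "x \<in> smooth" "y \<in> smooth"
  shows "jet_norm l J t (x + y) \<le> jet_norm l J t x + jet_norm l J t y"
  unfolding jet_norm_def sum.distrib[symmetric] distrib_left[symmetric]
  using assms by (intro sum_mono mult_left_mono) (auto simp: fderiv_add norm_triangle_ineq)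

lemma jet_norm_scaleC:
  assumes "l \<in> {fst, snd}" "x \<in> smooth"
  shows "jet_norm l J t (a *\<^sub>C x) = cmod a * jet_norm l J t x"
  unfolding jet_norm_def sum_distrib_left
  using assms by (intro sum.cong) (auto simp: fderiv_scaleC norm_scaleC)

lemma fderiv_const:
  assumes "l \<in> {fst, snd}"
  shows "fderiv l p 1 = (if p = 0 then 1 else 0)"
proof (rule smooth_eqI)
  have "l 0 = 0" using assms by auto
  then show "fcoeff (fderiv l p 1) z = fcoeff (if p = 0 then 1 else 0) z" for z
    by (simp add: fcoeff_fderiv[OF assms smooth_1] fcoeff_1 fcoeff_0)
qed (auto simp: fderiv_smooth[OF assms] smooth_0 smooth_1)

lemma jet_norm_1: "l \<in> {fst, snd} \<Longrightarrow> jet_norm l J t 1 = 1"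
  unfolding jet_norm_def by (simp add: fderiv_const if_distrib sum.delta cong: if_cong)

lemma jet_norm_0: "l \<in> {fst, snd} \<Longrightarrow> jet_norm l J t 0 = 0"
  using jet_norm_scaleC[OF _ smooth_0, of l J t 0] by simp

lemma jet_norm_sum:
  assumes "l \<in> {fst, snd}" "0 \<le> t" "\<And>i. i \<in> I \<Longrightarrow> f i \<in> smooth"
  shows "jet_norm l J t (\<Sum>i\<in>I. f i) \<le> (\<Sum>i\<in>I. jet_norm l J t (f i))"
  using assms(3)
proof (induction I rule: infinite_finite_induct)
  case (insert i I)
  then have "jet_norm l J t (f i + (\<Sum>i\<in>I. f i)) \<le> jet_norm l J t (f i) + jet_norm l J t (\<Sum>i\<in>I. f i)"
    by (intro jet_norm_add assms(1,2) smooth_sum) auto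
  with insert show ?case by fastforce
qed (auto simp: jet_norm_0[OF assms(1)])

lemma jet_norm_mult:
  assumes l: "l \<in> {fst, snd}" and t: "0 \<le> t" and x: "x \<in> smooth" and y: "y \<in> smooth"
  shows "jet_norm l J t (x * y) \<le> jet_norm l J t x * jet_norm l J t y"
proof -
  let ?f = "\<lambda>i j. (t ^ i * norm (fderiv l i x)) * (t ^ j * norm (fderiv l j y))"
  have "jet_norm l J t (x * y) \<le> (\<Sum>p\<le>J. \<Sum>i\<le>p. ?f i (p - i))"
    unfolding jet_norm_def
  proof (rule sum_mono)
    fix p
    have "norm (fderiv l p (x * y)) \<le> (\<Sum>i\<le>p. norm (fderiv l i x) * norm (fderiv l (p - i) y))"
      unfolding fderiv_mult[OF l x y] by (intro sum_norm_le norm_mult_ineq)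
    then have "t ^ p * norm (fderiv l p (x * y))
        \<le> t ^ p * (\<Sum>i\<le>p. norm (fderiv l i x) * norm (fderiv l (p - i) y))"
      using t by (intro mult_left_mono) auto
    also have "\<dots> = (\<Sum>i\<le>p. ?f i (p - i))"
      unfolding sum_distrib_left by (intro sum.cong refl) (simp add: power_add[symmetric])
    finally show "t ^ p * norm (fderiv l p (x * y)) \<le> (\<Sum>i\<le>p. ?f i (p - i))" .
  qed
  also have "\<dots> = (\<Sum>(i, j)\<in>{(i, j). i + j \<le> J}. ?f i j)"
    by (rule sum.triangle_reindex_eq[symmetric])
  also have "\<dots> \<le> (\<Sum>(i, j)\<in>{..J} \<times> {..J}. ?f i j)"
    using t by (intro sum_mono2) auto
  also have "\<dots> = jet_norm l J t x * jet_norm l J t y"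
    by (simp add: jet_norm_def sum_product sum.cartesian_product)
  finally show ?thesis .
qed

lemma jet_norm_power:
  assumes "l \<in> {fst, snd}" "0 \<le> t" "x \<in> smooth"
  shows "jet_norm l J t (x ^ n) \<le> jet_norm l J t x ^ n"
proof (induction n)
  case (Suc n)
  have "jet_norm l J t (x * x ^ n) \<le> jet_norm l J t x * jet_norm l J t (x ^ n)"
    using assms by (intro jet_norm_mult smooth_power)
  also have "\<dots> \<le> jet_norm l J t x * jet_norm l J t x ^ n"
    using Suc assms by (intro mult_left_mono jet_norm_nonneg)
  finally show ?case by simp
qed (simp add: jet_norm_1[OF assms(1)])

text \<open>At \<open>t = 0\<close> the jet norm is the C*-norm, and it is continuous in \<open>t\<close>. So whatever is contractive for
  the C*-norm is contractive for a jet norm with small \<open>t > 0\<close>, and the powers of such an element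
  decay geometrically together with all their derivatives.\<close>

lemma ex_jet_norm_less_1:
  assumes "finite I" "\<And>i. i \<in> I \<Longrightarrow> y i \<in> smooth" "(\<Sum>i\<in>I. norm (y i)) < 1"
  shows "\<exists>t>0. (\<Sum>i\<in>I. jet_norm l J t (y i)) < 1"
proof -
  have "((\<lambda>t. \<Sum>i\<in>I. jet_norm l J t (y i)) \<longlongrightarrow> (\<Sum>i\<in>I. jet_norm l J 0 (y i))) (at_right 0)"
    unfolding jet_norm_def by (intro tendsto_intros)
  moreover have "jet_norm l J 0 x = norm x" if "x \<in> smooth" for x
    using that by (simp add: jet_norm_def power_0_left fderiv_0 if_distrib[of "\<lambda>c. c * _"] sum.delta cong: if_cong)
  ultimately have "\<forall>\<^sub>F t in at_right 0. (\<Sum>i\<in>I. jet_norm l J t (y i)) < 1"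
    using assms by (intro order_tendstoD(2)) auto
  moreover have "\<forall>\<^sub>F t in at_right (0::real). t > 0" by (rule eventually_at_right_less)
  ultimately have "\<forall>\<^sub>F t in at_right 0. t > 0 \<and> (\<Sum>i\<in>I. jet_norm l J t (y i)) < 1"
    by eventually_elim simp
  then show ?thesis
    using eventually_happens trivial_limit_at_right_real by blast
qed

text \<open>Pure powers of the two derivations control all Schwartz norms, because
  \<open>(1 + \<bar>m\<bar> + \<bar>n\<bar>)\<^sup>k\<close> is at most a constant times \<open>1 + \<bar>m\<bar>\<^sup>k + \<bar>n\<bar>\<^sup>k\<close>.\<close>

lemma frechet_le_fderiv:
  assumes x: "x \<in> smooth"
  shows "frechet k x \<le> 3 ^ k * (norm x + fact k * norm (fderiv fst k x) + fact k * norm (fderiv snd k x))"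
proof (rule schwartz_norm_le)
  fix z :: "int \<times> int"
  obtain m n where z: "z = (m, n)" by (cases z)
  let ?c = "cmod (fcoeff x z)"
  have "weight z ^ k \<le> (3 * Max {1, \<bar>real_of_int m\<bar>, \<bar>real_of_int n\<bar>}) ^ k"
    by (intro power_mono) (auto simp: z weight_def)
  also have "\<dots> \<le> 3 ^ k * (1 + \<bar>of_int m\<bar> ^ k + \<bar>of_int n\<bar> ^ k)"
    by (auto simp: power_mult_distrib max_def)
  finally have "weight z ^ k * ?c \<le> 3 ^ k * (1 + \<bar>of_int m\<bar> ^ k + \<bar>of_int n\<bar> ^ k) * ?c"
    by (rule mult_right_mono) simp
  also have "\<dots> = 3 ^ k * (?c + \<bar>of_int m\<bar> ^ k * ?c + \<bar>of_int n\<bar> ^ k * ?c)"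
    by (simp add: algebra_simps)
  also have "\<dots> \<le> 3 ^ k * (norm x + fact k * norm (fderiv fst k x) + fact k * norm (fderiv snd k x))"
  proof (intro mult_left_mono add_mono)
    show "?c \<le> norm x" by (rule cmod_fcoeff_le[OF x])
    have "\<bar>of_int (l z)\<bar> ^ k * ?c \<le> fact k * norm (fderiv l k x)" if l: "l \<in> {fst, snd}" for l
      using cmod_fcoeff_le[OF fderiv_smooth[OF l x], of k z]
      by (simp add: fcoeff_fderiv[OF l x] norm_mult norm_divide norm_power pos_divide_le_eq mult.commute)
    from this[of fst] this[of snd]
    show "\<bar>of_int m\<bar> ^ k * ?c \<le> fact k * norm (fderiv fst k x)"
      "\<bar>of_int n\<bar> ^ k * ?c \<le> fact k * norm (fderiv snd k x)" by (auto simp: z)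
  qed simp
  finally show "weight z ^ k * ?c
      \<le> 3 ^ k * (norm x + fact k * norm (fderiv fst k x) + fact k * norm (fderiv snd k x))" .
qed

lemma summable_frechet:
  assumes X: "\<And>n. X n \<in> smooth"
    and jet: "\<And>l J. l \<in> {fst, snd} \<Longrightarrow>
      \<exists>t>0. \<exists>C \<rho>. 0 \<le> \<rho> \<and> \<rho> < 1 \<and> (\<forall>n. jet_norm l J t (X n) \<le> C * \<rho> ^ n)"
  shows "summable (\<lambda>n. frechet k (X n))"
proof -
  have sj: "summable (\<lambda>n. norm (fderiv l J (X n)))" if l: "l \<in> {fst, snd}" for l J
  proof -
    obtain t C \<rho> where t: "t > 0" "0 \<le> \<rho>" "\<rho> < 1" "\<And>n. jet_norm l J t (X n) \<le> C * \<rho> ^ n"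
      using jet[OF l] by blast
    show ?thesis
    proof (rule summable_comparison_test')
      show "summable (\<lambda>n. C / t ^ J * \<rho> ^ n)" using t by (intro summable_mult) simp
      fix n
      have "t ^ J * norm (fderiv l J (X n)) \<le> jet_norm l J t (X n)"
        unfolding jet_norm_def
        using t by (intro member_le_sum[where f = "\<lambda>p. t ^ p * norm (fderiv l p (X n))"]) auto
      then show "norm (norm (fderiv l J (X n))) \<le> C / t ^ J * \<rho> ^ n"
        using t(4)[of n] t(1) by (simp add: field_simps)
    qed
  qed
  have "summable (\<lambda>n. norm (X n))" using sj[of fst 0] by (simp add: fderiv_0 X)
  then have "summable (\<lambda>n. 3 ^ k * (norm (X n) + fact k * norm (fderiv fst k (X n))
      + fact k * norm (fderiv snd k (X n))))"
    by (intro summable_mult summable_add sj) auto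
  then show ?thesis
    by (rule summable_comparison_test') (use frechet_le_fderiv X frechet_nonneg in auto)
qed

lemma isqrt_one_minus_smooth:
  assumes x: "x \<in> smooth" "norm x < 1"
  shows "isqrt_one_minus x \<in> smooth"
proof -
  have sm: "isqrt_coeff n *\<^sub>R x ^ n \<in> smooth" for n by (intro smooth_scaleR smooth_power x)
  show ?thesis
    unfolding isqrt_one_minus_def
  proof (rule smooth_suminf(2)[OF sm summable_frechet[OF sm]])
  fix l :: "int \<times> int \<Rightarrow> int" and J assume l: "l \<in> {fst, snd}"
  obtain t where t: "t > 0" "jet_norm l J t x < 1"
    using ex_jet_norm_less_1[of "{()}" "\<lambda>_. x" l J] x by auto
  have "jet_norm l J t (isqrt_coeff n *\<^sub>R x ^ n) \<le> 1 * jet_norm l J t x ^ n" for n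
  proof -
    have "jet_norm l J t (isqrt_coeff n *\<^sub>R x ^ n) = \<bar>isqrt_coeff n\<bar> * jet_norm l J t (x ^ n)"
      using l x by (simp add: scaleR_scaleC jet_norm_scaleC smooth_power)
    also have "\<dots> \<le> 1 * jet_norm l J t x ^ n"
      using t l x by (intro mult_mono abs_isqrt_coeff jet_norm_power jet_norm_nonneg) auto
    finally show ?thesis .
  qed
  then show "\<exists>t>0. \<exists>C \<rho>. 0 \<le> \<rho> \<and> \<rho> < 1 \<and> (\<forall>n. jet_norm l J t (isqrt_coeff n *\<^sub>R x ^ n) \<le> C * \<rho> ^ n)"
    using t jet_norm_nonneg[of t l J x] by (meson less_imp_le)
qed
qed

end

section \<open>Traces and K-theory classes\<close>

text \<open>Dimension-indexed forms of the ring laws, which the simplifier can apply without guessing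
  sizes.\<close>

lemma mat_assoc:
  "dim_col A = dim_row B \<Longrightarrow> dim_col B = dim_row C \<Longrightarrow> A * B * C = A * (B * (C :: 'a::semiring_0 mat))"
  by (rule assoc_mult_mat[of _ "dim_row A" "dim_row B" _ "dim_row C" _ "dim_col C"]) auto

lemma mat_diff_mult:
  "dim_row A = dim_row B \<Longrightarrow> dim_col A = dim_col B \<Longrightarrow> dim_col B = dim_row C \<Longrightarrow>
    (A - B) * C = A * C - B * (C :: 'a::ring mat)"
  by (rule minus_mult_distrib_mat[of _ "dim_row A" "dim_col A" _ _ "dim_col C"]) auto

lemma mat_mult_diff:
  "dim_row B = dim_row C \<Longrightarrow> dim_col B = dim_col C \<Longrightarrow> dim_col A = dim_row B \<Longrightarrow>
    A * (B - C) = A * B - A * (C :: 'a::ring mat)"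
  by (rule mult_minus_distrib_mat[of _ "dim_row A" "dim_col A" _ "dim_col B"]) auto

lemma mat_add_mult:
  "dim_row A = dim_row B \<Longrightarrow> dim_col A = dim_col B \<Longrightarrow> dim_col B = dim_row C \<Longrightarrow>
    (A + B) * C = A * C + B * (C :: 'a::semiring_0 mat)"
  by (rule add_mult_distrib_mat[of _ "dim_row A" "dim_col A" _ _ "dim_col C"]) auto

lemma mat_mult_add:
  "dim_row B = dim_row C \<Longrightarrow> dim_col B = dim_col C \<Longrightarrow> dim_col A = dim_row B \<Longrightarrow>
    A * (B + C) = A * B + A * (C :: 'a::semiring_0 mat)"
  by (rule mult_add_distrib_mat[of _ "dim_row A" "dim_col A" _ "dim_col B"]) auto

lemma mat_mult_entry:
  "i < dim_row A \<Longrightarrow> j < dim_col B \<Longrightarrow> dim_col A = dim_row B \<Longrightarrow>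
    (A * B) $$ (i, j) = (\<Sum>l<dim_row B. A $$ (i, l) * B $$ (l, j))"
  by (simp add: scalar_prod_def atLeast0LessThan)

definition mat_over :: "'a set \<Rightarrow> 'a mat \<Rightarrow> bool" where
  "mat_over S A \<longleftrightarrow> (\<forall>i<dim_row A. \<forall>j<dim_col A. A $$ (i, j) \<in> S)"

lemma elements_mat_subset_iff: "elements_mat A \<subseteq> S \<longleftrightarrow> mat_over S A"
  unfolding mat_over_def by (auto dest!: elements_matD)

lemma mat_over_add:
  "dim_row A = dim_row C \<Longrightarrow> dim_col A = dim_col C \<Longrightarrow> mat_over S A \<Longrightarrow> mat_over S C \<Longrightarrow>
    (\<And>x y. x \<in> S \<Longrightarrow> y \<in> S \<Longrightarrow> x + y \<in> S) \<Longrightarrow> mat_over S (A + C)"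
  by (auto simp: mat_over_def)

definition mat_trace :: "('a \<Rightarrow> 'b::comm_monoid_add) \<Rightarrow> 'a mat \<Rightarrow> 'b" where
  "mat_trace f A = (\<Sum>i<dim_row A. f (A $$ (i, i)))"

definition entry_sum :: "('a \<Rightarrow> real) \<Rightarrow> 'a mat \<Rightarrow> real" where
  "entry_sum f A = (\<Sum>i<dim_row A. \<Sum>j<dim_col A. f (A $$ (i, j)))"

text \<open>The sum over the inner index of the product is at most the product of two independent sums. The
  function \<open>f\<close> will be the norm or a jet norm.\<close>

lemma entry_sum_mult_le:
  fixes A B :: "'a::semiring_0 mat"
  assumes dims: "dim_col A = dim_row B"
    and S: "mat_over S A" "mat_over S B" and mult: "\<And>x y. x \<in> S \<Longrightarrow> y \<in> S \<Longrightarrow> x * y \<in> S"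
    and f0: "\<And>x. 0 \<le> f x"
    and fm: "\<And>x y. x \<in> S \<Longrightarrow> y \<in> S \<Longrightarrow> f (x * y) \<le> f x * f y"
    and fs: "\<And>(g::nat \<Rightarrow> 'a) I. (\<And>i. i \<in> I \<Longrightarrow> g i \<in> S) \<Longrightarrow> f (\<Sum>i\<in>I. g i) \<le> (\<Sum>i\<in>I. f (g i))"
  shows "entry_sum f (A * B) \<le> entry_sum f A * entry_sum f B"
proof -
  let ?a = "\<lambda>i l. f (A $$ (i, l))" and ?b = "\<lambda>l j. f (B $$ (l, j))"
  let ?m = "dim_row B"
  have "entry_sum f (A * B) \<le> (\<Sum>i<dim_row A. \<Sum>j<dim_col B. \<Sum>l<?m. ?a i l * ?b l j)"
    unfolding entry_sum_def index_mult_mat(2,3)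
  proof (intro sum_mono)
    fix i j assume ij: "i \<in> {..<dim_row A}" "j \<in> {..<dim_col B}"
    have AB: "A $$ (i, l) \<in> S" "B $$ (l, j) \<in> S" if "l < ?m" for l
      using S ij that dims by (auto simp: mat_over_def)
    have "f ((A * B) $$ (i, j)) = f (\<Sum>l<?m. A $$ (i, l) * B $$ (l, j))"
      using ij dims by (subst mat_mult_entry) auto
    also have "\<dots> \<le> (\<Sum>l<?m. f (A $$ (i, l) * B $$ (l, j)))"
      using AB by (intro fs mult) auto
    also have "\<dots> \<le> (\<Sum>l<?m. ?a i l * ?b l j)"
      using AB by (intro sum_mono fm) auto
    finally show "f ((A * B) $$ (i, j)) \<le> (\<Sum>l<?m. ?a i l * ?b l j)" .
  qed
  also have "\<dots> = (\<Sum>i<dim_row A. \<Sum>l<?m. ?a i l * (\<Sum>j<dim_col B. ?b l j))"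
    unfolding sum_distrib_left by (intro sum.cong refl sum.swap)
  also have "\<dots> \<le> (\<Sum>i<dim_row A. \<Sum>l<?m. ?a i l * entry_sum f B)"
    unfolding entry_sum_def
    by (intro sum_mono mult_left_mono f0 member_le_sum[where f = "\<lambda>l. \<Sum>j<dim_col B. ?b l j"])
      (auto intro!: sum_nonneg f0)
  also have "\<dots> = entry_sum f A * entry_sum f B"
    by (simp add: entry_sum_def[of f A] sum_distrib_right dims)
  finally show ?thesis .
qed

text \<open>A *-subalgebra \<open>S\<close>, dense in \<open>B\<close>, for which matrices over \<open>S\<close> close to the identity have their
  inverses over \<open>S\<close>. Closeness refers to the sum of the norms of the entries, which is
  submultiplicative.\<close>

locale dense_spectral_subalgebra = closed_unital_subalgebra B for B :: "'a::cstar_algebra set" +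
  fixes S :: "'a set"
  assumes S_subset: "S \<subseteq> B" and S_0: "0 \<in> S" and S_1: "1 \<in> S"
    and S_add: "\<And>x y. x \<in> S \<Longrightarrow> y \<in> S \<Longrightarrow> x + y \<in> S"
    and S_mult: "\<And>x y. x \<in> S \<Longrightarrow> y \<in> S \<Longrightarrow> x * y \<in> S"
    and S_uminus: "\<And>x. x \<in> S \<Longrightarrow> - x \<in> S"
    and S_dense: "\<And>x. x \<in> B \<Longrightarrow> \<exists>a. (\<forall>n::nat. a n \<in> S) \<and> a \<longlonglongrightarrow> x"
    and S_neumann: "\<And>Y n. Y \<in> carrier_mat n n \<Longrightarrow> mat_over S Y \<Longrightarrow> entry_sum norm Y < 1 \<Longrightarrow>
      \<exists>Z\<in>carrier_mat n n. mat_over S Z \<and> Z * (1\<^sub>m n - Y) = 1\<^sub>m n \<and> (1\<^sub>m n - Y) * Z = 1\<^sub>m n"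
begin

lemma S_sum: "(\<And>i. i \<in> I \<Longrightarrow> f i \<in> S) \<Longrightarrow> (\<Sum>i\<in>I. f i) \<in> S"
  by (induction I rule: infinite_finite_induct) (auto simp: S_0 S_add)

lemma S_diff: "x \<in> S \<Longrightarrow> y \<in> S \<Longrightarrow> x - y \<in> S"
  using S_add[of x "- y"] S_uminus by simp

lemma mat_over_mult: "dim_col A = dim_row C \<Longrightarrow> mat_over S A \<Longrightarrow> mat_over S C \<Longrightarrow> mat_over S (A * C)"
  by (auto simp: mat_over_def mat_mult_entry simp del: index_mult_mat(1) intro!: S_sum S_mult)

lemma mat_over_diff:
  "dim_row A = dim_row C \<Longrightarrow> dim_col A = dim_col C \<Longrightarrow> mat_over S A \<Longrightarrow> mat_over S C \<Longrightarrow> mat_over S (A - C)"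
  by (auto simp: mat_over_def intro!: S_diff)

lemma B_mat_over_mult: "dim_col A = dim_row C \<Longrightarrow> mat_over B A \<Longrightarrow> mat_over B C \<Longrightarrow> mat_over B (A * C)"
  by (auto simp: mat_over_def mat_mult_entry simp del: index_mult_mat(1) intro!: sum mult)

definition mat_tendsto :: "(nat \<Rightarrow> 'a mat) \<Rightarrow> 'a mat \<Rightarrow> bool" where
  "mat_tendsto F A \<longleftrightarrow> (\<forall>k. dim_row (F k) = dim_row A \<and> dim_col (F k) = dim_col A) \<and>
    (\<forall>i<dim_row A. \<forall>j<dim_col A. (\<lambda>k. F k $$ (i, j)) \<longlonglongrightarrow> A $$ (i, j))"

lemma mat_approx:
  assumes "mat_over B A"
  obtains F where "\<And>k::nat. mat_over S (F k)" "mat_tendsto F A"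
proof -
  have "\<forall>i j. \<exists>a. i < dim_row A \<longrightarrow> j < dim_col A \<longrightarrow> (\<forall>k::nat. a k \<in> S) \<and> a \<longlonglongrightarrow> A $$ (i, j)"
    using assms S_dense unfolding mat_over_def by blast
  then obtain a where a: "\<And>i j. i < dim_row A \<Longrightarrow> j < dim_col A \<Longrightarrow>
      (\<forall>k::nat. a i j k \<in> S) \<and> a i j \<longlonglongrightarrow> A $$ (i, j)"
    by metis
  show thesis
    by (rule that[of "\<lambda>k. mat (dim_row A) (dim_col A) (\<lambda>(i, j). a i j k)"])
      (use a in \<open>auto simp: mat_over_def mat_tendsto_def\<close>)
qed

lemma mat_tendsto_const: "mat_tendsto (\<lambda>_. A) A"
  by (simp add: mat_tendsto_def)

lemma mat_tendsto_mult:
  assumes "mat_tendsto F A" "mat_tendsto G C" "dim_col A = dim_row C"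
  shows "mat_tendsto (\<lambda>k. F k * G k) (A * C)"
proof -
  have "(\<lambda>k. (F k * G k) $$ (i, j)) \<longlonglongrightarrow> (A * C) $$ (i, j)"
    if "i < dim_row A" "j < dim_col C" for i j
  proof -
    have "(\<lambda>k. (F k * G k) $$ (i, j)) = (\<lambda>k. \<Sum>l<dim_row C. F k $$ (i, l) * G k $$ (l, j))"
      using assms that by (intro ext, subst mat_mult_entry) (auto simp: mat_tendsto_def)
    moreover have "(\<lambda>k. \<Sum>l<dim_row C. F k $$ (i, l) * G k $$ (l, j)) \<longlonglongrightarrow> (\<Sum>l<dim_row C. A $$ (i, l) * C $$ (l, j))"
      using assms that by (intro tendsto_sum tendsto_mult) (auto simp: mat_tendsto_def)
    ultimately show ?thesis using that assms(3) by (simp only: mat_mult_entry)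
  qed
  then show ?thesis using assms by (auto simp: mat_tendsto_def)
qed

lemma mat_tendsto_diff:
  assumes "mat_tendsto F A" "mat_tendsto G C" "dim_row A = dim_row C" "dim_col A = dim_col C"
  shows "mat_tendsto (\<lambda>k. F k - G k) (A - C)"
  using assms by (auto simp: mat_tendsto_def intro!: tendsto_diff)

lemma mat_tendsto_0_entry_sum:
  assumes "mat_tendsto F (0\<^sub>m n m)"
  shows "\<forall>\<^sub>F k in sequentially. entry_sum norm (F k) < 1"
proof -
  have "(\<lambda>k. \<Sum>i<n. \<Sum>j<m. norm (F k $$ (i, j))) \<longlonglongrightarrow> (\<Sum>i<n. \<Sum>j<m. norm (0::'a))"
    using assms by (intro tendsto_sum tendsto_norm) (auto simp: mat_tendsto_def)
  then have "\<forall>\<^sub>F k in sequentially. (\<Sum>i<n. \<Sum>j<m. norm (F k $$ (i, j))) < 1"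
    by (intro order_tendstoD(2)) auto
  then show ?thesis using assms by (simp add: entry_sum_def mat_tendsto_def)
qed

definition is_trace :: "('a \<Rightarrow> 'b::ab_group_add) \<Rightarrow> bool" where
  "is_trace \<phi> \<longleftrightarrow> (\<forall>x\<in>S. \<forall>y\<in>S. \<phi> (x + y) = \<phi> x + \<phi> y \<and> \<phi> (x * y) = \<phi> (y * x))"

lemma is_trace_0: "is_trace \<phi> \<Longrightarrow> \<phi> 0 = 0"
  using S_0 unfolding is_trace_def by (metis add_cancel_right_right)

lemma is_trace_sum:
  "is_trace \<phi> \<Longrightarrow> (\<And>i. i \<in> I \<Longrightarrow> f i \<in> S) \<Longrightarrow> \<phi> (\<Sum>i\<in>I. f i) = (\<Sum>i\<in>I. \<phi> (f i))"
proof (induction I rule: infinite_finite_induct)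
  case (insert i I)
  then show ?case using S_sum[of I f] by (simp add: is_trace_def)
qed (auto simp: is_trace_0)

lemma mat_trace_mult_commute:
  assumes "is_trace \<phi>" "mat_over S A" "mat_over S C" "dim_col A = dim_row C" "dim_col C = dim_row A"
  shows "mat_trace \<phi> (A * C) = mat_trace \<phi> (C * A)"
proof -
  have S: "A $$ (i, l) \<in> S" "C $$ (l, i) \<in> S" if "i < dim_row A" "l < dim_row C" for i l
    using assms that by (auto simp: mat_over_def)
  have "mat_trace \<phi> (A * C) = (\<Sum>i<dim_row A. \<Sum>l<dim_row C. \<phi> (A $$ (i, l) * C $$ (l, i)))"
    unfolding mat_trace_def index_mult_mat(2)
  proof (intro sum.cong refl)
    fix i assume "i \<in> {..<dim_row A}"
    then show "\<phi> ((A * C) $$ (i, i)) = (\<Sum>l<dim_row C. \<phi> (A $$ (i, l) * C $$ (l, i)))"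
      using assms S by (subst mat_mult_entry) (auto intro!: is_trace_sum S_mult)
  qed
  also have "\<dots> = (\<Sum>i<dim_row A. \<Sum>l<dim_row C. \<phi> (C $$ (l, i) * A $$ (i, l)))"
    using assms(1) S by (intro sum.cong refl) (auto simp: is_trace_def)
  also have "\<dots> = (\<Sum>l<dim_row C. \<Sum>i<dim_row A. \<phi> (C $$ (l, i) * A $$ (i, l)))"
    by (rule sum.swap)
  also have "\<dots> = mat_trace \<phi> (C * A)"
    unfolding mat_trace_def index_mult_mat(2)
  proof (intro sum.cong refl)
    fix l assume "l \<in> {..<dim_row C}"
    then show "(\<Sum>i<dim_row A. \<phi> (C $$ (l, i) * A $$ (i, l))) = \<phi> ((C * A) $$ (l, l))"
      using assms S by (subst mat_mult_entry) (auto intro!: is_trace_sum[symmetric] S_mult)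
  qed
  finally show ?thesis .
qed

text \<open>The matrices \<open>a\<close> and \<open>b\<close> have approximations over \<open>S\<close>. Their products are close to \<open>P\<close> and \<open>Q\<close> and
  can be corrected by inverses over \<open>S\<close>, so that \<open>P\<close> and \<open>Q\<close> become equivalent over \<open>S\<close>, where the trace
  property applies.\<close>

lemma trace_eq_of_equivalent_idempotents:
  assumes tr: "is_trace \<phi>"
    and P: "P \<in> carrier_mat n n" "mat_over S P" "P * P = P"
    and Q: "Q \<in> carrier_mat m m" "mat_over S Q" "Q * Q = Q"
    and a: "a \<in> carrier_mat m n" "mat_over B a" and b: "b \<in> carrier_mat n m" "mat_over B b"
    and ba: "b * a = P" and ab: "a * b = Q"
  shows "mat_trace \<phi> P = mat_trace \<phi> Q"
proof -
  note dims = P(1) Q(1) a(1) b(1)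
  have [simp]: "dim_row P = n" "dim_col P = n" "dim_row Q = m" "dim_col Q = m"
    "dim_row a = m" "dim_col a = n" "dim_row b = n" "dim_col b = m"
    using dims by auto
  have PP: "P * (P * X) = P * X" and b_a: "b * (a * X) = P * X" if "dim_row X = n" for X
    using that by (simp_all add: mat_assoc[symmetric] P ba)
  have QQ: "Q * (Q * X) = Q * X" and a_b: "a * (b * X) = Q * X" if "dim_row X = m" for X
    using that by (simp_all add: mat_assoc[symmetric] Q ab)
  have Qa: "Q * (a * X) = a * (P * X)" if "dim_row X = n" for X
    using that a_b[of "a * X"] by (simp add: b_a)
  have Pb: "P * (b * X) = b * (Q * X)" if "dim_row X = m" for X
    using that b_a[of "b * X"] by (simp add: a_b)
  obtain F where F: "\<And>k. mat_over S (F k)" "mat_tendsto F a" using mat_approx[OF a(2)] by blast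
  obtain G where G: "\<And>k. mat_over S (G k)" "mat_tendsto G b" using mat_approx[OF b(2)] by blast
  have [simp]: "dim_row (F k) = m" "dim_col (F k) = n" "dim_row (G k) = n" "dim_col (G k) = m" for k
    using F(2) G(2) by (auto simp: mat_tendsto_def)
  define A where "A k = Q * (F k * P)" for k
  define C where "C k = P * (G k * Q)" for k
  have dA [simp]: "dim_row (A k) = m" "dim_col (A k) = n"
    and dC [simp]: "dim_row (C k) = n" "dim_col (C k) = m" for k
    by (auto simp: A_def C_def)
  have SA: "mat_over S (A k)" and SC: "mat_over S (C k)" for k
    unfolding A_def C_def using F(1) G(1) P(2) Q(2) by (auto intro!: mat_over_mult)
  have lim: "mat_tendsto A (Q * (a * P))" "mat_tendsto C (P * (b * Q))"
    unfolding A_def C_def by (auto intro!: mat_tendsto_mult mat_tendsto_const F G)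
  have e1: "P * (b * Q) * (Q * (a * P)) = P" and e2: "Q * (a * P) * (P * (b * Q)) = Q"
    by (simp_all add: mat_assoc QQ PP Qa b_a a_b Pb P(3) Q(3))
  have "mat_tendsto (\<lambda>k. P - C k * A k) (0\<^sub>m n n)"
    using mat_tendsto_diff[OF mat_tendsto_const mat_tendsto_mult[OF lim(2,1)], of P]
    by (simp add: e1 minus_r_inv_mat[OF P(1)])
  from mat_tendsto_0_entry_sum[OF this]
  have ev1: "\<forall>\<^sub>F k in sequentially. entry_sum norm (P - C k * A k) < 1" .
  have "mat_tendsto (\<lambda>k. Q - A k * C k) (0\<^sub>m m m)"
    using mat_tendsto_diff[OF mat_tendsto_const mat_tendsto_mult[OF lim], of Q]
    by (simp add: e2 minus_r_inv_mat[OF Q(1)])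
  from mat_tendsto_0_entry_sum[OF this]
  have "\<forall>\<^sub>F k in sequentially. entry_sum norm (Q - A k * C k) < 1" .
  with ev1 have "\<forall>\<^sub>F k in sequentially.
      entry_sum norm (P - C k * A k) < 1 \<and> entry_sum norm (Q - A k * C k) < 1"
    by (rule eventually_conj)
  then obtain k where k: "entry_sum norm (P - C k * A k) < 1" "entry_sum norm (Q - A k * C k) < 1"
    unfolding eventually_sequentially by auto
  have "mat_over S (P - C k * A k)" "mat_over S (Q - A k * C k)"
    using SA SC P Q by (auto intro!: mat_over_diff mat_over_mult)
  moreover have car: "P - C k * A k \<in> carrier_mat n n" "Q - A k * C k \<in> carrier_mat m m"
    by auto
  ultimately obtain s t where
    s: "s \<in> carrier_mat n n" "mat_over S s" "s * (1\<^sub>m n - (P - C k * A k)) = 1\<^sub>m n" and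
    t: "t \<in> carrier_mat m m" "mat_over S t" "(1\<^sub>m m - (Q - A k * C k)) * t = 1\<^sub>m m"
    using S_neumann[OF car(1)] S_neumann[OF car(2)] k by blast
  have [simp]: "dim_row s = n" "dim_col s = n" "dim_row t = m" "dim_col t = m"
    using s(1) t(1) by auto
  have AP: "A k * P = A k" "Q * A k = A k" "P * C k = C k" "C k * Q = C k"
    unfolding A_def C_def by (simp_all add: mat_assoc P Q QQ PP)
  have diff: "X - (X - Y) = Y" if "dim_row X = dim_row Y" "dim_col X = dim_col Y" for X Y :: "'a mat"
    using that by (intro eq_matI) auto
  have "(1\<^sub>m n - (P - C k * A k)) * P = C k * A k"
    by (simp add: mat_diff_mult mat_assoc AP P diff)
  then have "s * (C k * A k) = s * (1\<^sub>m n - (P - C k * A k)) * P"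
    by (simp add: mat_assoc)
  then have sCA: "s * (C k * A k) = P" by (simp add: s)
  have "Q * (1\<^sub>m m - (Q - A k * C k)) = A k * C k"
    by (simp add: mat_mult_diff mat_assoc[symmetric] AP Q diff)
  then have "A k * C k * t = Q * ((1\<^sub>m m - (Q - A k * C k)) * t)"
    by (simp add: mat_assoc[symmetric])
  then have ACt: "A k * C k * t = Q" by (simp add: t)
  \<comment> \<open>\<open>e\<close> is an idempotent below \<open>Q\<close>. It fixes \<open>A k * C k\<close>, whose right multiples reach \<open>Q\<close>, so \<open>e = Q\<close>.\<close>
  define e where "e = A k * (s * C k)"
  have "e * (A k * C k) = A k * ((s * (C k * A k)) * C k)"
    by (simp add: e_def mat_assoc)
  then have eAC: "e * (A k * C k) = A k * C k" by (simp add: sCA AP)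
  have "e * Q = e * (A k * C k) * t"
    unfolding ACt[symmetric] by (simp add: mat_assoc e_def)
  then have "e * Q = Q" by (simp only: eAC ACt)
  moreover have "e * Q = e" by (simp add: e_def mat_assoc AP)
  ultimately have "mat_trace \<phi> Q = mat_trace \<phi> (A k * (s * C k))" by (simp add: e_def)
  also have "\<dots> = mat_trace \<phi> (s * C k * A k)"
    using s(2) SA SC by (intro mat_trace_mult_commute tr mat_over_mult) auto
  also have "\<dots> = mat_trace \<phi> P" by (simp add: mat_assoc sCA)
  finally show ?thesis by simp
qed

lemma mat_trace_block_diag:
  assumes "p \<in> carrier_mat n n" "r \<in> carrier_mat l l"
  shows "mat_trace \<phi> (four_block_mat p (0\<^sub>m n l) (0\<^sub>m l n) r) = mat_trace \<phi> p + mat_trace \<phi> r"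
proof -
  let ?M = "four_block_mat p (0\<^sub>m n l) (0\<^sub>m l n) r"
  have [simp]: "dim_row p = n" "dim_col p = n" "dim_row r = l" "dim_col r = l" using assms by auto
  have "i \<in> (\<lambda>i. n + i) ` {..<l}" if "i < n + l" "\<not> i < n" for i
    using that by (intro image_eqI[of _ _ "i - n"]) auto
  then have "{..<n + l} = {..<n} \<union> (\<lambda>i. n + i) ` {..<l}"
    by auto
  then have "mat_trace \<phi> ?M = (\<Sum>i\<in>{..<n} \<union> (\<lambda>i. n + i) ` {..<l}. \<phi> (?M $$ (i, i)))"
    unfolding mat_trace_def by simp
  also have "\<dots> = (\<Sum>i<n. \<phi> (?M $$ (i, i))) + (\<Sum>i\<in>(\<lambda>i. n + i) ` {..<l}. \<phi> (?M $$ (i, i)))"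
    by (rule sum.union_disjoint) auto
  also have "(\<Sum>i\<in>(\<lambda>i. n + i) ` {..<l}. \<phi> (?M $$ (i, i))) = (\<Sum>i<l. \<phi> (r $$ (i, i)))"
    by (subst sum.reindex) (auto simp: inj_on_def)
  finally show ?thesis by (simp add: mat_trace_def)
qed

lemma dsum_empty: "square_mat p \<Longrightarrow> p \<oplus>\<^sub>m 0\<^sub>m 0 0 = p"
  unfolding dsum_def by (intro eq_matI) auto

text \<open>If \<open>p \<oplus> r\<close> and \<open>q \<oplus> r\<close> are Murray-von Neumann equivalent over \<open>B\<close>, adding \<open>1 - r\<close> in the last
  corner makes \<open>p \<oplus> 1\<close> and \<open>q \<oplus> 1\<close> equivalent, so the auxiliary projection \<open>r\<close>, which need
  not lie over \<open>S\<close>, disappears.\<close>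

theorem trace_eq_of_K0_rel:
  assumes tr: "is_trace \<phi>" and p: "mat_over S p" and q: "mat_over S q"
    and rel: "((p, 0\<^sub>m 0 0), (q, 0\<^sub>m 0 0)) \<in> K0_rel B"
  shows "mat_trace \<phi> p = mat_trace \<phi> q"
proof -
  obtain r where pr: "p \<in> mat_projections B" "q \<in> mat_projections B" and r: "r \<in> mat_projections B"
    and eq: "mvn_equiv B (p \<oplus>\<^sub>m 0\<^sub>m 0 0 \<oplus>\<^sub>m r) (q \<oplus>\<^sub>m 0\<^sub>m 0 0 \<oplus>\<^sub>m r)"
    using rel unfolding K0_rel_def by blast
  define n m l where "n = dim_row p" and "m = dim_row q" and "l = dim_row r"
  have [simp]: "dim_row p = n" "dim_col p = n" "dim_row q = m" "dim_col q = m" "dim_row r = l" "dim_col r = l"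
    using pr r by (auto simp: mat_projections_def n_def m_def l_def)
  have car: "p \<in> carrier_mat n n" "q \<in> carrier_mat m m" "r \<in> carrier_mat l l" by auto
  have idem: "p * p = p" "q * q = q" "r * r = r" and over: "mat_over B p" "mat_over B q" "mat_over B r"
    using pr r by (auto simp: mat_projections_def elements_mat_subset_iff)
  define P1 where "P1 = four_block_mat p (0\<^sub>m n l) (0\<^sub>m l n) r"
  define Q1 where "Q1 = four_block_mat q (0\<^sub>m m l) (0\<^sub>m l m) r"
  define P where "P = four_block_mat p (0\<^sub>m n l) (0\<^sub>m l n) (1\<^sub>m l)"
  define Q where "Q = four_block_mat q (0\<^sub>m m l) (0\<^sub>m l m) (1\<^sub>m l)"
  define E where "E = four_block_mat (0\<^sub>m m n) (0\<^sub>m m l) (0\<^sub>m l n) (1\<^sub>m l - r)"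
  define E' where "E' = four_block_mat (0\<^sub>m n m) (0\<^sub>m n l) (0\<^sub>m l m) (1\<^sub>m l - r)"
  note defs = P1_def Q1_def P_def Q_def E_def E'_def
  have dsum: "p \<oplus>\<^sub>m 0\<^sub>m 0 0 \<oplus>\<^sub>m r = P1" "q \<oplus>\<^sub>m 0\<^sub>m 0 0 \<oplus>\<^sub>m r = Q1"
    using dsum_empty[of p] dsum_empty[of q] by (simp_all add: dsum_def P1_def Q1_def)
  have dims1 [simp]: "dim_row P1 = n + l" "dim_col P1 = n + l" "dim_row Q1 = m + l" "dim_col Q1 = m + l"
    by (simp_all add: defs)
  obtain v where v: "v \<in> carrier_mat (m + l) (n + l)" "mat_over B v"
    "mat_star v * v = P1" "v * mat_star v = Q1"
    using eq unfolding dsum mvn_equiv_def elements_mat_subset_iff dims1 by blast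
  define w where "w = mat_star v"
  have w: "w \<in> carrier_mat (n + l) (m + l)" "mat_over B w"
    using v by (auto simp: w_def mat_star_def mat_over_def star)
  have dims [simp]: "dim_row v = m + l" "dim_col v = n + l" "dim_row w = n + l" "dim_col w = m + l"
    "dim_row P = n + l" "dim_col P = n + l" "dim_row Q = m + l" "dim_col Q = m + l"
    "dim_row E = m + l" "dim_col E = n + l" "dim_row E' = n + l" "dim_col E' = m + l"
    using v(1) w(1) by (auto simp: defs)
  have r1: "r * (1\<^sub>m l - r) = 0\<^sub>m l l" "(1\<^sub>m l - r) * r = 0\<^sub>m l l" "(1\<^sub>m l - r) * (1\<^sub>m l - r) = 1\<^sub>m l - r"
  proof -
    show 1: "r * (1\<^sub>m l - r) = 0\<^sub>m l l"
      by (simp add: mat_mult_diff idem minus_r_inv_mat[OF car(3)])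
    show "(1\<^sub>m l - r) * r = 0\<^sub>m l l"
      by (simp add: mat_diff_mult idem minus_r_inv_mat[OF car(3)])
    show "(1\<^sub>m l - r) * (1\<^sub>m l - r) = 1\<^sub>m l - r"
      by (subst mat_diff_mult) (simp_all add: 1, intro eq_matI, auto)
  qed
  have r2: "r + (1\<^sub>m l - r) = 1\<^sub>m l" by (intro eq_matI) auto
  have cr: "1\<^sub>m l - r \<in> carrier_mat l l" by auto
  have PP: "P1 * P1 = P1" "Q1 * Q1 = Q1" "P * P = P" "Q * Q = Q"
    unfolding defs using car
    by (simp_all add: mult_four_block_mat[of _ n n _ l _ l _ _ n _ l] mult_four_block_mat[of _ m m _ l _ l _ _ m _ l] idem)
  have PE: "E * P1 = 0\<^sub>m (m + l) (n + l)" "P1 * E' = 0\<^sub>m (n + l) (m + l)"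
    "Q1 * E = 0\<^sub>m (m + l) (n + l)" "E' * Q1 = 0\<^sub>m (n + l) (m + l)"
    unfolding defs using car cr
    by (simp_all add: mult_four_block_mat[of _ m n _ l _ l _ _ n _ l] mult_four_block_mat[of _ n n _ l _ l _ _ m _ l]
        mult_four_block_mat[of _ m m _ l _ l _ _ n _ l] mult_four_block_mat[of _ n m _ l _ l _ _ m _ l] r1)
  have EE: "P1 + E' * E = P" "Q1 + E * E' = Q"
    unfolding defs using car cr
    by (simp_all add: mult_four_block_mat[of _ n m _ l _ l _ _ n _ l] mult_four_block_mat[of _ m n _ l _ l _ _ m _ l]
        add_four_block_mat[of _ n n _ l _ l] add_four_block_mat[of _ m m _ l _ l] r1 r2)
  have wv: "w * v = P1" "v * w = Q1" using v by (simp_all add: w_def)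
  have wv': "w * (v * X) = P1 * X" and P1': "P1 * (P1 * X) = P1 * X"
    and ann: "Q1 * (E * X) = 0\<^sub>m (m + l) (dim_col X)" "E * (P1 * X) = 0\<^sub>m (m + l) (dim_col X)"
    if "dim_row X = n + l" for X
    using that by (simp_all add: mat_assoc[symmetric] wv PP PE)
  have vw': "v * (w * X) = Q1 * X" and Q1': "Q1 * (Q1 * X) = Q1 * X"
    and ann': "P1 * (E' * X) = 0\<^sub>m (n + l) (dim_col X)" "E' * (Q1 * X) = 0\<^sub>m (n + l) (dim_col X)"
    if "dim_row X = m + l" for X
    using that by (simp_all add: mat_assoc[symmetric] wv PP PE)
  have Qv: "Q1 * (v * X) = v * (P1 * X)" if "dim_row X = n + l" for X
    using that vw'[of "v * X"] by (simp add: wv')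
  have Pw: "P1 * (w * X) = w * (Q1 * X)" if "dim_row X = m + l" for X
    using that wv'[of "w * X"] by (simp add: vw')
  have EvP: "E' * (v * P1) = 0\<^sub>m (n + l) (n + l)" "E * (w * Q1) = 0\<^sub>m (m + l) (m + l)"
    using ann'(2)[of "v * P1"] ann(2)[of "w * Q1"] by (simp_all add: Qv Pw PP)
  \<comment> \<open>The compression of \<open>v\<close> to \<open>Q1 * v * P1\<close> makes the cross terms with \<open>E\<close> and \<open>E'\<close> vanish.\<close>
  define a where "a = Q1 * (v * P1) + E"
  define b where "b = P1 * (w * Q1) + E'"
  have [simp]: "dim_row a = m + l" "dim_col a = n + l" "dim_row b = n + l" "dim_col b = m + l"
    by (simp_all add: a_def b_def)
  have add0: "X + 0\<^sub>m i j = X" "0\<^sub>m i j + X = X" if "dim_row X = i" "dim_col X = j" for X :: "'a mat" and i j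
    using that by (auto intro!: eq_matI)
  have "b * a = P1 + E' * E"
    unfolding a_def b_def
    by (simp add: mat_add_mult mat_mult_add mat_assoc Q1' P1' Qv Pw wv' vw' PP PE ann ann' EvP add0)
  then have ba: "b * a = P" by (simp add: EE)
  have "a * b = Q1 + E * E'"
    unfolding a_def b_def
    by (simp add: mat_add_mult mat_mult_add mat_assoc Q1' P1' Qv Pw wv' vw' PP PE ann ann' EvP add0)
  then have ab: "a * b = Q" by (simp add: EE)
  have oE: "mat_over B E" "mat_over B E'" "mat_over B P1" "mat_over B Q1"
    using over by (auto simp: defs mat_over_def zero one uminus diff)
  have oab: "mat_over B a" "mat_over B b"
    unfolding a_def b_def using oE v(2) w(2)
    by (auto intro!: mat_over_add B_mat_over_mult add)
  have oPQ: "mat_over S P" "mat_over S Q"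
    using p q by (auto simp: defs mat_over_def S_0 S_1)
  have "mat_trace \<phi> P = mat_trace \<phi> Q"
    by (rule trace_eq_of_equivalent_idempotents[OF tr _ oPQ(1) PP(3) _ oPQ(2) PP(4) _ oab(1) _ oab(2) ba ab]) auto
  then show ?thesis
    by (simp add: P_def Q_def mat_trace_block_diag[OF car(1)] mat_trace_block_diag[OF car(2)])
qed

end

section \<open>The smooth Flip orbifold\<close>

locale flip_algebra = irrational_rotation_algebra \<theta> U V
  for \<theta> and U V :: "'a::cstar_algebra" +
  fixes \<Phi> :: "'a \<Rightarrow> 'a"
  assumes flip: "is_flip U V \<Phi>"
begin

abbreviation orbifold :: "'a set" where "orbifold \<equiv> flip_orbifold \<Phi>"
abbreviation smooth_orbifold :: "'a set" where "smooth_orbifold \<equiv> smooth_flip_orbifold U V \<Phi>"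

lemma flip_add: "\<Phi> (x + y) = \<Phi> x + \<Phi> y" and flip_mult: "\<Phi> (x * y) = \<Phi> x * \<Phi> y"
  and flip_star: "\<Phi> (star x) = star (\<Phi> x)" and flip_scaleC: "\<Phi> (c *\<^sub>C x) = c *\<^sub>C \<Phi> x"
  and flip_U: "\<Phi> U = star U" and flip_V: "\<Phi> V = star V"
  using flip by (auto simp: is_flip_def star_automorphism_def)

lemma flip_1: "\<Phi> 1 = 1" and norm_flip_le: "norm (\<Phi> x) \<le> norm x"
proof -
  interpret closed_unital_subalgebra "UNIV :: 'a set"
    by unfold_locales (auto simp: star_subalgebra_def)
  have "star_automorphism UNIV \<Phi>" using flip by (simp add: is_flip_def)
  then show "\<Phi> 1 = 1" "norm (\<Phi> x) \<le> norm x"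
    using star_automorphism_one star_automorphism_contractive by auto
qed

lemma bounded_linear_flip: "bounded_linear \<Phi>"
  by (rule bounded_linear_intro[where K = 1])
    (auto simp: flip_add norm_flip_le scaleR_scaleC flip_scaleC)

lemma flip_power: "\<Phi> (x ^ n) = \<Phi> x ^ n"
  by (induction n) (auto simp: flip_1 flip_mult)

lemma flip_diff: "\<Phi> (x - y) = \<Phi> x - \<Phi> y"
  using bounded_linear_flip by (simp add: bounded_linear.linear linear_diff)

lemma flip_weyl: "\<Phi> (weyl z) = weyl (- z)"
proof -
  have pw: "\<Phi> (upow u k) = upow u (- k)" if "\<Phi> u = star u" for u k
    using that by (auto simp: upow_def flip_power flip_star star_star flip_1)
  show ?thesis
    by (cases z) (simp add: weyl_def umonom_def flip_scaleC flip_mult pw flip_U flip_V)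
qed

lemma flip_series: "rapidly_decreasing c \<Longrightarrow> \<Phi> (series c) = series (\<lambda>z. c (- z))"
proof -
  assume c: "rapidly_decreasing c"
  have "\<Phi> (series c) = (\<Sum>\<^sub>\<infinity>z. c z *\<^sub>C weyl (- z))"
    unfolding series_def
    using infsum_bounded_linear[OF bounded_linear_flip series_summable[OF c]]
    by (simp add: flip_scaleC flip_weyl)
  also have "\<dots> = (\<Sum>\<^sub>\<infinity>z. c (- z) *\<^sub>C weyl z)"
    by (rule infsum_reindex_bij_witness[where i = uminus and j = uminus]) auto
  finally show ?thesis by (simp add: series_def)
qed

lemma flip_smooth: "x \<in> smooth \<Longrightarrow> \<Phi> x \<in> smooth"
  and fcoeff_flip: "x \<in> smooth \<Longrightarrow> fcoeff (\<Phi> x) = (\<lambda>z. fcoeff x (- z))"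
proof -
  assume x: "x \<in> smooth"
  have "\<Phi> x = series (\<lambda>z. fcoeff x (- z))"
    using flip_series[OF fcoeff_rapidly_decreasing[OF x]] by (simp add: series_fcoeff x)
  then show "\<Phi> x \<in> smooth" "fcoeff (\<Phi> x) = (\<lambda>z. fcoeff x (- z))"
    using rapidly_decreasing_uminus[OF fcoeff_rapidly_decreasing[OF x]] by (auto simp: series_smooth)
qed

lemma flip_flip: "x \<in> smooth \<Longrightarrow> \<Phi> (\<Phi> x) = x"
  by (rule smooth_eqI) (auto simp: flip_smooth fcoeff_flip)

lemma smooth_orbifold_iff: "x \<in> smooth_orbifold \<longleftrightarrow> x \<in> smooth \<and> \<Phi> x = x"
  by (auto simp: smooth_flip_orbifold_def flip_orbifold_def)

lemma smooth_orbifold_smooth: "x \<in> smooth_orbifold \<Longrightarrow> x \<in> smooth"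
  and smooth_orbifold_orbifold: "x \<in> smooth_orbifold \<Longrightarrow> x \<in> orbifold"
  by (auto simp: smooth_flip_orbifold_def)

lemma fcoeff_orbifold: "x \<in> smooth_orbifold \<Longrightarrow> fcoeff x (- z) = fcoeff x z"
  using fcoeff_flip[of x] by (metis smooth_orbifold_iff)

lemma orbifold_subalgebra: "closed_unital_subalgebra orbifold"
proof
  show "star_subalgebra orbifold"
    using linear_0[OF bounded_linear.linear[OF bounded_linear_flip]]
    by (auto simp: star_subalgebra_def flip_orbifold_def flip_add flip_mult flip_star flip_scaleC)
  have "continuous_on UNIV \<Phi>"
    using linear_continuous_on[OF bounded_linear_flip] by simp
  then show "closed orbifold"
    unfolding flip_orbifold_def by (intro closed_Collect_eq) auto
  show "1 \<in> orbifold" by (simp add: flip_orbifold_def flip_1)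
qed

text \<open>Averages of smooth approximations over the flip.\<close>

lemma smooth_orbifold_dense:
  assumes "x \<in> orbifold"
  shows "\<exists>a. (\<forall>n::nat. a n \<in> smooth_orbifold) \<and> a \<longlonglongrightarrow> x"
proof -
  have "x \<in> closure smooth" using smooth_dense by simp
  then obtain a where a: "\<forall>n. a n \<in> smooth" "a \<longlonglongrightarrow> x" unfolding closure_sequential by blast
  let ?b = "\<lambda>n. (1 / 2) *\<^sub>C (a n + \<Phi> (a n))"
  have "?b \<longlonglongrightarrow> (1 / 2) *\<^sub>C (x + \<Phi> x)"
    by (intro bounded_linear.tendsto[OF bounded_linear_scaleC_right]
        bounded_linear.tendsto[OF bounded_linear_flip] tendsto_add a)
  also have "(1 / 2) *\<^sub>C (x + \<Phi> x) = x"
    using assms by (simp add: flip_orbifold_def scaleC_2[symmetric] scaleC_scaleC)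
  finally have "?b \<longlonglongrightarrow> x" .
  moreover have "?b n \<in> smooth_orbifold" for n
    using a by (simp add: smooth_orbifold_iff smooth_scaleC smooth_add flip_smooth flip_scaleC
        flip_add flip_flip add.commute)
  ultimately show ?thesis by (intro exI[of _ ?b]) blast
qed

text \<open>The Neumann series of \<open>Y\<close> converges entrywise for all Schwartz norms: for a suitable \<open>t\<close> the sum of
  the jet norms of the entries is still less than \<open>1\<close>.\<close>

lemma smooth_orbifold_neumann:
  assumes Y: "Y \<in> carrier_mat n n" "mat_over smooth_orbifold Y" and small: "entry_sum norm Y < 1"
  shows "\<exists>Z\<in>carrier_mat n n. mat_over smooth_orbifold Z \<and>
    Z * (1\<^sub>m n - Y) = 1\<^sub>m n \<and> (1\<^sub>m n - Y) * Z = 1\<^sub>m n"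
proof -
  interpret closed_unital_subalgebra orbifold by (rule orbifold_subalgebra)
  have [simp]: "dim_row Y = n" "dim_col Y = n" using Y by auto
  have Ysm: "mat_over smooth Y" using Y(2) by (auto simp: mat_over_def smooth_orbifold_iff)
  define X where "X k i j = (Y ^\<^sub>m k) $$ (i, j)" for k i j
  have X0: "X 0 i j = (if i = j then 1 else 0)" if "i < n" "j < n" for i j
    using that by (simp add: X_def)
  have Xr: "X (Suc k) i j = (\<Sum>l<n. X k i l * Y $$ (l, j))" if "i < n" "j < n" for k i j
    using that by (simp add: X_def mat_mult_entry del: index_mult_mat(1))
  have Xl: "X (Suc k) i j = (\<Sum>l<n. Y $$ (i, l) * X k l j)" if "i < n" "j < n" for k i j
  proof -
    have "Y ^\<^sub>m k * Y = Y * Y ^\<^sub>m k"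
      using Y by (induction k) (simp_all add: mat_assoc)
    then show ?thesis using that by (simp add: X_def mat_mult_entry del: index_mult_mat(1))
  qed
  have XB: "X k i j \<in> orbifold" and Xs: "X k i j \<in> smooth" if "i < n" "j < n" for k i j
  proof -
    have "X k i j \<in> orbifold \<and> X k i j \<in> smooth"
      using that
    proof (induction k arbitrary: i j)
      case 0
      then show ?case by (simp add: X0 zero one smooth_0 smooth_1)
    next
      case (Suc k)
      have "Y $$ (l, j) \<in> orbifold \<and> Y $$ (l, j) \<in> smooth" if "l < n" for l
        using Y(2) Suc.prems that by (auto simp: mat_over_def smooth_flip_orbifold_def)
      then show ?case using Suc by (auto simp: Xr intro!: sum mult smooth_sum smooth_mult)
    qed
    then show "X k i j \<in> orbifold" "X k i j \<in> smooth" by auto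
  qed
  have jet: "\<exists>t>0. \<exists>C \<rho>. 0 \<le> \<rho> \<and> \<rho> < 1 \<and> (\<forall>k. jet_norm l J t (X k i j) \<le> C * \<rho> ^ k)"
    if l: "l \<in> {fst, snd}" and ij: "i < n" "j < n" for l J i j
  proof -
    have "(\<Sum>(i, j)\<in>{..<n} \<times> {..<n}. norm (Y $$ (i, j))) < 1"
      using small by (simp add: entry_sum_def sum.cartesian_product)
    then obtain t where t: "t > 0" "(\<Sum>p\<in>{..<n} \<times> {..<n}. jet_norm l J t (Y $$ p)) < 1"
      using ex_jet_norm_less_1[of "{..<n} \<times> {..<n}" "\<lambda>p. Y $$ p" l J] Ysm
      by (auto simp: mat_over_def case_prod_unfold)
    let ?f = "jet_norm l J t"
    have \<rho>: "entry_sum ?f Y < 1"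
      using t(2) by (simp add: entry_sum_def sum.cartesian_product case_prod_unfold)
    have f0: "0 \<le> ?f x" for x using t by (intro jet_norm_nonneg) simp
    have e0: "0 \<le> entry_sum ?f A" for A unfolding entry_sum_def by (intro sum_nonneg f0)
    have pw: "entry_sum ?f (Y ^\<^sub>m k) \<le> real n * entry_sum ?f Y ^ k" for k
    proof (induction k)
      case 0
      have "entry_sum ?f (1\<^sub>m n) = (\<Sum>i<n. \<Sum>j<n. if i = j then 1 else 0)"
        unfolding entry_sum_def by (intro sum.cong) (auto simp: jet_norm_1[OF l] jet_norm_0[OF l])
      then show ?case by simp
    next
      case (Suc k)
      have "entry_sum ?f (Y ^\<^sub>m k * Y) \<le> entry_sum ?f (Y ^\<^sub>m k) * entry_sum ?f Y"
      proof (rule entry_sum_mult_le[where S = smooth])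
        show "mat_over smooth (Y ^\<^sub>m k)"
          unfolding mat_over_def pow_mat_dim_square[OF Y(1)] X_def[symmetric] using Xs by blast
        show "?f (x * y) \<le> ?f x * ?f y" if "x \<in> smooth" "y \<in> smooth" for x y
          using t that by (intro jet_norm_mult l) auto
        show "?f (\<Sum>i\<in>I. g i) \<le> (\<Sum>i\<in>I. ?f (g i))" if "\<And>i. i \<in> I \<Longrightarrow> g i \<in> smooth"
          for g :: "nat \<Rightarrow> 'a" and I
          using t that by (intro jet_norm_sum l) auto
      qed (auto simp: Ysm f0 smooth_mult)
      also have "\<dots> \<le> real n * entry_sum ?f Y ^ k * entry_sum ?f Y"
        using Suc e0 by (intro mult_right_mono)
      finally show ?case by (simp add: mult_ac)
    qed
    have "?f (X k i j) \<le> entry_sum ?f (Y ^\<^sub>m k)" for k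
    proof -
      have "?f (X k i j) \<le> (\<Sum>j<n. ?f (X k i j))"
        using ij f0 by (intro member_le_sum[where f = "\<lambda>j. ?f (X k i j)"]) auto
      also have "\<dots> \<le> (\<Sum>i<n. \<Sum>j<n. ?f (X k i j))"
        using ij f0 by (intro member_le_sum[where f = "\<lambda>i. \<Sum>j<n. ?f (X k i j)"]) (auto intro: sum_nonneg)
      finally show ?thesis unfolding entry_sum_def pow_mat_dim_square[OF Y(1)] X_def .
    qed
    then have "?f (X k i j) \<le> real n * entry_sum ?f Y ^ k" for k
      using pw order_trans by blast
    then show ?thesis using t(1) e0 \<rho> by blast
  qed
  define Z where "Z = mat n n (\<lambda>(i, j). \<Sum>k. X k i j)"
  have XZ: "(\<lambda>k. X k i j) sums (Z $$ (i, j))" and Zs: "Z $$ (i, j) \<in> smooth" if "i < n" "j < n" for i j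
    using smooth_suminf(1,2)[of "\<lambda>k. X k i j", OF Xs[OF that] summable_frechet[OF Xs[OF that] jet[OF _ that]]]
      that by (auto simp: Z_def)
  have Z: "Z \<in> carrier_mat n n" "mat_over smooth_orbifold Z"
  proof -
    have "Z $$ (i, j) \<in> orbifold" if "i < n" "j < n" for i j
      using that suminf[of "\<lambda>k. X k i j", OF XB[OF that]] XZ[OF that] by (auto simp: Z_def sums_iff)
    then show "mat_over smooth_orbifold Z"
      using Zs by (auto simp: mat_over_def Z_def smooth_flip_orbifold_def)
  qed (simp add: Z_def)
  have [simp]: "dim_row Z = n" "dim_col Z = n" using Z by auto
  have tail: "(\<lambda>k. X (Suc k) i j) sums (Z $$ (i, j) - (if i = j then 1 else 0))" if "i < n" "j < n" for i j
    using XZ[OF that] X0[OF that] by (subst sums_Suc_iff[of "\<lambda>k. X k i j"]) simp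
  have r: "Z * Y = Z - 1\<^sub>m n"
  proof (rule eq_matI)
    fix i j assume "i < dim_row (Z - 1\<^sub>m n)" "j < dim_col (Z - 1\<^sub>m n)"
    then have ij: "i < n" "j < n" by auto
    have "(\<lambda>k. \<Sum>l<n. X k i l * Y $$ (l, j)) sums (\<Sum>l<n. Z $$ (i, l) * Y $$ (l, j))"
      using ij by (intro sums_sum sums_mult2 XZ) auto
    then show "(Z * Y) $$ (i, j) = (Z - 1\<^sub>m n) $$ (i, j)"
      using ij tail[OF ij] Xr[OF ij] by (simp add: mat_mult_entry sums_unique2 del: index_mult_mat(1))
  qed auto
  have l: "Y * Z = Z - 1\<^sub>m n"
  proof (rule eq_matI)
    fix i j assume "i < dim_row (Z - 1\<^sub>m n)" "j < dim_col (Z - 1\<^sub>m n)"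
    then have ij: "i < n" "j < n" by auto
    have "(\<lambda>k. \<Sum>l<n. Y $$ (i, l) * X k l j) sums (\<Sum>l<n. Y $$ (i, l) * Z $$ (l, j))"
      using ij by (intro sums_sum sums_mult XZ) auto
    then show "(Y * Z) $$ (i, j) = (Z - 1\<^sub>m n) $$ (i, j)"
      using ij tail[OF ij] Xl[OF ij] by (simp add: mat_mult_entry sums_unique2 del: index_mult_mat(1))
  qed auto
  have diff: "Z - (Z - 1\<^sub>m n) = 1\<^sub>m n" by (intro eq_matI) auto
  have "Z * (1\<^sub>m n - Y) = 1\<^sub>m n" "(1\<^sub>m n - Y) * Z = 1\<^sub>m n"
    by (simp_all add: mat_mult_diff mat_diff_mult r l diff)
  then show ?thesis using Z by blast
qed

sublocale orb: dense_spectral_subalgebra orbifold smooth_orbifold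
proof (intro dense_spectral_subalgebra.intro dense_spectral_subalgebra_axioms.intro orbifold_subalgebra)
  show "smooth_orbifold \<subseteq> orbifold" by (auto simp: smooth_flip_orbifold_def)
  have "\<Phi> 0 = 0" by (rule linear_0[OF bounded_linear.linear[OF bounded_linear_flip]])
  then show "0 \<in> smooth_orbifold" by (simp add: smooth_orbifold_iff smooth_0)
  show "1 \<in> smooth_orbifold" by (simp add: smooth_orbifold_iff smooth_1 flip_1)
  show "- x \<in> smooth_orbifold" if "x \<in> smooth_orbifold" for x
    using that linear_neg[OF bounded_linear.linear[OF bounded_linear_flip]]
    by (simp add: smooth_orbifold_iff smooth_uminus)
  show "\<exists>a. (\<forall>n::nat. a n \<in> smooth_orbifold) \<and> a \<longlonglongrightarrow> x" if "x \<in> orbifold" for x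
    using that by (rule smooth_orbifold_dense)
  show "\<exists>Z\<in>carrier_mat n n. mat_over smooth_orbifold Z \<and> Z * (1\<^sub>m n - Y) = 1\<^sub>m n \<and> (1\<^sub>m n - Y) * Z = 1\<^sub>m n"
    if "Y \<in> carrier_mat n n" "mat_over smooth_orbifold Y" "entry_sum norm Y < 1" for Y n
    using that by (rule smooth_orbifold_neumann)
qed (auto simp: smooth_orbifold_iff smooth_add smooth_mult flip_add flip_mult)

lemma smooth_orbifold_scaleC: "x \<in> smooth_orbifold \<Longrightarrow> c *\<^sub>C x \<in> smooth_orbifold"
  by (simp add: smooth_orbifold_iff smooth_scaleC flip_scaleC)

end

section \<open>Smooth automorphisms are continuous for the Frechet topology\<close>

locale flip_orbifold_automorphism = flip_algebra \<theta> U V \<Phi>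
  for \<theta> and U V :: "'a::cstar_algebra" and \<Phi> +
  fixes \<beta> :: "'a \<Rightarrow> 'a"
  assumes automorphism: "smooth_automorphism U V \<Phi> \<beta>"
begin

lemma auto_star_automorphism: "star_automorphism orbifold \<beta>"
  using automorphism by (simp add: smooth_automorphism_def)

lemma auto_smooth: "x \<in> smooth_orbifold \<Longrightarrow> \<beta> x \<in> smooth_orbifold"
  using automorphism by (auto simp: smooth_automorphism_def)

lemma auto_orbifold: "x \<in> orbifold \<Longrightarrow> \<beta> x \<in> orbifold"
  using auto_star_automorphism by (auto simp: star_automorphism_def bij_betw_def)

lemma auto_add: "x \<in> orbifold \<Longrightarrow> y \<in> orbifold \<Longrightarrow> \<beta> (x + y) = \<beta> x + \<beta> y"
  and auto_mult: "x \<in> orbifold \<Longrightarrow> y \<in> orbifold \<Longrightarrow> \<beta> (x * y) = \<beta> x * \<beta> y"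
  and auto_star: "x \<in> orbifold \<Longrightarrow> \<beta> (star x) = star (\<beta> x)"
  and auto_scaleC: "x \<in> orbifold \<Longrightarrow> \<beta> (c *\<^sub>C x) = c *\<^sub>C \<beta> x"
  using auto_star_automorphism by (auto simp: star_automorphism_def)

lemma auto_0: "\<beta> 0 = 0"
  using auto_scaleC[OF orb.zero, of 0] by simp

lemma auto_1: "\<beta> 1 = 1"
  by (rule orb.star_automorphism_one[OF auto_star_automorphism])

lemma auto_diff: "x \<in> orbifold \<Longrightarrow> y \<in> orbifold \<Longrightarrow> \<beta> (x - y) = \<beta> x - \<beta> y"
  using auto_add[of "x - y" y] orb.diff[of x y] by (simp add: eq_diff_eq)

lemma auto_sum: "(\<And>i. i \<in> I \<Longrightarrow> f i \<in> orbifold) \<Longrightarrow> \<beta> (\<Sum>i\<in>I. f i) = (\<Sum>i\<in>I. \<beta> (f i))"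
proof (induction I rule: infinite_finite_induct)
  case (insert i I)
  then show ?case using orb.sum[of I f] by (simp add: auto_add)
qed (auto simp: auto_0)

lemma norm_auto_le: "x \<in> orbifold \<Longrightarrow> norm (\<beta> x) \<le> norm x"
  by (rule orb.star_automorphism_contractive[OF auto_star_automorphism])

text \<open>Rescaling a violation of continuity gives an element that is as small, and has as large a hump at
  some lattice point, as desired.\<close>

lemma unbounded_step:
  assumes unb: "\<And>K C. \<exists>x\<in>smooth_orbifold. C * frechet K x < frechet k (\<beta> x)"
    and e: "e > 0"
  shows "\<exists>x\<in>smooth_orbifold. frechet n x \<le> e \<and> (\<exists>z. R < weight z ^ k * cmod (fcoeff (\<beta> x) z))"
proof -
  define C where "C = (\<bar>R\<bar> + 1) / e"
  obtain x where x: "x \<in> smooth_orbifold" "C * frechet n x < frechet k (\<beta> x)"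
    using unb by blast
  note xs = smooth_orbifold_smooth[OF x(1)]
  define f where "f = frechet n x"
  have "f \<noteq> 0"
  proof
    assume "f = 0"
    have "fcoeff x z = fcoeff 0 z" for z
    proof -
      have "weight z ^ n * cmod (fcoeff x z) \<le> 0"
        using frechet_bound[OF xs, of z n] \<open>f = 0\<close> by (simp add: f_def)
      moreover have "0 < weight z ^ n" by simp
      ultimately show ?thesis by (simp add: mult_le_0_iff fcoeff_0 not_le)
    qed
    then have "x = 0" by (rule smooth_eqI[OF xs smooth_0])
    moreover have "frechet k 0 \<le> 0" by (rule schwartz_norm_le) (simp add: fcoeff_0)
    ultimately show False using x(2) \<open>f = 0\<close> by (simp add: auto_0 f_def)
  qed
  then have f: "f > 0" using frechet_nonneg[OF xs, of n] by (simp add: f_def)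
  obtain z where z: "C * f < weight z ^ k * cmod (fcoeff (\<beta> x) z)"
    using x(2) schwartz_norm_le[of k "fcoeff (\<beta> x)" "C * f"] unfolding f_def by (meson not_le)
  let ?x = "complex_of_real (e / f) *\<^sub>C x"
  have "frechet n ?x \<le> cmod (complex_of_real (e / f)) * f"
    unfolding f_def fcoeff_scaleC[OF xs] by (rule schwartz_norm_cmult_le[OF fcoeff_rapidly_decreasing[OF xs]])
  also have "\<dots> = e" using e f by (simp add: norm_divide)
  finally have "frechet n ?x \<le> e" .
  moreover have "R < weight z ^ k * cmod (fcoeff (\<beta> ?x) z)"
  proof -
    have "e / f * (C * f) = \<bar>R\<bar> + 1" using e f by (simp add: C_def)
    moreover have "e / f * (C * f) < e / f * (weight z ^ k * cmod (fcoeff (\<beta> x) z))"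
      using z e f by (intro mult_strict_left_mono) auto
    moreover have "fcoeff (\<beta> ?x) z = complex_of_real (e / f) * fcoeff (\<beta> x) z"
      using smooth_orbifold_smooth[OF auto_smooth[OF x(1)]]
      by (simp add: auto_scaleC smooth_orbifold_orbifold x fcoeff_scaleC)
    ultimately show ?thesis using e f by (simp add: norm_mult norm_divide mult_ac)
  qed
  ultimately show ?thesis using smooth_orbifold_scaleC[OF x(1)] by blast
qed

text \<open>Each Fourier coefficient of \<open>\<beta> x\<close> is bounded by \<open>norm x\<close>, so \<open>frechet k (\<beta> x)\<close> is a pointwise
  finite supremum of continuous seminorms. The principle of uniform boundedness is proved here by a
  gliding hump: an unbounded seminorm would be infinite at a suitable sum of elements that shrink
  fast. The choice between \<open>s + x\<close> and \<open>s - x\<close> keeps each new hump from being cancelled by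
  the preceding ones.\<close>

theorem auto_frechet_continuous:
  "\<exists>K C. \<forall>x\<in>smooth_orbifold. frechet k (\<beta> x) \<le> C * frechet K x"
proof (rule ccontr)
  assume "\<not> ?thesis"
  then have unb: "\<exists>x\<in>smooth_orbifold. C * frechet K x < frechet k (\<beta> x)" for K C
    by (meson not_le)
  define e0 where "e0 = 1 / (1 + weight_sum)"
  have e0: "0 < e0" using weight_sum_nonneg by (simp add: e0_def)
  let ?h = "\<lambda>x z. weight z ^ k * cmod (fcoeff (\<beta> x) z)"
  let ?P = "\<lambda>n (p :: 'a \<times> real). fst p \<in> smooth_orbifold \<and> 0 < snd p \<and> (n = 0 \<longrightarrow> p = (0, e0))"
  let ?Q = "\<lambda>n (p :: 'a \<times> real) p'. \<exists>z. frechet (n + 4) (fst p' - fst p) \<le> snd p \<and>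
      real n + 1 < ?h (fst p') z \<and> snd p' = snd p / (2 * weight z ^ k)"
  have step: "\<exists>p'. ?P (Suc n) p' \<and> ?Q n p p'" if p: "?P n p" for n p
  proof -
    obtain s e where [simp]: "p = (s, e)" by (cases p)
    have s: "s \<in> smooth_orbifold" and e: "e > 0" using p by auto
    obtain x z where x: "x \<in> smooth_orbifold" "frechet (n + 4) x \<le> e" and z: "real n + 1 < ?h x z"
      using unbounded_step[OF unb e] by blast
    note bs = smooth_orbifold_smooth[OF auto_smooth[OF s]] and bx = smooth_orbifold_smooth[OF auto_smooth[OF x(1)]]
    have sx: "s + x \<in> smooth_orbifold" "s - x \<in> smooth_orbifold" using s x by (auto intro: orb.S_add orb.S_diff)
    have "2 * cmod (fcoeff (\<beta> x) z) \<le> cmod (fcoeff (\<beta> (s + x)) z) + cmod (fcoeff (\<beta> (s - x)) z)"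
    proof -
      have "fcoeff (\<beta> (s + x)) z - fcoeff (\<beta> (s - x)) z = 2 * fcoeff (\<beta> x) z"
        using s x bs bx by (simp add: auto_add auto_diff smooth_orbifold_orbifold fcoeff_add fcoeff_diff)
      then show ?thesis
        using norm_triangle_ineq4[of "fcoeff (\<beta> (s + x)) z" "fcoeff (\<beta> (s - x)) z"]
        by (simp add: norm_mult)
    qed
    then have "weight z ^ k * (2 * cmod (fcoeff (\<beta> x) z))
        \<le> weight z ^ k * (cmod (fcoeff (\<beta> (s + x)) z) + cmod (fcoeff (\<beta> (s - x)) z))"
      by (intro mult_left_mono) auto
    then have "2 * ?h x z \<le> ?h (s + x) z + ?h (s - x) z"
      by (simp add: distrib_left mult_ac)
    then have "real n + 1 < ?h (s + x) z \<or> real n + 1 < ?h (s - x) z" using z by linarith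
    \<comment> \<open>By the triangle inequality one of the two signs keeps the hump.\<close>
    then obtain s' where s': "s' \<in> {s + x, s - x}" "real n + 1 < ?h s' z" by blast
    have "frechet (n + 4) (s' - s) \<le> e"
    proof (cases "s' = s + x")
      case False
      then have "s' - s = - 1 *\<^sub>C x" using s'(1) by (auto simp: scaleC_minus_left)
      then show ?thesis
        using schwartz_norm_cmult_le[OF fcoeff_rapidly_decreasing[OF smooth_orbifold_smooth[OF x(1)]], of "n + 4" "-1"]
          fcoeff_scaleC[OF smooth_orbifold_smooth[OF x(1)], of "-1"] x(2) by simp
    qed (use x in simp)
    moreover have "s' \<in> smooth_orbifold" using s' sx by auto
    ultimately show ?thesis using s'(2) e
      by (intro exI[of _ "(s', e / (2 * weight z ^ k))"] conjI exI[of _ z]) simp_all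
  qed
  obtain f where f: "\<And>n. ?P n (f n)" "\<And>n. ?Q n (f n) (f (Suc n))"
    using dependent_nat_choice[of ?P ?Q, OF _ step] e0 orb.S_0 by (metis fst_conv snd_conv)
  define s e where "s n = fst (f n)" and "e n = snd (f n)" for n
  define y where "y n = s (Suc n) - s n" for n
  obtain w where w: "\<And>n. frechet (n + 4) (y n) \<le> e n" "\<And>n. real n + 1 < ?h (s (Suc n)) (w n)"
    "\<And>n. e (Suc n) = e n / (2 * weight (w n) ^ k)"
    using f(2) unfolding s_def e_def y_def by metis
  have s: "s n \<in> smooth_orbifold" and e: "e n > 0" and s0: "s 0 = 0" "e 0 = e0" for n
    using f(1)[of n] f(1)[of 0] by (auto simp: s_def e_def)
  have y: "y n \<in> smooth_orbifold" for n unfolding y_def by (intro orb.S_diff s)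
  note ys = smooth_orbifold_smooth[OF y]
  have sy: "s n = (\<Sum>i<n. y i)" for n
    by (simp add: y_def sum_lessThan_telescope s0)
  have w1: "1 \<le> weight (w n) ^ k" for n by (intro one_le_power weight_ge_1)
  have half: "e (Suc n) \<le> e n / 2" for n
    unfolding w(3) using e[of n] w1[of n] by (intro divide_left_mono) auto
  \<comment> \<open>The later terms together change the hump at \<open>w n\<close> by at most \<open>1\<close>; this is what the factor
    \<open>weight (w n) ^ k\<close> in the recursion for \<open>e\<close> is for.\<close>
  have decay: "e (Suc n + i) \<le> e (Suc n) * (1 / 2) ^ i" for n i
  proof (induction i)
    case (Suc i)
    then show ?case using half[of "Suc n + i"] by simp
  qed simp
  have decay0: "e n \<le> e0 * (1 / 2) ^ n" for n
  proof (induction n)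
    case (Suc n)
    then show ?case using half[of n] by simp
  qed (simp add: s0)
  have sf: "summable (\<lambda>n. frechet j (y n))" for j
  proof (rule summable_comparison_test')
    show "summable (\<lambda>n. e0 * (1 / 2) ^ n)" by (intro summable_mult) simp
    show "norm (frechet j (y n)) \<le> e0 * (1 / 2) ^ n" if "n \<ge> j" for n
      using frechet_mono[OF ys, of j "n + 4" n] that w(1)[of n] decay0[of n] frechet_nonneg[OF ys, of j n]
      by simp
  qed
  define x where "x = suminf y"
  have ysum: "y sums x" and xs: "x \<in> smooth"
    using smooth_suminf(1,2)[of y, OF ys sf] by (auto simp: x_def)
  have "x \<in> orbifold" unfolding x_def
    by (rule orb.suminf) (auto intro: smooth_orbifold_orbifold y sums_summable[OF ysum])
  with xs have x: "x \<in> smooth_orbifold" by (simp add: smooth_flip_orbifold_def)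
  have "real n \<le> frechet k (\<beta> x)" for n
  proof -
    let ?W = "weight (w n) ^ k"
    have ny: "norm (y (i + Suc n)) \<le> e (Suc n) * weight_sum * (1 / 2) ^ i" for i
    proof -
      have "norm (y (i + Suc n)) \<le> weight_sum * frechet 4 (y (i + Suc n))" by (rule norm_le_frechet[OF ys])
      also have "\<dots> \<le> weight_sum * (e (Suc n) * (1 / 2) ^ i)"
        using frechet_mono[OF ys, of 4 "i + Suc n + 4" "i + Suc n"] w(1)[of "i + Suc n"] decay[of n i]
        by (intro mult_left_mono weight_sum_nonneg) (simp add: add_ac)
      finally show ?thesis by (simp add: mult_ac)
    qed
    have geo: "(\<lambda>i. e (Suc n) * weight_sum * (1 / 2) ^ i) sums (e (Suc n) * weight_sum * 2)"
      using sums_mult[OF geometric_sums[of "1 / 2 :: real"], of "e (Suc n) * weight_sum"] by simp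
    have "x - s (Suc n) = (\<Sum>i. y (i + Suc n))"
      using suminf_minus_initial_segment[OF sums_summable[OF ysum], of "Suc n"] by (simp add: sy x_def)
    also have "norm \<dots> \<le> (\<Sum>i. e (Suc n) * weight_sum * (1 / 2) ^ i)"
      by (rule summable_norm[THEN order_trans, OF _ suminf_le])
        (use ny geo in \<open>auto intro: summable_comparison_test' sums_summable\<close>)
    also have "\<dots> = e n * weight_sum / ?W" using geo w1[of n] by (simp add: sums_iff w(3))
    finally have nx: "norm (x - s (Suc n)) \<le> e n * weight_sum / ?W" .
    have "e0 * (1 / 2) ^ n \<le> e0 * 1" using e0 by (intro mult_left_mono power_le_one) auto
    then have "e n \<le> e0" using decay0[of n] by simp
    then have "e n * weight_sum \<le> e0 * weight_sum" by (intro mult_right_mono weight_sum_nonneg)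
    also have "\<dots> \<le> 1" using weight_sum_nonneg by (simp add: e0_def)
    finally have e1: "e n * weight_sum \<le> 1" .
    have d: "x - s (Suc n) \<in> smooth_orbifold" by (intro orb.S_diff x s)
    have "cmod (fcoeff (\<beta> (x - s (Suc n))) (w n)) \<le> norm (\<beta> (x - s (Suc n)))"
      by (intro cmod_fcoeff_le smooth_orbifold_smooth auto_smooth d)
    also have "\<dots> \<le> norm (x - s (Suc n))" by (intro norm_auto_le smooth_orbifold_orbifold d)
    also have "\<dots> \<le> 1 / ?W" using nx e1 w1[of n] by (meson divide_right_mono order_trans zero_le_one)
    finally have small: "?h (x - s (Suc n)) (w n) \<le> 1" using w1[of n] by (simp add: pos_le_divide_eq mult.commute)
    have "fcoeff (\<beta> (x - s (Suc n))) (w n) = fcoeff (\<beta> x) (w n) - fcoeff (\<beta> (s (Suc n))) (w n)"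
      using x s[of "Suc n"]
      by (simp add: auto_diff smooth_orbifold_orbifold fcoeff_diff smooth_orbifold_smooth auto_smooth)
    then have "cmod (fcoeff (\<beta> (s (Suc n))) (w n))
        \<le> cmod (fcoeff (\<beta> x) (w n)) + cmod (fcoeff (\<beta> (x - s (Suc n))) (w n))"
      using norm_triangle_ineq4[of "fcoeff (\<beta> x) (w n)" "fcoeff (\<beta> (x - s (Suc n))) (w n)"] by simp
    then have "?W * cmod (fcoeff (\<beta> (s (Suc n))) (w n))
        \<le> ?W * (cmod (fcoeff (\<beta> x) (w n)) + cmod (fcoeff (\<beta> (x - s (Suc n))) (w n)))"
      by (intro mult_left_mono) auto
    then have "?h (s (Suc n)) (w n) \<le> ?h x (w n) + ?h (x - s (Suc n)) (w n)"
      by (simp add: distrib_left)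
    then show ?thesis
      using w(2)[of n] small frechet_bound[OF smooth_orbifold_smooth[OF auto_smooth[OF x]], of "w n" k] by simp
  qed
  then show False using reals_Archimedean2[of "frechet k (\<beta> x)"] by (meson not_le)
qed

end

section \<open>Continuous traces on the smooth Flip orbifold\<close>

context flip_algebra
begin

text \<open>The flip-invariant elements that span the Laurent polynomials in the orbifold.\<close>

definition sym_weyl :: "int \<times> int \<Rightarrow> 'a" where
  "sym_weyl z = weyl z + weyl (- z)"

lemma sym_orbifold: "sym_weyl z \<in> smooth_orbifold"
  by (simp add: sym_weyl_def smooth_orbifold_iff smooth_add smooth_weyl flip_add flip_weyl add.commute)

lemma sym_weyl_0: "sym_weyl 0 = 2 *\<^sub>C 1"
  by (simp add: sym_weyl_def scaleC_2)

lemma fcoeff_sym_weyl: "fcoeff (sym_weyl w) z = (if z = w then 1 else 0) + (if z = - w then 1 else 0)"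
  by (simp add: sym_weyl_def fcoeff_add smooth_weyl fcoeff_weyl)

text \<open>Truncations of the Fourier series converge in the Frechet topology; a truncation to a symmetric
  set is a combination of the \<open>sym_weyl z\<close>.\<close>

lemma vanishes_of_vanishes_on_sym:
  assumes add: "\<And>x y. x \<in> smooth_orbifold \<Longrightarrow> y \<in> smooth_orbifold \<Longrightarrow> L (x + y) = L x + L y"
    and scale: "\<And>x c. x \<in> smooth_orbifold \<Longrightarrow> L (c *\<^sub>C x) = c * L x"
    and bound: "\<And>x. x \<in> smooth_orbifold \<Longrightarrow> cmod (L x) \<le> C * frechet k x"
    and sym_weyl: "\<And>z. L (sym_weyl z) = 0"
    and x: "x \<in> smooth_orbifold"
  shows "L x = 0"
proof -
  note xs = smooth_orbifold_smooth[OF x]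
  define F where "F N = {z. weight z \<le> real N}" for N
  have finF: "finite (F N)" for N
  proof (rule finite_subset)
    show "F N \<subseteq> {- int N..int N} \<times> {- int N..int N}"
      by (auto simp: F_def weight_def)
  qed auto
  define X where "X N = (\<Sum>z\<in>F N. (fcoeff x z / 2) *\<^sub>C sym_weyl z)" for N
  have XO: "X N \<in> smooth_orbifold" for N
    unfolding X_def by (intro orb.S_sum smooth_orbifold_scaleC sym_orbifold)
  have L0: "L (\<Sum>z\<in>I. (fcoeff x z / 2) *\<^sub>C sym_weyl z) = 0" for I
  proof (induction I rule: infinite_finite_induct)
    case (insert z I)
    then show ?case
      by (simp add: add scale sym_weyl sym_orbifold smooth_orbifold_scaleC orb.S_sum)
  qed (use scale[OF orb.S_0, of 0] in auto)
  have fX: "fcoeff (X N) y = (if y \<in> F N then fcoeff x y else 0)" for N y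
  proof -
    have "fcoeff (X N) y = (\<Sum>z\<in>F N. fcoeff x z / 2 * ((if y = z then 1 else 0) + (if y = - z then 1 else 0)))"
      unfolding X_def
      by (simp add: fcoeff_sum fcoeff_scaleC smooth_scaleC smooth_orbifold_smooth[OF sym_orbifold] fcoeff_sym_weyl)
    also have "\<dots> = (\<Sum>z\<in>F N. if z = y then fcoeff x z / 2 else 0)
        + (\<Sum>z\<in>F N. if z = - y then fcoeff x z / 2 else 0)"
      unfolding sum.distrib[symmetric]
    proof (intro sum.cong refl)
      fix z
      have "y = - z \<longleftrightarrow> z = - y" by (metis minus_minus)
      then show "fcoeff x z / 2 * ((if y = z then 1 else 0) + (if y = - z then 1 else 0))
          = (if z = y then fcoeff x z / 2 else 0) + (if z = - y then fcoeff x z / 2 else 0)"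
        by (simp add: distrib_left eq_commute[of y z])
    qed
    also have "\<dots> = (if y \<in> F N then fcoeff x y else 0)"
      using finF[of N] by (simp add: sum.delta fcoeff_orbifold[OF x] F_def)
    finally show ?thesis .
  qed
  have le: "cmod (L x) \<le> \<bar>C\<bar> * frechet (k + 1) x * (1 / real N)" if N: "N > 0" for N
  proof -
    have d: "x - X N \<in> smooth_orbifold" by (intro orb.S_diff x XO)
    have "L x = L (x - X N) + L (X N)" using add[OF d XO[of N]] by simp
    then have "cmod (L x) \<le> C * frechet k (x - X N)"
      using bound[OF d] L0[of "F N"] by (simp add: X_def)
    also have "\<dots> \<le> \<bar>C\<bar> * frechet k (x - X N)"
      by (intro mult_right_mono frechet_nonneg smooth_orbifold_smooth d) auto
    also have "frechet k (x - X N) \<le> frechet (k + 1) x * (1 / real N)"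
    proof (rule schwartz_norm_le)
      fix z
      have fz: "fcoeff (x - X N) z = (if z \<in> F N then 0 else fcoeff x z)"
        by (simp add: fcoeff_diff xs smooth_orbifold_smooth[OF XO] fX)
      show "weight z ^ k * cmod (fcoeff (x - X N) z) \<le> frechet (k + 1) x * (1 / real N)"
      proof (cases "z \<in> F N")
        case True
        then show ?thesis using fz frechet_nonneg[OF xs, of "k + 1"] by simp
      next
        case False
        have "real N * (weight z ^ k * cmod (fcoeff x z)) \<le> weight z * (weight z ^ k * cmod (fcoeff x z))"
          using False by (intro mult_right_mono) (auto simp: F_def)
        also have "\<dots> \<le> frechet (k + 1) x" using frechet_bound[OF xs, of z "k + 1"] by simp
        finally show ?thesis using fz False N by (simp add: pos_le_divide_eq mult.commute)
      qed
    qed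
    finally show ?thesis by (simp add: mult.assoc mult_left_mono)
  qed
  have "(\<lambda>N. \<bar>C\<bar> * frechet (k + 1) x * (1 / real N)) \<longlonglongrightarrow> 0"
    by (intro tendsto_mult_right_zero lim_1_over_n)
  moreover have "\<forall>\<^sub>F N in sequentially. cmod (L x) \<le> \<bar>C\<bar> * frechet (k + 1) x * (1 / real N)"
    using eventually_gt_at_top[of 0] by (rule eventually_mono) (rule le)
  ultimately have "cmod (L x) \<le> 0"
    by (rule tendsto_lowerbound) simp
  then show ?thesis by simp
qed

text \<open>Bounded functions \<open>k\<close> on the lattice give functionals; with \<open>k\<close> the indicator function of a
  parity class, these are the functionals \<open>\<phi>\<^sub>j\<^sub>k\<close>.\<close>

definition pairing :: "(int \<times> int \<Rightarrow> complex) \<Rightarrow> 'a \<Rightarrow> complex" where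
  "pairing k x = (\<Sum>\<^sub>\<infinity>z. fcoeff x z * k z)"

lemma pairing_summable:
  assumes k: "\<And>z. cmod (k z) \<le> K" and x: "x \<in> smooth"
  shows "(\<lambda>z. fcoeff x z * k z) summable_on UNIV"
    and "cmod (pairing k x) \<le> K * weight_sum * frechet 4 x"
proof -
  have K: "0 \<le> K" using order_trans[OF norm_ge_zero k[of 0]] .
  have s: "(\<lambda>z. cmod (fcoeff x z) * K) summable_on UNIV"
    by (intro summable_on_cmult_left abs_summable fcoeff_rapidly_decreasing x)
  have le: "norm (fcoeff x z * k z) \<le> cmod (fcoeff x z) * K" for z
    unfolding norm_mult by (intro mult_left_mono k) auto
  show 1: "(\<lambda>z. fcoeff x z * k z) summable_on UNIV"
    by (rule abs_summable_summable, rule summable_on_comparison_test[OF s le]) auto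
  have "cmod (pairing k x) \<le> (\<Sum>\<^sub>\<infinity>z. cmod (fcoeff x z) * K)"
    unfolding pairing_def by (rule norm_infsum_le[OF has_sum_infsum[OF 1] has_sum_infsum[OF s] le])
  also have "\<dots> = (\<Sum>\<^sub>\<infinity>z. cmod (fcoeff x z)) * K" by (rule infsum_cmult_left')
  also have "\<dots> \<le> weight_sum * frechet 4 x * K"
    by (intro mult_right_mono abs_summable(2) fcoeff_rapidly_decreasing x K)
  finally show "cmod (pairing k x) \<le> K * weight_sum * frechet 4 x" by (simp add: mult_ac)
qed

lemma pairing_add:
  assumes "\<And>z. cmod (k z) \<le> K" "x \<in> smooth" "y \<in> smooth"
  shows "pairing k (x + y) = pairing k x + pairing k y"
  unfolding pairing_def fcoeff_add[OF assms(2,3)] distrib_right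
  by (intro infsum_add pairing_summable(1)[OF assms(1)] assms(2,3))

lemma pairing_scaleC: "x \<in> smooth \<Longrightarrow> pairing k (c *\<^sub>C x) = c * pairing k x"
  unfolding pairing_def by (simp add: fcoeff_scaleC mult.assoc infsum_cmult_right')

lemma pairing_weyl: "pairing k (weyl w) = k w"
proof -
  have "pairing k (weyl w) = (\<Sum>\<^sub>\<infinity>z\<in>{w}. k z)"
    unfolding pairing_def fcoeff_weyl by (rule infsum_cong_neutral) auto
  then show ?thesis by simp
qed

lemma pairing_mult:
  assumes k: "\<And>z. cmod (k z) \<le> K" and x: "x \<in> smooth" and y: "y \<in> smooth"
  shows "pairing k (x * y) = (\<Sum>\<^sub>\<infinity>z. \<Sum>\<^sub>\<infinity>w. fcoeff x z * fcoeff y w * twist z w * k (z + w))"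
proof -
  note rd = fcoeff_rapidly_decreasing[OF x] fcoeff_rapidly_decreasing[OF y]
  let ?F = "\<lambda>z w. fcoeff x z * fcoeff y w * twist z w * k (z + w)"
  have F: "norm (?F z w) \<le> K * (cmod (fcoeff x z) * cmod (fcoeff y w))" for z w
    using mult_left_mono[OF k[of "z + w"], of "cmod (fcoeff x z) * cmod (fcoeff y w)"]
    by (simp add: norm_mult mult_ac)
  have "(\<Sum>\<^sub>\<infinity>z. \<Sum>\<^sub>\<infinity>w. ?F z w) = (\<Sum>\<^sub>\<infinity>v. \<Sum>\<^sub>\<infinity>z. ?F z (v - z))"
    by (rule double_sum_diagonals[OF rd F])
  also have "\<dots> = (\<Sum>\<^sub>\<infinity>v. fcoeff (x * y) v * k v)"
  proof (rule infsum_cong)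
    fix v
    have "z + (v - z) = v" for z :: "int \<times> int" by simp
    then show "(\<Sum>\<^sub>\<infinity>z. ?F z (v - z)) = fcoeff (x * y) v * k v"
      unfolding fcoeff_mult[OF x y] conv_def by (simp only: infsum_cmult_left')
  qed
  finally show ?thesis by (simp add: pairing_def)
qed

text \<open>On the whole smooth algebra, the functionals \<open>\<phi>\<^sub>j\<^sub>k\<close> are traces twisted by the flip.\<close>

lemma pairing_twisted_trace:
  assumes k: "\<And>z. cmod (k z) \<le> K" and parity: "\<And>z w. k (z + w) = k (z - w)"
    and x: "x \<in> smooth" and y: "y \<in> smooth"
  shows "pairing k (x * y) = pairing k (\<Phi> y * x)"
proof -
  note rd = fcoeff_rapidly_decreasing[OF x] fcoeff_rapidly_decreasing[OF y]
  let ?F = "\<lambda>z w. fcoeff x z * fcoeff y w * twist z w * k (z + w)"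
  have F: "norm (?F z w) \<le> K * (cmod (fcoeff x z) * cmod (fcoeff y w))" for z w
    using mult_left_mono[OF k[of "z + w"], of "cmod (fcoeff x z) * cmod (fcoeff y w)"]
    by (simp add: norm_mult mult_ac)
  have k': "k (z - w) = k (w - z)" for z w
    using parity[of 0 "z - w"] by simp
  have "pairing k (x * y) = (\<Sum>\<^sub>\<infinity>w. \<Sum>\<^sub>\<infinity>z. ?F z w)"
    unfolding pairing_mult[OF k x y] by (rule double_sum_swap[OF rd F])
  also have "\<dots> = (\<Sum>\<^sub>\<infinity>w. \<Sum>\<^sub>\<infinity>z. fcoeff y (- w) * fcoeff x z * twist w z * k (w + z))"
    by (rule infsum_reindex_bij_witness[where i = uminus and j = uminus])
      (simp_all add: twist_minus parity k' mult_ac)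
  also have "\<dots> = pairing k (\<Phi> y * x)"
    by (simp add: pairing_mult[OF k flip_smooth[OF y] x] fcoeff_flip[OF y])
  finally show ?thesis .
qed

lemma fcoeff_0_mult_commute:
  assumes "x \<in> smooth" "y \<in> smooth"
  shows "fcoeff (x * y) 0 = fcoeff (y * x) 0"
proof -
  have "fcoeff (x * y) 0 = (\<Sum>\<^sub>\<infinity>z. fcoeff x z * fcoeff y (- z))"
    using assms by (simp add: fcoeff_mult conv_def)
  also have "\<dots> = (\<Sum>\<^sub>\<infinity>z. fcoeff y z * fcoeff x (- z))"
    by (rule infsum_reindex_bij_witness[where i = uminus and j = uminus]) (auto simp: mult.commute)
  finally show ?thesis using assms by (simp add: fcoeff_mult conv_def)
qed

text \<open>A nonzero representative of the class of \<open>z\<close> modulo \<open>2\<close>; the origin is special, since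
  \<open>sym_weyl 0\<close> is a scalar and no commutator identity relates it to its class.\<close>

definition parity_rep :: "int \<times> int \<Rightarrow> int \<times> int" where
  "parity_rep z = (2 + fst z mod 2, snd z mod 2)"

lemma sym_commutator:
  "sym_weyl z * sym_weyl y - sym_weyl y * sym_weyl z = (twist z y - twist y z) *\<^sub>C (sym_weyl (z + y) - sym_weyl (z - y))"
proof -
  have prod: "sym_weyl z * sym_weyl y = twist z y *\<^sub>C sym_weyl (z + y) + twist y z *\<^sub>C sym_weyl (z - y)"
    for z y
  proof -
    have "weyl z * weyl (- y) = twist y z *\<^sub>C weyl (z - y)"
      using weyl_mult[of z "- y"] by (simp add: twist_minus)
    moreover have "weyl (- z) * weyl y = twist y z *\<^sub>C weyl (- (z - y))"
      using weyl_mult[of "- z" y] by (simp add: twist_minus)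
    moreover have "weyl (- z) * weyl (- y) = twist z y *\<^sub>C weyl (- (z + y))"
      using weyl_mult[of "- z" "- y"] by (simp add: twist_minus)
    ultimately show ?thesis
      unfolding sym_weyl_def distrib_left distrib_right scaleC_add_right weyl_mult[of z y]
      by (simp only: add_ac)
  qed
  have "sym_weyl (y - z) = sym_weyl (z - y)" "sym_weyl (y + z) = sym_weyl (z + y)"
    by (simp_all add: sym_weyl_def add.commute)
  then show ?thesis
    unfolding prod[of z y] prod[of y z] by (simp add: scaleC_diff_left scaleC_diff_right)
qed

lemma twist_diff_nonzero:
  assumes "symplectic z y \<noteq> 0"
  shows "twist z y - twist y z \<noteq> 0"
proof
  assume "twist z y - twist y z = 0"
  then have "e_exp (\<theta> / 2 * of_int (symplectic z y)) = e_exp (- (\<theta> / 2 * of_int (symplectic z y)))"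
    by (simp add: twist_def symplectic_commute[of y z])
  then have "e_exp (\<theta> / 2 * of_int (symplectic z y)) * e_exp (\<theta> / 2 * of_int (symplectic z y)) = 1"
    by (metis add.right_inverse e_exp_0 e_exp_add)
  then have "e_exp (\<theta> * of_int (symplectic z y)) = 1" by (simp add: e_exp_add[symmetric])
  then show False using assms by (simp add: e_exp_theta_eq_1_iff)
qed

definition continuous_trace :: "('a \<Rightarrow> complex) \<Rightarrow> bool" where
  "continuous_trace \<psi> \<longleftrightarrow>
    (\<forall>x\<in>smooth_orbifold. \<forall>c. \<psi> (c *\<^sub>C x) = c * \<psi> x) \<and> orb.is_trace \<psi> \<and>
    (\<exists>k C. \<forall>x\<in>smooth_orbifold. cmod (\<psi> x) \<le> C * frechet k x)"

text \<open>The difference of phases in \<open>sym_commutator\<close> does not vanish, because \<open>\<theta>\<close> is irrational.\<close>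

lemma trace_sym_eq:
  assumes "continuous_trace \<psi>" and "symplectic z y \<noteq> 0"
  shows "\<psi> (sym_weyl (z + y)) = \<psi> (sym_weyl (z - y))"
proof -
  note O = sym_orbifold orb.S_mult orb.S_diff smooth_orbifold_scaleC
  have sc: "\<psi> (c *\<^sub>C x) = c * \<psi> x" if "x \<in> smooth_orbifold" for x c
    using assms that by (simp add: continuous_trace_def)
  have tr: "orb.is_trace \<psi>" using assms by (simp add: continuous_trace_def)
  have diff: "\<psi> (a - b) = \<psi> a - \<psi> b" if "a \<in> smooth_orbifold" "b \<in> smooth_orbifold" for a b
  proof -
    have "\<psi> (a - b + b) = \<psi> (a - b) + \<psi> b"
      using tr that orb.S_diff[OF that] unfolding orb.is_trace_def by blast
    then show ?thesis by simp
  qed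
  have "\<psi> (sym_weyl z * sym_weyl y) = \<psi> (sym_weyl y * sym_weyl z)"
    using tr sym_orbifold unfolding orb.is_trace_def by blast
  then have "(twist z y - twist y z) * (\<psi> (sym_weyl (z + y)) - \<psi> (sym_weyl (z - y))) = 0"
    using arg_cong[OF sym_commutator[of z y], of \<psi>] by (simp add: diff sc O)
  then show ?thesis using twist_diff_nonzero[OF assms(2)] by simp
qed

text \<open>Two lattice points of the same parity are \<open>u + v\<close> and \<open>u - v\<close> with \<open>u\<close> and \<open>v\<close> in the lattice, so
  \<open>trace_sym_eq\<close> applies as long as they are not on one line through the origin.\<close>

lemma trace_sym_parity:
  assumes \<psi>: "continuous_trace \<psi>" and nz: "z \<noteq> 0" "y \<noteq> 0"
    and par: "even (fst z - fst y)" "even (snd z - snd y)"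
  shows "\<psi> (sym_weyl z) = \<psi> (sym_weyl y)"
proof -
  have transversal: "\<psi> (sym_weyl z) = \<psi> (sym_weyl y)"
    if s: "symplectic z y \<noteq> 0" and par: "even (fst z - fst y)" "even (snd z - snd y)" for z y
  proof -
    obtain a b where ab: "fst z - fst y = 2 * a" "snd z - snd y = 2 * b"
      using par by (metis evenE)
    define v where "v = (a, b)"
    have z: "z = (y + v) + v" "y = (y + v) - v"
      using ab by (auto simp: v_def prod_eq_iff)
    have "symplectic z y = - 2 * symplectic (y + v) v"
      by (subst (1) z(1)) (simp add: symplectic_simps symplectic_commute[of v y])
    then have "symplectic (y + v) v \<noteq> 0" using s by auto
    then show ?thesis using trace_sym_eq[OF \<psi>, of "y + v" v] z by simp
  qed
  show ?thesis
  proof (cases "symplectic z y = 0")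
    case True
    \<comment> \<open>Both elements are compared with a third one that lies on neither of their lines.\<close>
    define x where "x = (fst z - 2 * snd z, snd z + 2 * fst z)"
    define r where "r = (fst z)\<^sup>2 + (snd z)\<^sup>2"
    have x1: "symplectic z x = - 2 * r"
      by (simp add: symplectic_def x_def r_def power2_eq_square algebra_simps)
    have z2: "r \<noteq> 0"
      unfolding r_def sum_power2_eq_zero_iff using nz(1) by (simp add: prod_eq_iff)
    then have zx: "symplectic z x \<noteq> 0" using x1 by simp
    have yx0: "symplectic y x = - 2 * (fst z * fst y + snd z * snd y)"
    proof -
      have "symplectic y x = - symplectic z y - 2 * (fst z * fst y + snd z * snd y)"
        by (simp add: symplectic_def x_def algebra_simps)
      then show ?thesis using True by simp
    qed
    have "(fst z * fst y + snd z * snd y)\<^sup>2 + (symplectic z y)\<^sup>2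
        = r * ((fst y)\<^sup>2 + (snd y)\<^sup>2)"
      by (simp add: symplectic_def r_def power2_eq_square algebra_simps)
    moreover have "(fst y)\<^sup>2 + (snd y)\<^sup>2 \<noteq> 0"
      unfolding sum_power2_eq_zero_iff using nz(2) by (simp add: prod_eq_iff)
    ultimately have "fst z * fst y + snd z * snd y \<noteq> 0"
      using z2 True by (metis add_0_right mult_eq_0_iff power_zero_numeral)
    then have yx: "symplectic y x \<noteq> 0" using yx0 by (metis mult_eq_0_iff neg_equal_0_iff_equal zero_neq_numeral)
    have px: "even (fst z - fst x)" "even (snd z - snd x)" by (simp_all add: x_def)
    have py: "even (fst y - fst x)" "even (snd y - snd x)" using px par by simp_all
    show ?thesis using transversal[OF zx px] transversal[OF yx py] by simp
  qed (use transversal par in blast)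
qed

text \<open>Every continuous trace is a linear combination of the canonical trace \<open>x \<mapsto> fcoeff x 0\<close> and the
  four functionals \<open>\<phi>\<^sub>j\<^sub>k\<close>: the two sides are continuous and agree on all \<open>sym_weyl z\<close>.\<close>

lemma continuous_trace_formula:
  assumes \<psi>: "continuous_trace \<psi>" and x: "x \<in> smooth_orbifold"
  defines "\<kappa> \<equiv> \<lambda>z. \<psi> (sym_weyl (parity_rep z)) / 2"
  shows "\<psi> x = (\<psi> 1 - \<kappa> 0) * fcoeff x 0 + pairing \<kappa> x"
    and "\<exists>K. \<forall>z. cmod (\<kappa> z) \<le> K" and "\<kappa> (z + w) = \<kappa> (z - w)"
proof -
  have sc: "\<psi> (c *\<^sub>C x) = c * \<psi> x" if "x \<in> smooth_orbifold" for x c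
    using \<psi> that by (simp add: continuous_trace_def)
  have ad: "\<psi> (x + y) = \<psi> x + \<psi> y" if "x \<in> smooth_orbifold" "y \<in> smooth_orbifold" for x y
    using \<psi> that by (simp add: continuous_trace_def orb.is_trace_def)
  obtain k C where C: "\<And>x. x \<in> smooth_orbifold \<Longrightarrow> cmod (\<psi> x) \<le> C * frechet k x"
    using \<psi> unfolding continuous_trace_def by blast
  have "finite (range \<kappa>)"
  proof (rule finite_subset)
    have "parity_rep z \<in> {2, 3} \<times> {0, 1}" for z
      unfolding parity_rep_def by simp presburger
    then show "range \<kappa> \<subseteq> (\<lambda>p. \<psi> (sym_weyl p) / 2) ` ({2, 3} \<times> {0, 1})"
      unfolding \<kappa>_def by blast
  qed auto
  then have "bounded (range \<kappa>)" by (rule finite_imp_bounded)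
  then obtain K where K: "\<And>z. cmod (\<kappa> z) \<le> K" unfolding bounded_iff by blast
  then show "\<exists>K. \<forall>z. cmod (\<kappa> z) \<le> K" by blast
  have "parity_rep (z + w) = parity_rep (z - w)" for z w
    unfolding parity_rep_def by (auto simp: prod_eq_iff) presburger+
  then show "\<kappa> (z + w) = \<kappa> (z - w)" by (simp add: \<kappa>_def)
  have \<kappa>: "\<psi> (sym_weyl z) = 2 * \<kappa> z" if "z \<noteq> 0" for z
  proof -
    have "\<psi> (sym_weyl z) = \<psi> (sym_weyl (parity_rep z))"
    proof (rule trace_sym_parity[OF \<psi> that])
      have "0 < fst (parity_rep z)" by (simp add: parity_rep_def add_pos_nonneg)
      then show "parity_rep z \<noteq> 0" by auto
      show "even (fst z - fst (parity_rep z))" "even (snd z - snd (parity_rep z))"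
        unfolding parity_rep_def by simp_all
    qed
    then show ?thesis by (simp add: \<kappa>_def)
  qed
  have \<kappa>_minus: "\<kappa> (- z) = \<kappa> z" for z
  proof -
    have "parity_rep (- z) = parity_rep z"
      unfolding parity_rep_def by (auto simp: prod_eq_iff) presburger+
    then show ?thesis by (simp add: \<kappa>_def)
  qed
  let ?a = "\<psi> 1 - \<kappa> 0"
  let ?L = "\<lambda>x. \<psi> x - ?a * fcoeff x 0 - pairing \<kappa> x"
  note sm = smooth_orbifold_smooth
  have "?L x = 0"
  proof (rule vanishes_of_vanishes_on_sym[OF _ _ _ _ x])
    show "?L (x + y) = ?L x + ?L y" if "x \<in> smooth_orbifold" "y \<in> smooth_orbifold" for x y
      using that by (simp add: ad fcoeff_add sm pairing_add[of \<kappa> K, OF K] algebra_simps)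
    show "?L (c *\<^sub>C x) = c * ?L x" if "x \<in> smooth_orbifold" for x c
      using that by (simp add: sc fcoeff_scaleC sm pairing_scaleC algebra_simps)
    show "cmod (?L x) \<le> (\<bar>C\<bar> + cmod ?a + K * weight_sum) * frechet (k + 4) x"
      if x: "x \<in> smooth_orbifold" for x
    proof -
      let ?f = "frechet (k + 4) x"
      have "cmod (?L x) \<le> cmod (\<psi> x) + cmod (?a * fcoeff x 0) + cmod (pairing \<kappa> x)"
        by (meson add_mono norm_triangle_ineq4 order_refl order_trans)
      moreover have "cmod (\<psi> x) \<le> \<bar>C\<bar> * ?f"
      proof -
        have "C * frechet k x \<le> \<bar>C\<bar> * ?f"
          using frechet_nonneg[OF sm[OF x]] by (intro mult_mono frechet_mono sm x) auto
        then show ?thesis using C[OF x] by linarith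
      qed
      moreover have "cmod (?a * fcoeff x 0) \<le> cmod ?a * ?f"
      proof -
        have "cmod (fcoeff x 0) \<le> frechet 0 x" using frechet_bound[OF sm[OF x], of 0 0] by simp
        also have "\<dots> \<le> ?f" by (intro frechet_mono sm x) simp
        finally show ?thesis unfolding norm_mult by (intro mult_left_mono) auto
      qed
      moreover have "cmod (pairing \<kappa> x) \<le> K * weight_sum * ?f"
      proof -
        have "0 \<le> K" using order_trans[OF norm_ge_zero K[of 0]] .
        then have "K * weight_sum * frechet 4 x \<le> K * weight_sum * ?f"
          by (intro mult_left_mono frechet_mono sm x) (auto simp: weight_sum_nonneg)
        then show ?thesis using pairing_summable(2)[of \<kappa> K, OF K sm[OF x]] by linarith
      qed
      ultimately show ?thesis by (simp add: distrib_right)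
    qed
    show "?L (sym_weyl z) = 0" for z
    proof -
      have "pairing \<kappa> (sym_weyl z) = 2 * \<kappa> z"
        by (simp add: sym_weyl_def pairing_add[of \<kappa> K, OF K] smooth_weyl pairing_weyl \<kappa>_minus)
      then show ?thesis
        by (cases "z = 0")
          (simp_all add: \<kappa> fcoeff_sym_weyl sym_weyl_0 sc orb.S_1 fcoeff_scaleC smooth_1 fcoeff_1
            algebra_simps)
    qed
  qed
  then show "\<psi> x = ?a * fcoeff x 0 + pairing \<kappa> x" by (simp add: algebra_simps)
qed

end

section \<open>Projections detecting the traces\<close>

lemma cmod_add_less_2:
  assumes "cmod a = 1" "cmod b = 1" "a \<noteq> b"
  shows "cmod (a + b) < 2"
proof -
  have "(cmod (a + b))\<^sup>2 + (cmod (a - b))\<^sup>2 = 2 * (cmod a)\<^sup>2 + 2 * (cmod b)\<^sup>2"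
    unfolding cmod_power2 by (simp add: power2_eq_square algebra_simps)
  moreover have "0 < (cmod (a - b))\<^sup>2" using assms(3) by simp
  moreover have "2 * (cmod a)\<^sup>2 + 2 * (cmod b)\<^sup>2 = 2\<^sup>2" using assms(1,2) by simp
  ultimately have "(cmod (a + b))\<^sup>2 < 2\<^sup>2" by linarith
  then show ?thesis by (rule power2_less_imp_less) simp
qed

context flip_algebra
begin

text \<open>In the square of the sum, \<open>R1 * R2\<close> and \<open>R2 * R1\<close> differ by a phase other than \<open>1\<close>, so these two of
  the sixteen terms do not add up to norm \<open>2\<close>.\<close>

lemma norm_sum_of_noncommuting_unitaries:
  assumes R: "R1 = c1 *\<^sub>C weyl y1" "R2 = c2 *\<^sub>C weyl y2" "cmod c1 = 1" "cmod c2 = 1"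
    and s: "symplectic y1 y2 \<noteq> 0"
  shows "norm (R1 + star R1 + R2 + star R2) < 4"
proof -
  define T P G where "T = R1 + star R1 + R2 + star R2" and "P = R1 + R2" and "G = star R1 + star R2"
  have n: "norm R1 = 1" "norm R2 = 1" using R by (auto simp: norm_scaleC)
  have "norm P \<le> 2" unfolding P_def using norm_triangle_ineq[of R1 R2] n by simp
  moreover have "norm G \<le> 2" unfolding G_def using norm_triangle_ineq[of "star R1" "star R2"] n by simp
  ultimately have PG: "norm (P * G) \<le> 4" "norm (G * P) \<le> 4" "norm (G * G) \<le> 4"
    using norm_mult_ineq[of P G] norm_mult_ineq[of G P] norm_mult_ineq[of G G]
      mult_mono[of "norm P" 2 "norm G" 2] mult_mono[of "norm G" 2 "norm P" 2] mult_mono[of "norm G" 2 "norm G" 2]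
    by auto
  have "R1 * R2 + R2 * R1 = (c1 * c2 * (twist y1 y2 + twist y2 y1)) *\<^sub>C weyl (y1 + y2)"
    by (simp add: R weyl_mult mult_scaleC_left mult_scaleC_right scaleC_scaleC scaleC_add_left
        distrib_left add.commute[of y2] mult_ac)
  then have "norm (R1 * R2 + R2 * R1) = cmod (twist y1 y2 + twist y2 y1)"
    using R by (simp add: norm_scaleC norm_mult)
  also have "\<dots> < 2" using twist_diff_nonzero[OF s] by (intro cmod_add_less_2) auto
  finally have c: "norm (R1 * R2 + R2 * R1) < 2" .
  have "norm (R1 * R1) \<le> 1" "norm (R2 * R2) \<le> 1"
    using norm_mult_ineq[of R1 R1] norm_mult_ineq[of R2 R2] n by auto
  moreover have "P * P = R1 * R1 + R2 * R2 + (R1 * R2 + R2 * R1)"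
    by (simp add: P_def algebra_simps)
  ultimately have PP: "norm (P * P) < 4"
    using c norm_triangle_ineq[of "R1 * R1 + R2 * R2" "R1 * R2 + R2 * R1"]
      norm_triangle_ineq[of "R1 * R1" "R2 * R2"] by simp
  have "star T * T = P * P + P * G + G * P + G * G"
    by (simp add: T_def P_def G_def star_add star_star algebra_simps)
  then have "norm (star T * T) < 16"
    using PP PG norm_triangle_ineq[of "P * P + P * G + G * P" "G * G"]
      norm_triangle_ineq[of "P * P + P * G" "G * P"] norm_triangle_ineq[of "P * P" "P * G"] by simp
  then have "(norm T)\<^sup>2 < 4\<^sup>2" by (simp add: cstar_identity)
  then have "norm T < 4" by (rule power2_less_imp_less) simp
  then show ?thesis by (simp add: T_def)
qed

text \<open>The elements with \<open>weyl w * \<Phi> y = - y\<close> form a right module over the orbifold, and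
  \<open>x z = weyl z - weyl w * weyl (- z)\<close> lies in it. The sum of \<open>x z * star (x z)\<close> over two suitable
  \<open>z\<close> is \<open>4 - T\<close>, where \<open>T\<close> is a sum of four unitaries as in
  \<open>norm_sum_of_noncommuting_unitaries\<close>. So it is invertible, and its inverse square root normalises the
  two elements to a frame.\<close>

lemma ex_flip_module_frame:
  assumes s: "symplectic (2 * fst z1 - fst w, 2 * snd z1 - snd w) (2 * fst z2 - fst w, 2 * snd z2 - snd w) \<noteq> 0"
  obtains y1 y2 where "y1 \<in> smooth" "y2 \<in> smooth" "y1 * star y1 + y2 * star y2 = 1"
    "\<Phi> y1 = - (weyl (- w) * y1)" "\<Phi> y2 = - (weyl (- w) * y2)"
proof -
  define x where "x z = weyl z - weyl w * weyl (- z)" for z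
  define R where "R z = weyl z * weyl z * weyl (- w)" for z
  have inv: "weyl z * weyl (- z) = 1" "weyl (- z) * weyl z = 1" for z by (simp_all add: weyl_mult)
  have inv': "weyl z * (weyl (- z) * a) = a" "weyl (- z) * (weyl z * a) = a" for z a
    by (simp_all add: mult.assoc[symmetric] inv)
  have xsm: "x z \<in> smooth" for z
    unfolding x_def by (intro smooth_diff smooth_mult smooth_weyl)
  have Rsm: "R z \<in> smooth" for z
    unfolding R_def by (intro smooth_mult smooth_weyl)
  have xx: "x z * star (x z) = 2 *\<^sub>C 1 - (R z + star (R z))" for z
    by (simp add: x_def R_def star_diff star_mult star_weyl left_diff_distrib right_diff_distrib
        mult.assoc inv inv' scaleC_2)
  have \<Phi>x: "\<Phi> (x z) = - (weyl (- w) * x z)" for z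
    by (simp add: x_def flip_diff flip_mult flip_weyl right_diff_distrib inv')
  have R: "\<exists>c. cmod c = 1 \<and> R z = c *\<^sub>C weyl (2 * fst z - fst w, 2 * snd z - snd w)" for z
  proof -
    have "R z = (twist z z * twist (z + z) (- w)) *\<^sub>C weyl (z + z + - w)"
      by (simp add: R_def weyl_mult mult_scaleC_left scaleC_scaleC)
    also have "z + z + - w = (2 * fst z - fst w, 2 * snd z - snd w)" by (simp add: prod_eq_iff)
    finally show ?thesis by (intro exI[of _ "twist z z * twist (z + z) (- w)"]) (simp add: norm_mult)
  qed
  define A where "A = (1 / 4) *\<^sub>C (R z1 + star (R z1) + R z2 + star (R z2))"
  obtain c1 c2 where c: "cmod c1 = 1" "R z1 = c1 *\<^sub>C weyl (2 * fst z1 - fst w, 2 * snd z1 - snd w)"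
    "cmod c2 = 1" "R z2 = c2 *\<^sub>C weyl (2 * fst z2 - fst w, 2 * snd z2 - snd w)"
    using R[of z1] R[of z2] by blast
  have nA: "norm A < 1"
    using norm_sum_of_noncommuting_unitaries[OF c(2,4,1,3) s] by (simp add: A_def norm_scaleC)
  have As: "star A = A"
    by (simp add: A_def star_scaleC star_add star_star add_ac)
  have Asm: "A \<in> smooth"
    unfolding A_def by (intro smooth_scaleC smooth_add smooth_star Rsm)
  have h: "x z1 * star (x z1) + x z2 * star (x z2) = 4 *\<^sub>C (1 - A)"
  proof -
    have "4 *\<^sub>C (1 :: 'a) = 2 *\<^sub>C 1 + 2 *\<^sub>C 1" using scaleC_add_left[of 2 2 "1::'a"] by simp
    then show ?thesis by (simp add: xx A_def scaleC_diff_right scaleC_scaleC algebra_simps)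
  qed
  have hA: "A = 1 - (1 / 4) *\<^sub>C (x z1 * star (x z1) + x z2 * star (x z2))"
    by (simp add: h scaleC_scaleC)
  define g where "g = (1 / 2) *\<^sub>C isqrt_one_minus A"
  have gsm: "g \<in> smooth" unfolding g_def by (intro smooth_scaleC isqrt_one_minus_smooth Asm nA)
  have gs: "star g = g" by (simp add: g_def star_scaleC star_isqrt_one_minus[OF nA As])
  have "g * (4 *\<^sub>C (1 - A)) * g = isqrt_one_minus A * ((1 - A) * isqrt_one_minus A)"
    by (simp add: g_def mult_scaleC_left mult_scaleC_right scaleC_scaleC mult.assoc)
  also have "(1 - A) * isqrt_one_minus A = isqrt_one_minus A * (1 - A)"
    by (rule isqrt_one_minus_intertwine[OF nA nA, symmetric]) (simp add: algebra_simps)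
  finally have ghg: "g * (4 *\<^sub>C (1 - A)) * g = 1"
    using isqrt_one_minus_square[OF nA] by (simp add: mult.assoc)
  have "\<Phi> A * weyl (- w) = weyl (- w) * A"
  proof -
    have eq: "\<Phi> (x z * star (x z)) * weyl (- w) = weyl (- w) * (x z * star (x z))" for z
      by (simp add: flip_mult flip_star \<Phi>x star_minus star_mult star_weyl mult.assoc inv)
    show ?thesis
      unfolding hA
      by (simp only: flip_diff flip_1 flip_scaleC flip_add left_diff_distrib right_diff_distrib
          mult_scaleC_left mult_scaleC_right distrib_left distrib_right eq mult_1 mult_1_right)
  qed
  moreover have n\<Phi>A: "norm (\<Phi> A) < 1" using norm_flip_le[of A] nA by simp
  ultimately have "isqrt_one_minus (\<Phi> A) * weyl (- w) = weyl (- w) * isqrt_one_minus A"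
    by (intro isqrt_one_minus_intertwine nA)
  then have \<Phi>g: "\<Phi> g * weyl (- w) = weyl (- w) * g"
    using isqrt_one_minus_bounded_linear[OF nA bounded_linear_flip flip_power]
    by (simp add: g_def flip_scaleC mult_scaleC_left mult_scaleC_right)
  show thesis
  proof (rule that[of "g * x z1" "g * x z2"])
    show "g * x z1 \<in> smooth" "g * x z2 \<in> smooth" by (intro smooth_mult gsm xsm)+
    have "g * x z1 * star (g * x z1) + g * x z2 * star (g * x z2)
        = g * (x z1 * star (x z1) + x z2 * star (x z2)) * g"
      by (simp add: star_mult gs distrib_left distrib_right mult.assoc)
    then show "g * x z1 * star (g * x z1) + g * x z2 * star (g * x z2) = 1"
      by (simp only: h ghg)
    have "\<Phi> (g * x z) = - (weyl (- w) * (g * x z))" for z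
      by (simp add: flip_mult \<Phi>x mult.assoc[symmetric] \<Phi>g)
    then show "\<Phi> (g * x z1) = - (weyl (- w) * (g * x z1))" "\<Phi> (g * x z2) = - (weyl (- w) * (g * x z2))"
      by auto
  qed
qed

text \<open>The Gram matrix \<open>star (y i) * y j\<close> of a frame is a projection over the orbifold. Its canonical trace
  is that of \<open>\<Sum>i. y i * star (y i) = 1\<close>, whereas the functionals twisted by the flip see
  \<open>\<Phi> (y i) * star (y i)\<close>, which sums up to \<open>- weyl (- w)\<close>.\<close>

lemma ex_flip_projection:
  assumes s: "symplectic (2 * fst z1 - fst w, 2 * snd z1 - snd w) (2 * fst z2 - fst w, 2 * snd z2 - snd w) \<noteq> 0"
  obtains p where "p \<in> mat_projections orbifold" "mat_over smooth_orbifold p"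
    "mat_trace (\<lambda>x. fcoeff x 0) p = 1"
    "\<And>\<kappa> K. (\<And>z. cmod (\<kappa> z) \<le> K) \<Longrightarrow> (\<And>z z'. \<kappa> (z + z') = \<kappa> (z - z')) \<Longrightarrow>
      mat_trace (pairing \<kappa>) p = - \<kappa> w"
proof -
  obtain y1 y2 where y12: "y1 \<in> smooth" "y2 \<in> smooth" "y1 * star y1 + y2 * star y2 = 1"
    "\<Phi> y1 = - (weyl (- w) * y1)" "\<Phi> y2 = - (weyl (- w) * y2)"
    by (rule ex_flip_module_frame[OF s])
  define y where "y i = (if i = 0 then y1 else y2)" for i :: nat
  have ysm: "y i \<in> smooth" and \<Phi>y: "\<Phi> (y i) = - (weyl (- w) * y i)" for i using y12 by (auto simp: y_def)
  have two: "(\<Sum>i<2. f i) = f 0 + f (1::nat)" for f :: "nat \<Rightarrow> 'b::comm_monoid_add"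
    by (simp add: numeral_2_eq_2)
  have yy: "(\<Sum>l<2. y l * star (y l)) = 1" using y12(3) by (simp add: two y_def)
  define p where "p = mat 2 2 (\<lambda>(i, j). star (y i) * y j)"
  have O: "star (y i) * y j \<in> smooth_orbifold" for i j
  proof -
    have "weyl w * (weyl (- w) * a) = a" for a by (simp add: mult.assoc[symmetric] weyl_mult)
    then show ?thesis
      by (simp add: smooth_orbifold_iff smooth_mult smooth_star ysm flip_mult flip_star \<Phi>y star_minus
          star_mult star_weyl mult.assoc)
  qed
  have pO: "mat_over smooth_orbifold p" using O by (auto simp: p_def mat_over_def)
  have "p * p = p"
  proof (rule eq_matI)
    fix i j assume "i < dim_row p" "j < dim_col p"
    then have ij: "i < 2" "j < 2" by (auto simp: p_def)
    have "(p * p) $$ (i, j) = (\<Sum>l<2. star (y i) * (y l * star (y l)) * y j)"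
      using ij by (subst mat_mult_entry) (auto simp: p_def mult.assoc)
    also have "\<dots> = star (y i) * (\<Sum>l<2. y l * star (y l)) * y j"
      by (simp only: sum_distrib_left sum_distrib_right)
    finally show "(p * p) $$ (i, j) = p $$ (i, j)" using ij by (simp add: yy p_def)
  qed (auto simp: p_def)
  moreover have "mat_star p = p"
    by (intro eq_matI) (auto simp: mat_star_def p_def star_mult star_star)
  ultimately have "p \<in> mat_projections orbifold"
    using pO by (auto simp: mat_projections_def elements_mat_subset_iff mat_over_def smooth_flip_orbifold_def)
      (auto simp: p_def)
  moreover have "mat_trace (\<lambda>x. fcoeff x 0) p = 1"
  proof -
    have "mat_trace (\<lambda>x. fcoeff x 0) p = (\<Sum>i<2. fcoeff (star (y i) * y i) 0)"
      by (simp add: mat_trace_def p_def)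
    also have "\<dots> = (\<Sum>i<2. fcoeff (y i * star (y i)) 0)"
      by (simp add: fcoeff_0_mult_commute[OF smooth_star[OF ysm] ysm])
    also have "\<dots> = fcoeff (\<Sum>i<2. y i * star (y i)) 0"
      by (simp add: fcoeff_sum smooth_mult smooth_star ysm)
    finally show ?thesis by (simp add: yy fcoeff_1)
  qed
  moreover have "mat_trace (pairing \<kappa>) p = - \<kappa> w"
    if K: "\<And>z. cmod (\<kappa> z) \<le> K" and par: "\<And>z z'. \<kappa> (z + z') = \<kappa> (z - z')" for \<kappa> K
  proof -
    note sm = smooth_weyl smooth_mult smooth_star ysm
    have neg: "pairing \<kappa> (- x) = - pairing \<kappa> x" if "x \<in> smooth" for x
      using pairing_scaleC[OF that, of \<kappa> "-1"] by (simp add: scaleC_minus_left)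
    have "mat_trace (pairing \<kappa>) p = (\<Sum>i<2. pairing \<kappa> (star (y i) * y i))"
      by (simp add: mat_trace_def p_def)
    also have "\<dots> = (\<Sum>i<2. - pairing \<kappa> (weyl (- w) * (y i * star (y i))))"
      by (intro sum.cong refl)
        (simp add: pairing_twisted_trace[of \<kappa> K, OF K par smooth_star[OF ysm] ysm] \<Phi>y neg mult.assoc sm)
    also have "\<dots> = - pairing \<kappa> (weyl (- w) * (\<Sum>i<2. y i * star (y i)))"
      by (simp only: two distrib_left) (simp add: pairing_add[of \<kappa> K, OF K] sm)
    also have "\<dots> = - \<kappa> w"
      using par[of 0 w] by (simp add: yy pairing_weyl)
    finally show ?thesis .
  qed
  ultimately show thesis using that pO by blast
qed

text \<open>With \<open>\<alpha>\<close> the coefficient of the canonical trace and \<open>\<kappa>\<close> those of the functionals \<open>\<phi>\<^sub>j\<^sub>k\<close>, the unit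
  gives \<open>\<alpha> + \<kappa> 0 = 0\<close> and the projections of the four twisted modules give
  \<open>\<alpha> - \<kappa> w = 0\<close>.\<close>

theorem continuous_trace_eq_0:
  assumes \<psi>: "continuous_trace \<psi>" and one: "\<psi> 1 = 0"
    and proj: "\<And>p. p \<in> mat_projections orbifold \<Longrightarrow> mat_over smooth_orbifold p \<Longrightarrow> mat_trace \<psi> p = 0"
    and x: "x \<in> smooth_orbifold"
  shows "\<psi> x = 0"
proof -
  define \<kappa> where "\<kappa> z = \<psi> (sym_weyl (parity_rep z)) / 2" for z
  note formula = continuous_trace_formula[OF \<psi>, folded \<kappa>_def]
  obtain K where K: "\<And>z. cmod (\<kappa> z) \<le> K" using formula(2)[OF x] by blast
  have par: "\<kappa> (z + z') = \<kappa> (z - z')" for z z' by (rule formula(3)[OF x])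
  have eq: "\<kappa> w = - \<kappa> 0" if w: "w \<in> {0, 1} \<times> {0, 1}" for w
  proof -
    \<comment> \<open>The pair \<open>(1, 0)\<close>, \<open>(0, 2)\<close> is transversal for all four \<open>w\<close>; \<open>(1, 0)\<close>, \<open>(0, 1)\<close> fails for \<open>w = (1, 1)\<close>.\<close>
    have "symplectic (2 * fst (1, 0) - fst w, 2 * snd (1, 0) - snd w) (2 * fst (0, 2) - fst w, 2 * snd (0, 2) - snd w) \<noteq> 0"
      using w by (auto simp: symplectic_def)
    then obtain p where p: "p \<in> mat_projections orbifold" "mat_over smooth_orbifold p"
      "mat_trace (\<lambda>x. fcoeff x 0) p = 1" "mat_trace (pairing \<kappa>) p = - \<kappa> w"
      using ex_flip_projection[of "(1, 0)" w "(0, 2)"] K par by metis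
    have "dim_row p = dim_col p" using p(1) by (auto simp: mat_projections_def)
    then have "mat_trace \<psi> p = (\<Sum>i<dim_row p. - \<kappa> 0 * fcoeff (p $$ (i, i)) 0 + pairing \<kappa> (p $$ (i, i)))"
      unfolding mat_trace_def
      using p(2) formula(1) one by (intro sum.cong refl) (auto simp: mat_over_def)
    also have "\<dots> = - \<kappa> 0 * mat_trace (\<lambda>x. fcoeff x 0) p + mat_trace (pairing \<kappa>) p"
      by (simp add: mat_trace_def sum_subtractf sum_distrib_left sum_negf)
    also have "\<dots> = - \<kappa> 0 - \<kappa> w" by (simp add: p)
    finally show ?thesis using proj[OF p(1,2)] by simp
  qed
  have "\<kappa> 0 = 0" using eq[of 0] by (simp add: zero_prod_def)
  have "\<kappa> z = 0" for z
  proof -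
    define w where "w = (fst z mod 2, snd z mod 2)"
    have "parity_rep z = parity_rep w" by (simp add: parity_rep_def w_def)
    moreover have "w \<in> {0, 1} \<times> {0, 1}" unfolding w_def by simp presburger
    ultimately show ?thesis using eq[of w] \<open>\<kappa> 0 = 0\<close> by (simp add: \<kappa>_def)
  qed
  then show ?thesis using formula(1)[OF x] one by (simp add: pairing_def)
qed

end

context flip_orbifold_automorphism
begin

lemma auto_projection:
  assumes p: "p \<in> mat_projections orbifold"
  shows "map_mat \<beta> p \<in> mat_projections orbifold"
proof -
  have sq: "dim_row p = dim_col p" and over: "mat_over orbifold p" and pp: "p * p = p" and ps: "mat_star p = p"
    using p by (auto simp: mat_projections_def elements_mat_subset_iff)
  have "map_mat \<beta> p * map_mat \<beta> p = map_mat \<beta> (p * p)"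
  proof (rule eq_matI)
    fix i j assume "i < dim_row (map_mat \<beta> (p * p))" "j < dim_col (map_mat \<beta> (p * p))"
    then have ij: "i < dim_row p" "j < dim_col p" by auto
    have B: "p $$ (i, l) \<in> orbifold" "p $$ (l, j) \<in> orbifold" if "l < dim_row p" for l
      using over ij that sq by (auto simp: mat_over_def)
    have "(map_mat \<beta> p * map_mat \<beta> p) $$ (i, j) = (\<Sum>l<dim_row p. \<beta> (p $$ (i, l) * p $$ (l, j)))"
      using ij sq B by (subst mat_mult_entry) (auto simp: auto_mult)
    also have "\<dots> = \<beta> (\<Sum>l<dim_row p. p $$ (i, l) * p $$ (l, j))"
      using B by (intro auto_sum[symmetric] orb.mult) auto
    also have "(\<Sum>l<dim_row p. p $$ (i, l) * p $$ (l, j)) = (p * p) $$ (i, j)"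
      using ij sq by (subst mat_mult_entry) auto
    finally show "(map_mat \<beta> p * map_mat \<beta> p) $$ (i, j) = map_mat \<beta> (p * p) $$ (i, j)"
      using ij by simp
  qed auto
  moreover have "mat_star (map_mat \<beta> p) = map_mat \<beta> (mat_star p)"
    using over sq by (intro eq_matI) (auto simp: mat_star_def mat_over_def auto_star)
  ultimately show ?thesis
    using sq over by (auto simp: mat_projections_def elements_mat_subset_iff pp ps mat_over_def auto_orbifold)
qed

lemma K0_rel_empty_refl: "p \<in> mat_projections orbifold \<Longrightarrow> ((p, 0\<^sub>m 0 0), (p, 0\<^sub>m 0 0)) \<in> K0_rel orbifold"
proof -
  assume p: "p \<in> mat_projections orbifold"
  have sq: "square_mat p" using p by (simp add: mat_projections_def)
  have z: "(0\<^sub>m 0 0 :: 'a mat) \<in> mat_projections orbifold"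
    by (auto simp: mat_projections_def mat_star_def elements_mat_subset_iff mat_over_def)
  have "mvn_equiv orbifold p p"
    unfolding mvn_equiv_def using p
    by (intro bexI[of _ p]) (auto simp: mat_projections_def intro!: carrier_matI)
  then have "mvn_equiv orbifold (p \<oplus>\<^sub>m 0\<^sub>m 0 0 \<oplus>\<^sub>m 0\<^sub>m 0 0) (p \<oplus>\<^sub>m 0\<^sub>m 0 0 \<oplus>\<^sub>m 0\<^sub>m 0 0)"
    by (simp add: orb.dsum_empty[OF sq])
  then show ?thesis using p z unfolding K0_rel_def by blast
qed

text \<open>A class fixed by \<open>\<beta>\<close> is a whole equivalence class, so it contains the pair of the projection and the
  pair of its image.\<close>

lemma K0_rel_auto:
  assumes K: "\<forall>X\<in>carrier (K0 orbifold). K0_map orbifold \<beta> X = X"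
    and p: "p \<in> mat_projections orbifold"
  shows "((p, 0\<^sub>m 0 0), (map_mat \<beta> p, 0\<^sub>m 0 0)) \<in> K0_rel orbifold"
proof -
  have z: "(0\<^sub>m 0 0 :: 'a mat) \<in> mat_projections orbifold"
    by (auto simp: mat_projections_def mat_star_def elements_mat_subset_iff mat_over_def)
  let ?X = "K0_rel orbifold `` {(p, 0\<^sub>m 0 0)}"
  have "?X \<in> carrier (K0 orbifold)"
    using p z by (auto simp: K0_def intro!: quotientI)
  then have fix_X: "K0_map orbifold \<beta> ?X = ?X" using K by blast
  have "(p, 0\<^sub>m 0 0) \<in> ?X" using K0_rel_empty_refl[OF p] by simp
  moreover have "map_mat \<beta> (0\<^sub>m 0 0) = 0\<^sub>m 0 0" by (intro eq_matI) auto
  ultimately have "K0_rel orbifold `` {(map_mat \<beta> p, 0\<^sub>m 0 0)} \<subseteq> K0_map orbifold \<beta> ?X"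
    unfolding K0_map_def by force
  moreover have "(map_mat \<beta> p, 0\<^sub>m 0 0) \<in> K0_rel orbifold `` {(map_mat \<beta> p, 0\<^sub>m 0 0)}"
    using K0_rel_empty_refl[OF auto_projection[OF p]] by simp
  ultimately show ?thesis using fix_X by auto
qed

lemma HC0_continuous_trace:
  assumes "\<phi> \<in> HC0 U V \<Phi>"
  shows "continuous_trace \<phi>"
proof -
  obtain k C where C: "\<And>x a. x \<in> smooth_orbifold \<Longrightarrow> smooth_series U V a x \<Longrightarrow> cmod (\<phi> x) \<le> C * schwartz_norm k a"
    using assms unfolding HC0_def by blast
  have "cmod (\<phi> x) \<le> C * frechet k x" if x: "x \<in> smooth_orbifold" for x
  proof -
    obtain a where "smooth_series U V a x"
      using smooth_orbifold_smooth[OF x] by (auto simp: smooth_algebra_def)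
    then show ?thesis using C[OF x] smooth_series_fcoeff by metis
  qed
  then show ?thesis
    using assms unfolding continuous_trace_def orb.is_trace_def HC0_def by blast
qed

text \<open>The pull-back of a continuous trace is again continuous, by \<open>auto_frechet_continuous\<close>.\<close>

lemma continuous_trace_auto_diff:
  assumes \<phi>: "continuous_trace \<phi>"
  shows "continuous_trace (\<lambda>x. \<phi> (\<beta> x) - \<phi> x)"
proof -
  have sc: "\<phi> (c *\<^sub>C x) = c * \<phi> x" if "x \<in> smooth_orbifold" for x c
    using \<phi> that by (simp add: continuous_trace_def)
  have tr: "\<phi> (x + y) = \<phi> x + \<phi> y" "\<phi> (x * y) = \<phi> (y * x)" if "x \<in> smooth_orbifold" "y \<in> smooth_orbifold" for x y
    using \<phi> that by (auto simp: continuous_trace_def orb.is_trace_def)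
  obtain k C where C: "\<And>x. x \<in> smooth_orbifold \<Longrightarrow> cmod (\<phi> x) \<le> C * frechet k x"
    using \<phi> unfolding continuous_trace_def by blast
  obtain K D where D: "\<And>x. x \<in> smooth_orbifold \<Longrightarrow> frechet k (\<beta> x) \<le> D * frechet K x"
    using auto_frechet_continuous by blast
  note so = smooth_orbifold_orbifold smooth_orbifold_smooth auto_smooth
  have bound: "cmod (\<phi> (\<beta> x) - \<phi> x) \<le> (\<bar>C\<bar> * \<bar>D\<bar> + \<bar>C\<bar>) * frechet (K + k) x" if x: "x \<in> smooth_orbifold" for x
  proof -
    have f0: "0 \<le> frechet j x" "0 \<le> frechet j (\<beta> x)" for j
      using x by (auto intro: frechet_nonneg so)
    have mono: "frechet K x \<le> frechet (K + k) x" "frechet k x \<le> frechet (K + k) x"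
      using x by (auto intro: frechet_mono so)
    have "cmod (\<phi> (\<beta> x)) \<le> C * frechet k (\<beta> x)" by (intro C auto_smooth x)
    also have "\<dots> \<le> \<bar>C\<bar> * (\<bar>D\<bar> * frechet (K + k) x)"
    proof (intro mult_mono)
      have "D * frechet K x \<le> \<bar>D\<bar> * frechet (K + k) x"
        using f0 mono by (intro mult_mono) auto
      then show "frechet k (\<beta> x) \<le> \<bar>D\<bar> * frechet (K + k) x" using D[OF x] by simp
    qed (use f0 in auto)
    finally have 1: "cmod (\<phi> (\<beta> x)) \<le> \<bar>C\<bar> * (\<bar>D\<bar> * frechet (K + k) x)" .
    have "cmod (\<phi> x) \<le> C * frechet k x" by (intro C x)
    also have "\<dots> \<le> \<bar>C\<bar> * frechet (K + k) x" using f0 mono by (intro mult_mono) auto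
    finally show ?thesis using 1 norm_triangle_ineq4[of "\<phi> (\<beta> x)" "\<phi> x"] by (simp add: algebra_simps)
  qed
  show ?thesis
    unfolding continuous_trace_def orb.is_trace_def
    using bound by (auto simp: auto_scaleC auto_add auto_mult so sc tr right_diff_distrib)
qed

theorem HC0_map_eq:
  assumes K: "\<forall>X\<in>carrier (K0 orbifold). K0_map orbifold \<beta> X = X"
    and \<phi>: "\<phi> \<in> HC0 U V \<Phi>"
  shows "HC0_map U V \<Phi> \<beta> \<phi> = \<phi>"
proof -
  note ct = HC0_continuous_trace[OF \<phi>]
  have tr: "orb.is_trace \<phi>" using ct by (simp add: continuous_trace_def)
  have eq: "\<phi> (\<beta> x) - \<phi> x = 0" if x: "x \<in> smooth_orbifold" for x
  proof (rule continuous_trace_eq_0[OF continuous_trace_auto_diff[OF ct] _ _ x])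
    show "\<phi> (\<beta> 1) - \<phi> 1 = 0" by (simp add: auto_1)
    fix p assume p: "p \<in> mat_projections orbifold" "mat_over smooth_orbifold p"
    have sq: "dim_row p = dim_col p" using p(1) by (auto simp: mat_projections_def)
    have "mat_over smooth_orbifold (map_mat \<beta> p)" using p(2) by (auto simp: mat_over_def auto_smooth)
    then have "mat_trace \<phi> p = mat_trace \<phi> (map_mat \<beta> p)"
      by (rule orb.trace_eq_of_K0_rel[OF tr p(2) _ K0_rel_auto[OF K p(1)]])
    then show "mat_trace (\<lambda>x. \<phi> (\<beta> x) - \<phi> x) p = 0"
      using sq by (simp add: mat_trace_def sum_subtractf)
  qed
  have "\<phi> \<in> extensional smooth_orbifold" using \<phi> by (simp add: HC0_def)
  then show ?thesis
    using eq by (auto simp: HC0_map_def compose_def fun_eq_iff extensional_def)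
qed

end

theorem corollary1p9:
  fixes \<theta> :: real and U V :: "'a::cstar_algebra" and \<Phi> \<beta> :: "'a \<Rightarrow> 'a"
  assumes "\<theta> \<notin> \<rat>"
    and "rotation_algebra \<theta> U V"
    and "is_flip U V \<Phi>"
    and "smooth_automorphism U V \<Phi> \<beta>"
    and "\<forall>X\<in>carrier (K0 (flip_orbifold \<Phi>)). K0_map (flip_orbifold \<Phi>) \<beta> X = X"
  shows "\<forall>\<phi>\<in>HC0 U V \<Phi>. HC0_map U V \<Phi> \<beta> \<phi> = \<phi>"
proof -
  interpret rotation_algebra \<theta> U V by fact
  interpret flip_orbifold_automorphism \<theta> U V \<Phi> \<beta>
    by unfold_locales (use assms in auto)
  show ?thesis using HC0_map_eq[OF assms(5)] by blast
qed

end
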